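(* Let $\mu_0,\mu_1,\mu_2\in\mathcal{P}_2^{\mathrm{ac}}(\mathbb{R}^d)$, let $\pi_{01},\pi_{02}$ be optimal IGW couplings of $(\mu_0,\mu_1)$ and $(\mu_0,\mu_2)$ with $A_1=\frac12\int xy^\intercal d\pi_{01}(x,y)$ and $A_2=\frac12\int xz^\intercal d\pi_{02}(x,z)$ symmetric positive definite, and let $(\nu_t)_{t\in[0,1]}$ be the corresponding modified generalized IGW geodesic between $\mu_1$ and $\mu_2$ with respect to $\mu_0$, with glued coupling $\pi$. Then $$\begin{aligned}\mathsf{H}(\nu_t\|\gamma)\le{}&(1-t)\mathsf{H}(\mu_1\|\gamma)+t\,\mathsf{H}(\mu_2\|\gamma)\\&+t\,\frac{8\sqrt2}{c_{1,\mu_0}}\,\beta_\pi\int_{(\mathbb{R}^d\times\mathbb{R}^d)^2}\big|\langle y,y'\rangle-\langle z,z'\rangle\big|^2d\pi_{1,2}\otimes\pi_{1,2}(y,z,y',z')\\&+t\,\frac{12\sqrt2}{c_{1,\mu_0}}\,\beta_\pi\,\mathsf{IGW}^2(\mu_1,\mu_0)+O(t^2),\end{aligned}$$ where $c_{1,\mu_0}=\lambda_{\min}(\Sigma_{\mu_0})>0$, $c_{2,\pi}>0$ is chosen such that $1/c_{2,\pi}\le\lambda_{\min}(A_i)\le\lambda_{\max}(A_i)\le c_{2,\pi}$ for $i=1,2$, and $$\beta_\pi=\frac{c_{2,\pi}}{2}M_2^{1/2}(\mu_0)M_2^{1/2}(\mu_1)+\frac{c_{2,\pi}^4}{4}M_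2(\mu_0)M_2(\mu_1).$$
   Context: $\mathcal{P}_2^{\mathrm{ac}}(\mathbb{R}^d)$: Borel probability measures on $\mathbb{R}^d$ with finite second moment that are absolutely continuous with respect to Lebesgue measure; $\Sigma_\mu=\int xx^\intercal d\mu(x)$; $M_2(\mu)=\int\|x\|^2d\mu(x)$; $\lambda_{\min},\lambda_{\max}$: smallest and largest eigenvalues; $\gamma=\mathcal{N}(0,I)$; $\mathsf{H}(\mu\|\gamma)=\int\log\frac{d\mu}{d\gamma}d\mu$ if $\mu\ll\gamma$, $+\infty$ otherwise. $\mathsf{IGW}(\mu,\nu)=\big(\inf_{\pi\in\Pi(\mu,\nu)}\int|\langle x,x'\rangle-\langle y,y'\rangle|^2d\pi\otimes\pi(x,y,x',y')\big)^{1/2}$ over couplings; minimizers are optimal IGW couplings. Modified generalized IGW geodesic: let $\phi_1,\phi_2$ be convex functions such that $T_i=(8A_i)^{-1}\nabla\phi_i$ is a Gromov--Monge map from $\mu_0$ to $\mu_i$, i.e. $(\mathrm{id},T_i)_\#\mu_0=\pi_{0i}$, $i=1,2$. Put $T_t=\big((1-t)(8A_1)^{-1}+t(8A_2)^{-1}\big)\big((1-t)\nabla\phi_1+t\nabla\phi_2\big)$ and $\nu_t=(T_t)_\#\mu_0$ for $t\in[0,1]$. The glued coupling is $\pi=(\mathrm{id},T_1,T_2)_\#\mu_0\in\Pi(\mu_0,\mu_1,\mu_2)$ (variables $(x,y,z)$) and $\pi_{1,2}$ is its $(y,z)$-marginal. The term $O(t^2)$ is as $t\to0^+$, with constant depending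 on the fixed data. *)

theory Defs
  imports "HOL-Probability.Probability" "HOL-Library.Landau_Symbols"
begin

definition P2ac :: "(real^'n) measure set" where
  "P2ac = {\<mu>. prob_space \<mu> \<and> sets \<mu> = sets borel \<and>
             integrable \<mu> (\<lambda>x. (norm x)\<^sup>2) \<and> absolutely_continuous lborel \<mu>}"

definition second_moment :: "(real^'n) measure \<Rightarrow> real" where
  "second_moment \<mu> = (\<integral>x. (norm x)\<^sup>2 \<partial>\<mu>)"

definition second_moment_matrix :: "(real^'n) measure \<Rightarrow> real^'n^'n" where
  "second_moment_matrix \<mu> = (\<chi> i j. \<integral>x. x $ i * x $ j \<partial>\<mu>)"

definition cross_moment_matrix :: "((real^'n) \<times> (real^'n)) measure \<Rightarrow> real^'n^'n" where
  "cross_moment_matrix \<pi> = (\<chi> i j. \<integral>(x, y). x $ i * y $ j \<partial>\<pi>)"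

definition matrix_eigenvalue :: "real^'n^'n \<Rightarrow> real \<Rightarrow> bool" where
  "matrix_eigenvalue A l \<longleftrightarrow> (\<exists>v. v \<noteq> 0 \<and> A *v v = l *\<^sub>R v)"

definition lambda_min :: "real^'n^'n \<Rightarrow> real" where
  "lambda_min A = (LEAST l. matrix_eigenvalue A l)"

definition lambda_max :: "real^'n^'n \<Rightarrow> real" where
  "lambda_max A = (GREATEST l. matrix_eigenvalue A l)"

definition sym_pos_def :: "real^'n^'n \<Rightarrow> bool" where
  "sym_pos_def A \<longleftrightarrow> transpose A = A \<and> (\<forall>v. v \<noteq> 0 \<longrightarrow> v \<bullet> (A *v v) > 0)"

definition std_gaussian :: "(real^'n) measure" where
  "std_gaussian = density lborel (\<lambda>x. ennreal (\<Prod>i\<in>UNIV. std_normal_density (x $ i)))"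

text \<open>For probability measures \<open>\<mu> \<lless> \<nu>\<close> the negative part of \<open>log (d\<mu>/d\<nu>)\<close> is always
  \<open>\<mu>\<close>-integrable, so non-integrability of the logarithm means that its integral is \<open>\<infinity>\<close>.
  The library functions take the reference measure first, and base \<open>exp 1\<close> gives the
  natural logarithm.\<close>

definition rel_entropy :: "'a measure \<Rightarrow> 'a measure \<Rightarrow> ereal" where
  "rel_entropy \<mu> \<nu> =
     (if absolutely_continuous \<nu> \<mu> \<and> integrable \<mu> (entropy_density (exp 1) \<nu> \<mu>)
      then ereal (KL_divergence (exp 1) \<nu> \<mu>) else \<infinity>)"

definition couplings ::
    "(real^'n) measure \<Rightarrow> (real^'n) measure \<Rightarrow> ((real^'n) \<times> (real^'n)) measure set" where
  "couplings \<mu> \<nu> = {\<pi>. sets \<pi> = sets borel \<and> distr \<pi> borel fst = \<mu> \<and> distr \<pi> borel snd = \<nu>}"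

text \<open>The integrand below is integrable as soon as both marginals have finite second moment,
  so on couplings of measures in \<^const>\<open>P2ac\<close> the Bochner integral is the usual one.\<close>

definition igw_cost :: "((real^'n) \<times> (real^'n)) measure \<Rightarrow> real" where
  "igw_cost \<pi> = (\<integral>((x, y), (x', y')). \<bar>x \<bullet> x' - y \<bullet> y'\<bar>\<^sup>2 \<partial>(\<pi> \<Otimes>\<^sub>M \<pi>))"

definition IGW :: "(real^'n) measure \<Rightarrow> (real^'n) measure \<Rightarrow> real" where
  "IGW \<mu> \<nu> = sqrt (INF \<pi>\<in>couplings \<mu> \<nu>. igw_cost \<pi>)"

definition optimal_igw_coupling ::
    "((real^'n) \<times> (real^'n)) measure \<Rightarrow> (real^'n) measure \<Rightarrow> (real^'n) measure \<Rightarrow> bool" where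
  "optimal_igw_coupling \<pi> \<mu> \<nu> \<longleftrightarrow>
     \<pi> \<in> couplings \<mu> \<nu> \<and> (\<forall>\<pi>'\<in>couplings \<mu> \<nu>. igw_cost \<pi> \<le> igw_cost \<pi>')"

text \<open>\<open>G\<close> is a Borel version of \<open>\<nabla>\<phi>\<close>, which is only defined \<open>\<mu>\<close>-almost everywhere.
  The potential may take the value \<open>\<infinity>\<close>, as Brenier potentials in general do: such a function
  is represented by its effective domain \<open>\<Omega>\<close> and its real values there, and the values of \<open>\<phi>\<close>
  outside \<open>\<Omega>\<close> are irrelevant. A finite convex function is the case \<open>\<Omega> = UNIV\<close>.\<close>

definition convex_potential_gradient ::
    "(real^'n) measure \<Rightarrow> (real^'n) set \<Rightarrow> (real^'n \<Rightarrow> real) \<Rightarrow> (real^'n \<Rightarrow> real^'n) \<Rightarrow> bool" where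
  "convex_potential_gradient \<mu> \<Omega> \<phi> G \<longleftrightarrow>
     convex_on \<Omega> \<phi> \<and> G \<in> borel_measurable borel \<and>
     (AE x in \<mu>. x \<in> interior \<Omega> \<and> (GDERIV \<phi> x :> G x))"

definition gm_map :: "real^'n^'n \<Rightarrow> (real^'n \<Rightarrow> real^'n) \<Rightarrow> real^'n \<Rightarrow> real^'n" where
  "gm_map A G x = matrix_inv (8 *\<^sub>R A) *v G x"

definition mod_geodesic_map ::
    "real^'n^'n \<Rightarrow> (real^'n \<Rightarrow> real^'n) \<Rightarrow> real^'n^'n \<Rightarrow> (real^'n \<Rightarrow> real^'n) \<Rightarrow>
     real \<Rightarrow> real^'n \<Rightarrow> real^'n" where
  "mod_geodesic_map A1 G1 A2 G2 t x =
     ((1 - t) *\<^sub>R matrix_inv (8 *\<^sub>R A1) + t *\<^sub>R matrix_inv (8 *\<^sub>R A2)) *v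
     ((1 - t) *\<^sub>R G1 x + t *\<^sub>R G2 x)"

definition mod_igw_geodesic ::
    "(real^'n) measure \<Rightarrow> real^'n^'n \<Rightarrow> (real^'n \<Rightarrow> real^'n) \<Rightarrow>
     real^'n^'n \<Rightarrow> (real^'n \<Rightarrow> real^'n) \<Rightarrow> real \<Rightarrow> (real^'n) measure" where
  "mod_igw_geodesic \<mu>0 A1 G1 A2 G2 t = distr \<mu>0 borel (mod_geodesic_map A1 G1 A2 G2 t)"

end

theory Submission
  imports Defs
begin

text \<open>Write \<open>T\<^sub>t = B\<^sub>t G\<^sub>t\<close> with \<open>B\<^sub>t = (1-t)(8 A1)\<inverse> + t(8 A2)\<inverse>\<close> and
  \<open>G\<^sub>t = (1-t)\<nabla>\<phi>1 + t\<nabla>\<phi>2\<close>. Almost everywhere \<open>G\<^sub>t\<close> has a symmetric positive definite derivative: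
  the resolvent \<open>(id + \<partial>\<phi>)\<inverse>\<close> is Lipschitz, hence differentiable almost everywhere by Rademacher's
  theorem, and its critical values are negligible by Sard's lemma, so that it can be inverted;
  absolute continuity of the end points excludes a singular derivative. The change of variables
  formula expresses the density of \<open>\<nu>\<^sub>t\<close> along \<open>T\<^sub>t\<close> by \<open>det B\<^sub>t\<close> and \<open>det DG\<^sub>t\<close>, and concavity of
  \<open>ln det\<close> keeps the Lebesgue entropy below its linear interpolation.

  The Gaussian adds \<open>M\<^sub>2(\<nu>\<^sub>t)/2\<close>, a polynomial in \<open>t\<close>. Its defect from the linear interpolation is,
  to first order in \<open>t\<close>, at most \<open>\<beta> E|z - y|\<^sup>2\<close>. Finally \<open>E|x - y|\<^sup>2\<close> and \<open>E|x - z|\<^sup>2\<close> are bounded by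
  \<open>2/c1\<close> times the inner product distortion, because the cross moments are symmetric and positive,
  and the distortion itself satisfies a triangle inequality.\<close>

text \<open>A product of a varying matrix and a varying gradient is not itself a gradient. It stays
  tractable because matrices and gradients are interpolated separately: the Jacobian determinant is
  the product of two determinants of convex combinations of symmetric positive definite matrices,
  and \<open>ln det\<close> is concave in each factor. Injectivity comes from monotonicity of
  \<open>G\<^sub>t\<close> alone, since \<open>B\<^sub>t\<close> is invertible. The gradients are
  known only almost everywhere, on a Borel set that contains no neighbourhoods. Their derivatives
  are therefore taken relative to that set, which both Sard's lemma and the area formula permit; the
  limits behind them are taken for the resolvent, a Lipschitz map of the whole space. The entropies
  of the end points may be infinite, so the comparison is made pointwise along the maps and
  integrated only once. The upper bound then also yields finiteness of the entropy of
  \<open>\<nu>\<^sub>t\<close>. The error term is \<open>C t\<^sup>2\<close> on all of [0,1], not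
  only near 0.\<close>

section \<open>Change of variables over an arbitrary finite index type\<close>

text \<open>The library proves Sard's lemma and the change of variables formula only for index types of
  class \<open>wellorder\<close>. A copy of the index type, ordered by an enumeration, carries them over.\<close>

typedef 'n wo = "UNIV :: 'n set" morphisms of_wo to_wo ..

lemma of_wo_inverse' [simp]: "to_wo (of_wo i) = i" and to_wo_inverse' [simp]: "of_wo (to_wo j) = j"
  by (simp_all add: of_wo_inverse to_wo_inverse)

lemma bij_of_wo: "bij of_wo"
  by (rule o_bij[where g = to_wo]) (simp_all add: fun_eq_iff)

lemma bij_to_wo: "bij to_wo"
  by (rule o_bij[where g = of_wo]) (simp_all add: fun_eq_iff)

instance wo :: (finite) finite
proof
  have "(UNIV :: 'a wo set) = to_wo ` UNIV"
    using bij_is_surj[OF bij_to_wo] by (rule sym)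
  then show "finite (UNIV :: 'a wo set)"
    using finite_imageI[OF finite] by (rule ssubst)
qed

instantiation wo :: (finite) wellorder
begin

definition less_eq_wo :: "'a wo \<Rightarrow> 'a wo \<Rightarrow> bool" where
  "less_eq_wo x y \<longleftrightarrow> to_nat (of_wo x) \<le> to_nat (of_wo y)"

definition less_wo :: "'a wo \<Rightarrow> 'a wo \<Rightarrow> bool" where
  "less_wo x y \<longleftrightarrow> to_nat (of_wo x) < to_nat (of_wo y)"

instance
proof
  fix x y z :: "'a wo" and P :: "'a wo \<Rightarrow> bool"
  show "(x < y) = (x \<le> y \<and> \<not> y \<le> x)" "x \<le> x" "x \<le> y \<or> y \<le> x"
    "x \<le> y \<Longrightarrow> y \<le> z \<Longrightarrow> x \<le> z"
    by (auto simp: less_eq_wo_def less_wo_def)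
  show "x \<le> y \<Longrightarrow> y \<le> x \<Longrightarrow> x = y"
    by (auto simp: less_eq_wo_def of_wo_inject)
  assume *: "\<And>x. (\<And>y. y < x \<Longrightarrow> P y) \<Longrightarrow> P x"
  show "P x"
  proof (induction "to_nat (of_wo x)" arbitrary: x rule: less_induct)
    case less
    show ?case by (rule *) (rule less, simp add: less_wo_def)
  qed
qed

end

definition to_wo_vec :: "real^'n::finite \<Rightarrow> real^'n wo" where
  "to_wo_vec x = (\<chi> i. x $ of_wo i)"

definition of_wo_vec :: "real^'n::finite wo \<Rightarrow> real^'n" where
  "of_wo_vec x = (\<chi> i. x $ to_wo i)"

lemma of_wo_vec_inverse [simp]: "to_wo_vec (of_wo_vec x) = x"
  and to_wo_vec_inverse [simp]: "of_wo_vec (to_wo_vec y) = y"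
  by (simp_all add: to_wo_vec_def of_wo_vec_def vec_eq_iff)

lemma linear_to_wo_vec: "linear to_wo_vec" and linear_of_wo_vec: "linear of_wo_vec"
  by (auto intro!: linearI simp: to_wo_vec_def of_wo_vec_def vec_eq_iff)

lemma bounded_linear_to_wo_vec: "bounded_linear (to_wo_vec :: real^'n::finite \<Rightarrow> _)"
  and bounded_linear_of_wo_vec: "bounded_linear (of_wo_vec :: _ \<Rightarrow> real^'n::finite)"
  by (simp_all add: linear_conv_bounded_linear[symmetric] linear_to_wo_vec linear_of_wo_vec)

lemma measurable_to_wo_vec [measurable]: "to_wo_vec \<in> borel \<rightarrow>\<^sub>M borel"
  and measurable_of_wo_vec [measurable]: "of_wo_vec \<in> borel \<rightarrow>\<^sub>M borel"
  by (auto intro!: borel_measurable_continuous_onI linear_continuous_on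
      bounded_linear_to_wo_vec bounded_linear_of_wo_vec)

text \<open>In the Leibniz sum each permutation is conjugated with the bijection
  \<open>to_wo\<close>; conjugation keeps the sign and only renames the factors of the
  product.\<close>

lemma det_reindex:
  fixes A :: "'a::comm_ring_1^'n::finite^'n"
  shows "det ((\<chi> i j. A $ of_wo i $ of_wo j) :: 'a^'n wo^'n wo) = det A"
proof -
  let ?m = "map_permutation UNIV (to_wo :: 'n \<Rightarrow> 'n wo)"
  have inj: "inj (to_wo :: 'n \<Rightarrow> 'n wo)" using bij_to_wo by (rule bij_is_inj)
  have app: "?m p i = to_wo (p (of_wo i))" for p i
    using map_permutation_apply[of to_wo UNIV "of_wo i" p] inj by simp
  have perm: "?m p permutes UNIV" if "p permutes UNIV" for p
    using map_permutation_permutes[OF bij_to_wo that] by simp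
  have "det A = (\<Sum>p | p permutes (UNIV :: 'n set). of_int (sign p) * (\<Prod>i\<in>UNIV. A $ i $ p i))"
    by (simp add: det_def)
  also have "\<dots> = (\<Sum>q | q permutes (UNIV :: 'n wo set). of_int (sign q) * (\<Prod>i\<in>UNIV. A $ of_wo i $ of_wo (q i)))"
  proof (rule sum.reindex_bij_witness[where i = "\<lambda>q. of_wo \<circ> q \<circ> to_wo" and j = ?m])
    fix p :: "'n \<Rightarrow> 'n" assume "p \<in> {p. p permutes UNIV}"
    then have p: "p permutes UNIV" by simp
    show "of_wo \<circ> ?m p \<circ> to_wo = p" by (auto simp: app)
    show "?m p \<in> {q. q permutes UNIV}" using perm[OF p] by simp
    have "sign (?m p) = sign p"
      using p inj by (intro sign_map_permutation) auto
    moreover have "(\<Prod>i\<in>UNIV. A $ of_wo i $ of_wo (?m p i)) = (\<Prod>i\<in>UNIV. A $ i $ p i)"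
      by (rule prod.reindex_bij_witness[where j = of_wo and i = to_wo]) (auto simp: app)
    ultimately show "of_int (sign (?m p)) * (\<Prod>i\<in>UNIV. A $ of_wo i $ of_wo (?m p i)) =
        of_int (sign p) * (\<Prod>i\<in>UNIV. A $ i $ p i)" by simp
  next
    fix q :: "'n wo \<Rightarrow> 'n wo" assume "q \<in> {q. q permutes UNIV}"
    then have "bij q" by (simp add: permutes_bij)
    then show "of_wo \<circ> q \<circ> to_wo \<in> {p. p permutes UNIV}"
      using bij_of_wo bij_to_wo by (auto intro!: bij_imp_permutes bij_comp)
    show "?m (of_wo \<circ> q \<circ> to_wo) = q" by (auto simp: app)
  qed
  finally show ?thesis by (simp add: det_def)
qed

lemma det_matrix_conj_wo:
  fixes f :: "real^'n::finite \<Rightarrow> real^'n"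
  shows "det (matrix (to_wo_vec \<circ> f \<circ> of_wo_vec)) = det (matrix f)"
proof -
  have *: "of_wo_vec (axis j 1) = axis (of_wo j) (1::real)" for j :: "'n wo"
    by (auto simp: of_wo_vec_def axis_def vec_eq_iff)
  have "matrix (to_wo_vec \<circ> f \<circ> of_wo_vec) = (\<chi> i j. matrix f $ of_wo i $ of_wo j)"
    by (simp add: matrix_def to_wo_vec_def * vec_eq_iff)
  then show ?thesis by (simp add: det_reindex)
qed

text \<open>Lebesgue measure is determined by its values on boxes, and renaming coordinates sends a
  box to a box with the same side lengths.\<close>

lemma distr_of_wo_vec: "distr lborel borel (of_wo_vec :: _ \<Rightarrow> real^'n::finite) = lborel"
proof (rule lborel_eqI[symmetric])
  fix l u :: "real^'n" assume lu: "\<And>b. b \<in> Basis \<Longrightarrow> l \<bullet> b \<le> u \<bullet> b"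
  have eq: "of_wo_vec -` box l u = box (to_wo_vec l) (to_wo_vec u)"
    by (auto simp: mem_box_cart of_wo_vec_def to_wo_vec_def) (metis of_wo_inverse' to_wo_inverse')+
  have le: "l $ i \<le> u $ i" for i
    using lu[of "axis i 1"] by (simp add: axis_in_Basis_iff inner_axis)
  have cart: "(\<Prod>b\<in>Basis. v \<bullet> b) = (\<Prod>i\<in>UNIV. v $ i)" for v :: "real^'m"
    by (simp add: Basis_vec_def UNION_singleton_eq_range prod.reindex inj_on_def axis_eq_axis inner_axis)
  have "emeasure (distr lborel borel of_wo_vec) (box l u) = emeasure lborel (box (to_wo_vec l) (to_wo_vec u))"
    by (simp add: emeasure_distr eq)
  also have "\<dots> = (\<Prod>b\<in>Basis. (to_wo_vec u - to_wo_vec l) \<bullet> b)"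
    using le by (intro emeasure_lborel_box) (auto simp: Basis_vec_def inner_axis to_wo_vec_def)
  also have "(\<Prod>b\<in>Basis. (to_wo_vec u - to_wo_vec l) \<bullet> b) = (\<Prod>b\<in>Basis. (u - l) \<bullet> b)"
    unfolding cart by (rule prod.reindex_bij_witness[where j = of_wo and i = to_wo]) (auto simp: to_wo_vec_def)
  finally show "emeasure (distr lborel borel of_wo_vec) (box l u) = (\<Prod>b\<in>Basis. (u - l) \<bullet> b)" .
qed simp

lemma distr_to_wo_vec: "distr lborel borel (to_wo_vec :: real^'n::finite \<Rightarrow> _) = lborel"
proof -
  have "distr lborel borel to_wo_vec = distr (distr lborel borel of_wo_vec) borel (to_wo_vec :: real^'n \<Rightarrow> _)"
    by (simp add: distr_of_wo_vec)
  also have "\<dots> = distr lborel borel (\<lambda>x. x)"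
    by (subst distr_distr) (auto simp: o_def)
  finally show ?thesis by (simp add: distr_id2)
qed

text \<open>Images under differentiable maps are in general Lebesgue but not Borel measurable, so
  the transfer must respect completed measures. Preservation of the Borel measure makes preimages of
  null sets null, and this extends measurability to the completion.\<close>

lemma lebesgue_measure_preserving:
  fixes f :: "'a::euclidean_space \<Rightarrow> 'b::euclidean_space"
  assumes [measurable]: "f \<in> borel \<rightarrow>\<^sub>M borel" and "distr lborel borel f = lborel"
  shows "f \<in> lebesgue \<rightarrow>\<^sub>M lebesgue" and "distr lebesgue lebesgue f = lebesgue"
proof -
  have d: "distr lebesgue lborel f = lborel"
    using assms(2) by (subst distr_completion) (auto cong: distr_cong)
  show "f \<in> lebesgue \<rightarrow>\<^sub>M lebesgue"
    by (rule completion.measurable_completion2) (auto simp: d measurable_completion)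
  show "distr lebesgue lebesgue f = lebesgue"
    using completion.completion_distr_eq[of f lborel lborel]
    by (simp add: d measurable_completion)
qed

lemma lebesgue_to_wo_vec: "to_wo_vec \<in> lebesgue \<rightarrow>\<^sub>M lebesgue"
    "distr lebesgue lebesgue (to_wo_vec :: real^'n::finite \<Rightarrow> _) = lebesgue"
  and lebesgue_of_wo_vec: "of_wo_vec \<in> lebesgue \<rightarrow>\<^sub>M lebesgue"
    "distr lebesgue lebesgue (of_wo_vec :: _ \<Rightarrow> real^'n::finite) = lebesgue"
  by (auto intro!: lebesgue_measure_preserving distr_to_wo_vec distr_of_wo_vec)

lemma image_to_wo_vec: "to_wo_vec ` S = of_wo_vec -` S"
  by (auto simp: image_iff intro: exI[of _ "of_wo_vec _"] of_wo_vec_inverse[symmetric])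

lemma inj_to_wo_vec [simp]: "to_wo_vec x = to_wo_vec y \<longleftrightarrow> x = y"
  by (metis to_wo_vec_inverse)

lemma conj_wo_image: "f ` S = to_wo_vec -` ((to_wo_vec \<circ> f \<circ> of_wo_vec) ` to_wo_vec ` S)"
  by (auto simp: image_image)

lemma has_derivative_conj_wo:
  fixes f :: "real^'n::finite \<Rightarrow> real^'n"
  assumes "(f has_derivative f') (at x within S)"
  shows "((to_wo_vec \<circ> f \<circ> of_wo_vec) has_derivative (to_wo_vec \<circ> f' \<circ> of_wo_vec))
           (at (to_wo_vec x) within to_wo_vec ` S)"
proof -
  have "(of_wo_vec has_derivative of_wo_vec) (at (to_wo_vec x) within to_wo_vec ` S)"
    by (rule bounded_linear_imp_has_derivative[OF bounded_linear_of_wo_vec])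
  moreover have "of_wo_vec ` to_wo_vec ` S = S"
    by (simp add: image_image)
  ultimately have "((f \<circ> of_wo_vec) has_derivative (f' \<circ> of_wo_vec)) (at (to_wo_vec x) within to_wo_vec ` S)"
    using assms by (intro diff_chain_within) simp_all
  from diff_chain_within[OF this bounded_linear_imp_has_derivative[OF bounded_linear_to_wo_vec]]
  show ?thesis by (simp only: comp_assoc)
qed

text \<open>An identity in \<open>ennreal\<close> rather than for finite measures, so that it
  applies to any measurable \<open>S\<close>: the formula for finite values shows that one side is
  finite only if the other is, and otherwise both are infinite.\<close>

lemma emeasure_differentiable_image_wo:
  fixes f :: "real^'n::{finite,wellorder} \<Rightarrow> real^'n::_"
  assumes S: "S \<in> sets lebesgue"
    and der: "\<And>x. x \<in> S \<Longrightarrow> (f has_derivative f' x) (at x within S)"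
    and inj: "inj_on f S"
  shows "f ` S \<in> sets lebesgue"
    and "(\<lambda>x. ennreal \<bar>det (matrix (f' x))\<bar> * indicator S x) \<in> borel_measurable lebesgue"
    and "emeasure lebesgue (f ` S) = (\<integral>\<^sup>+x. ennreal \<bar>det (matrix (f' x))\<bar> * indicator S x \<partial>lebesgue)"
proof -
  let ?h = "\<lambda>x. \<bar>det (matrix (f' x))\<bar>"
  show im: "f ` S \<in> sets lebesgue"
  proof (rule differentiable_image_in_sets_lebesgue)
    show "f differentiable_on S"
      unfolding differentiable_on_def differentiable_def using der by blast
  qed (use S in auto)
  have "?h \<in> borel_measurable (lebesgue_on S)"
    using borel_measurable_det_Jacobian[OF S der] by (rule borel_measurable_abs)
  then have m: "(\<lambda>x. if x \<in> S then ?h x else 0) \<in> borel_measurable lebesgue"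
    using S by (simp add: borel_measurable_if)
  then have "(\<lambda>x. ennreal (if x \<in> S then ?h x else 0)) \<in> borel_measurable lebesgue"
    by (rule measurable_compose[OF _ measurable_ennreal])
  moreover have eq: "(\<lambda>x. ennreal (if x \<in> S then ?h x else 0)) = (\<lambda>x. ennreal (?h x) * indicator S x)"
    by (auto simp: indicator_def)
  ultimately show "(\<lambda>x. ennreal (?h x) * indicator S x) \<in> borel_measurable lebesgue" by simp
  have hi: "(?h has_integral m) S \<longleftrightarrow> 0 \<le> m \<and> (\<integral>\<^sup>+x. ennreal (?h x) * indicator S x \<partial>lebesgue) = ennreal m" for m
  proof -
    have "(?h has_integral m) S \<longleftrightarrow> ((\<lambda>x. if x \<in> S then ?h x else 0) has_integral m) UNIV"
      by (simp add: has_integral_restrict_UNIV)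
    also have "\<dots> \<longleftrightarrow> 0 \<le> m \<and> (\<integral>\<^sup>+x. ennreal (if x \<in> S then ?h x else 0) \<partial>lebesgue) = ennreal m"
      using m by (subst has_integral_iff_nn_integral_lebesgue) auto
    finally show ?thesis unfolding eq .
  qed
  note * = has_measure_differentiable_image[OF S der inj]
  show "emeasure lebesgue (f ` S) = (\<integral>\<^sup>+x. ennreal (?h x) * indicator S x \<partial>lebesgue)"
  proof (cases "f ` S \<in> lmeasurable")
    case True
    then have "(?h has_integral measure lebesgue (f ` S)) S"
      using *[of "measure lebesgue (f ` S)"] True by simp
    then have "(\<integral>\<^sup>+x. ennreal (?h x) * indicator S x \<partial>lebesgue) = ennreal (measure lebesgue (f ` S))"
      by (simp only: hi)
    then show ?thesis
      using True by (simp only: emeasure_eq_measure2)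
  next
    case False
    have "(\<integral>\<^sup>+x. ennreal (?h x) * indicator S x \<partial>lebesgue) = \<infinity>"
    proof (rule ccontr)
      assume "\<not> ?thesis"
      then obtain m where "0 \<le> m" "(\<integral>\<^sup>+x. ennreal (?h x) * indicator S x \<partial>lebesgue) = ennreal m"
        by (cases "\<integral>\<^sup>+x. ennreal (?h x) * indicator S x \<partial>lebesgue" rule: ennreal_cases) auto
      then have "(?h has_integral m) S" by (simp only: hi)
      then show False using *[of m] False by simp
    qed
    moreover have "emeasure lebesgue (f ` S) = \<infinity>"
    proof (rule ccontr)
      assume "emeasure lebesgue (f ` S) \<noteq> \<infinity>"
      then have "f ` S \<in> lmeasurable"
        using im by (intro fmeasurableI) (simp_all only: less_top infinity_ennreal_def)
      then show False using False by contradiction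
    qed
    ultimately show ?thesis by simp
  qed
qed

lemma emeasure_differentiable_image:
  fixes f :: "real^'n \<Rightarrow> real^'n"
  assumes S: "S \<in> sets lebesgue"
    and der: "\<And>x. x \<in> S \<Longrightarrow> (f has_derivative f' x) (at x within S)"
    and inj: "inj_on f S"
  shows "f ` S \<in> sets lebesgue" (is ?A)
    and "(\<lambda>x. ennreal \<bar>det (matrix (f' x))\<bar> * indicator S x) \<in> borel_measurable lebesgue" (is ?B)
    and "emeasure lebesgue (f ` S) = (\<integral>\<^sup>+x. ennreal \<bar>det (matrix (f' x))\<bar> * indicator S x \<partial>lebesgue)" (is ?C)
proof -
  let ?S = "to_wo_vec ` S" and ?f = "to_wo_vec \<circ> f \<circ> of_wo_vec"
  let ?f' = "\<lambda>y. to_wo_vec \<circ> f' (of_wo_vec y) \<circ> of_wo_vec"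
  have S': "?S \<in> sets lebesgue"
    using measurable_sets[OF lebesgue_of_wo_vec(1) S] by (simp add: image_to_wo_vec)
  have der': "(?f has_derivative ?f' y) (at y within ?S)" if "y \<in> ?S" for y
    using that has_derivative_conj_wo[OF der] by auto
  have inj': "inj_on ?f ?S"
    using inj by (auto simp: inj_on_def)
  note wo = emeasure_differentiable_image_wo[OF S' der' inj', unfolded det_matrix_conj_wo]
  have im: "f ` S = to_wo_vec -` (?f ` ?S)"
    by (rule conj_wo_image)
  have h: "(\<lambda>x. ennreal \<bar>det (matrix (f' x))\<bar> * indicator S x) =
      (\<lambda>y. ennreal \<bar>det (matrix (f' (of_wo_vec y)))\<bar> * indicator ?S y) \<circ> to_wo_vec"
    by (auto simp: fun_eq_iff indicator_def)
  show ?A unfolding im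
    using measurable_sets[OF lebesgue_to_wo_vec(1) wo(1)] by simp
  show ?B unfolding h
    by (rule measurable_comp[OF lebesgue_to_wo_vec(1) wo(2)])
  have "emeasure lebesgue (f ` S) = emeasure (distr lebesgue lebesgue to_wo_vec) (?f ` ?S)"
    unfolding im by (subst emeasure_distr) (use lebesgue_to_wo_vec(1) wo(1) in auto)
  also have "\<dots> = emeasure lebesgue (?f ` ?S)"
    by (simp only: lebesgue_to_wo_vec(2))
  also have "\<dots> = (\<integral>\<^sup>+y. ennreal \<bar>det (matrix (f' (of_wo_vec y)))\<bar> * indicator ?S y
      \<partial>distr lebesgue lebesgue to_wo_vec)"
    by (simp only: wo(3) lebesgue_to_wo_vec(2))
  also have "\<dots> = (\<integral>\<^sup>+x. ennreal \<bar>det (matrix (f' x))\<bar> * indicator S x \<partial>lebesgue)"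
    unfolding h o_def by (rule nn_integral_distr) (use lebesgue_to_wo_vec(1) wo(2) in auto)
  finally show ?C .
qed

text \<open>Sard's lemma in equal dimensions, where a zero determinant is a rank deficit.
  Differentiability within \<open>S\<close> suffices, so it covers both the critical points of the
  resolvent and a map known to be differentiable only along a set of full measure.\<close>

lemma negligible_singular_image:
  fixes f :: "real^'n \<Rightarrow> real^'n"
  assumes der: "\<And>x. x \<in> S \<Longrightarrow> (f has_derivative f' x) (at x within S)"
    and sing: "\<And>x. x \<in> S \<Longrightarrow> det (matrix (f' x)) = 0"
  shows "negligible (f ` S)"
proof -
  let ?S = "to_wo_vec ` S" and ?f = "to_wo_vec \<circ> f \<circ> of_wo_vec"
  let ?f' = "\<lambda>y. to_wo_vec \<circ> f' (of_wo_vec y) \<circ> of_wo_vec"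
  have "negligible (?f ` ?S)"
  proof (rule baby_Sard)
    fix y assume y: "y \<in> ?S"
    show "(?f has_derivative ?f' y) (at y within ?S)"
      using y has_derivative_conj_wo[OF der] by auto
    have "det (matrix (?f' y)) = 0"
      using y sing by (auto simp: det_matrix_conj_wo)
    then show "rank (matrix (?f' y)) < CARD('n wo)"
      by (simp add: det_eq_0_rank)
  qed simp
  moreover have im: "f ` S = to_wo_vec -` (?f ` ?S)"
    by (rule conj_wo_image)
  ultimately show ?thesis
    unfolding negligible_iff_null_sets im
    using null_sets_distr_iff[OF lebesgue_to_wo_vec(1), of "?f ` ?S"]
    by (simp add: lebesgue_to_wo_vec(2))
qed

section \<open>Rademacher's theorem\<close>

text \<open>The increments are masses of half-open intervals for the Stieltjes measure of
  \<open>f\<close>; disjoint intervals inside \<open>{a<..b}\<close> together have at most its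
  mass.\<close>

lemma sum_increments_disjoint_le:
  fixes f :: "real \<Rightarrow> real" and l u :: "'i \<Rightarrow> real"
  assumes mono: "mono f" and cont: "continuous_on UNIV f" and fin: "finite F" and "a \<le> b"
    and lu: "\<And>i. i \<in> F \<Longrightarrow> l i \<le> u i" and sub: "\<And>i. i \<in> F \<Longrightarrow> {l i..u i} \<subseteq> {a..b}"
    and disj: "disjoint_family_on (\<lambda>i. {l i..u i}) F"
  shows "(\<Sum>i\<in>F. f (u i) - f (l i)) \<le> f b - f a"
proof -
  let ?M = "interval_measure f"
  have contr: "continuous (at_right x) f" for x
    by (rule continuous_at_imp_continuous_at_within) (use cont in \<open>simp add: continuous_on_eq_continuous_at\<close>)
  have m: "emeasure ?M {x<..y} = ennreal (f y - f x)" if "x \<le> y" for x y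
    by (rule emeasure_interval_measure_Ioc[OF that]) (rule monoD[OF mono], simp, rule contr)
  have "ennreal (\<Sum>i\<in>F. f (u i) - f (l i)) = (\<Sum>i\<in>F. emeasure ?M {l i<..u i})"
  proof -
    have "(\<Sum>i\<in>F. emeasure ?M {l i<..u i}) = (\<Sum>i\<in>F. ennreal (f (u i) - f (l i)))"
      by (rule sum.cong) (use lu m in auto)
    also have "\<dots> = ennreal (\<Sum>i\<in>F. f (u i) - f (l i))"
      by (rule sum_ennreal) (use lu monoD[OF mono] in auto)
    finally show ?thesis by (rule sym)
  qed
  also have "\<dots> = emeasure ?M (\<Union>i\<in>F. {l i<..u i})"
  proof (rule sum_emeasure)
    show "disjoint_family_on (\<lambda>i. {l i<..u i}) F"
      unfolding disjoint_family_on_def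
    proof (intro ballI impI)
      fix i j assume "i \<in> F" "j \<in> F" "i \<noteq> j"
      with disj have "{l i..u i} \<inter> {l j..u j} = {}" by (auto simp only: disjoint_family_on_def)
      moreover have "{l i<..u i} \<subseteq> {l i..u i}" "{l j<..u j} \<subseteq> {l j..u j}" by auto
      ultimately show "{l i<..u i} \<inter> {l j<..u j} = {}" by blast
    qed
  qed (use fin in auto)
  also have "\<dots> \<le> emeasure ?M {a<..b}"
  proof (rule emeasure_mono)
    show "(\<Union>i\<in>F. {l i<..u i}) \<subseteq> {a<..b}"
    proof safe
      fix i x assume "i \<in> F" "x \<in> {l i<..u i}"
      with sub[of i] lu[of i] have "a \<le> l i" "u i \<le> b" by auto
      with \<open>x \<in> {l i<..u i}\<close> show "x \<in> {a<..b}" by auto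
    qed
  qed simp
  also have "\<dots> = ennreal (f b - f a)"
    using \<open>a \<le> b\<close> by (rule m)
  finally show ?thesis
    using monoD[OF mono \<open>a \<le> b\<close>] by (simp add: ennreal_le_iff)
qed

text \<open>The intervals between \<open>x\<close> and \<open>x + s k\<close> on which the difference quotient nearly exceeds
  \<open>U x\<close> form a Vitali cover; on finitely many disjoint ones of nearly full measure, Henstock's lemma
  compares the increments of \<open>f\<close> with the integral of \<open>U\<close>.\<close>

lemma integral_upper_derivative_le:
  fixes f U :: "real \<Rightarrow> real" and s :: "nat \<Rightarrow> real"
  assumes mono: "mono f" and lip: "L-lipschitz_on UNIV f" and ab: "a < b"
    and s0: "\<And>k. s k \<noteq> 0" and s: "s \<longlonglongrightarrow> 0"
    and int: "U integrable_on {a..b}" and U: "\<And>x. 0 \<le> U x" "\<And>x. U x \<le> L"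
    and limsup: "\<And>x e n. 0 < e \<Longrightarrow> \<exists>k\<ge>n. U x - e < (f (x + s k) - f x) / s k"
  shows "integral {a..b} U \<le> f b - f a"
proof (rule field_le_epsilon)
  fix e :: real assume "e > 0"
  have L: "0 \<le> L" using lip by (rule lipschitz_on_nonneg)
  \<comment> \<open>The three errors are \<open>L * d\<close> from the uncovered remainder,
    \<open>d * (b - a)\<close> from the difference quotients and \<open>d\<close> from Henstock's
    lemma; this choice makes their sum \<open>e\<close>.\<close>
  define d where "d = e / (L + 1 + (b - a))"
  have "d > 0" using \<open>e > 0\<close> L ab by (simp add: d_def)
  have de: "d * (L + 1 + (b - a)) = e" using L ab by (simp add: d_def)
  obtain \<gamma> where \<gamma>: "gauge \<gamma>"
    and hen: "\<And>p. p tagged_partial_division_of (cbox a b) \<Longrightarrow> \<gamma> fine p \<Longrightarrow>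
      (\<Sum>(x,K)\<in>p. norm (measure lborel K *\<^sub>R U x - integral K U)) < d"
    using Henstock_lemma[of U a b d] int \<open>d > 0\<close> by auto
  define I where "I = (\<lambda>(x,k). cball (x + s k / 2) (\<bar>s k\<bar> / 2))"
  define lo where "lo = (\<lambda>(x,k). min x (x + s k))"
  define hi where "hi = (\<lambda>(x,k). max x (x + s k))"
  have Ieq: "I i = {lo i..hi i}" and lohi: "lo i < hi i" and xI: "fst i \<in> I i" for i
    using s0[of "snd i"] by (auto simp: I_def lo_def hi_def cball_eq_atLeastAtMost min_def max_def abs_if split: prod.splits)
  \<comment> \<open>Containment in \<open>\<gamma> x\<close> is built into the cover, so that any
    finite disjoint subfamily is automatically \<open>\<gamma>\<close>-fine.\<close>
  define K where "K = {(x,k). x \<in> {a<..<b} \<and> I (x,k) \<subseteq> {a<..<b} \<and> I (x,k) \<subseteq> \<gamma> x \<and>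
     U x - d < (f (x + s k) - f x) / s k}"
  obtain C where C: "countable C" "C \<subseteq> K"
    and dis: "pairwise (\<lambda>i j. disjnt (I i) (I j)) C"
    and neg: "negligible ({a<..<b} - (\<Union>i\<in>C. I i))"
  proof (rule Vitali_covering_theorem_cballs[of K "\<lambda>(x,k). \<bar>s k\<bar> / 2" "{a<..<b}" "\<lambda>(x,k). x + s k / 2"])
    show "0 < (case i of (x, k) \<Rightarrow> \<bar>s k\<bar> / 2)" for i
      using s0 by (auto split: prod.splits)
    fix x r :: real assume x: "x \<in> {a<..<b}" and r: "0 < r"
    have "open ({a<..<b} \<inter> \<gamma> x)" "x \<in> {a<..<b} \<inter> \<gamma> x"
      using x \<gamma> by (auto simp: gauge_def open_Int)
    then obtain r1 where r1: "r1 > 0" "ball x r1 \<subseteq> {a<..<b} \<inter> \<gamma> x"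
      by (rule openE)
    have "eventually (\<lambda>k. \<bar>s k\<bar> < min r r1) sequentially"
      using s r r1(1) unfolding tendsto_iff dist_real_def by (elim allE[of _ "min r r1"]) simp
    then obtain n where n: "\<And>k. k \<ge> n \<Longrightarrow> \<bar>s k\<bar> < min r r1"
      by (auto simp: eventually_sequentially)
    obtain k where k: "k \<ge> n" "U x - d < (f (x + s k) - f x) / s k"
      using limsup[OF \<open>d > 0\<close>] by blast
    have "I (x,k) \<subseteq> ball x r1"
      using n[OF k(1)] by (auto simp: Ieq lo_def hi_def dist_real_def)
    then have "(x,k) \<in> K" using k r1 x by (auto simp: K_def)
    moreover have "x \<in> cball (x + s k / 2) (\<bar>s k\<bar> / 2)" by (simp add: dist_real_def)
    ultimately show "\<exists>i. i \<in> K \<and> x \<in> cball (case i of (x, k) \<Rightarrow> x + s k / 2) (case i of (x, k) \<Rightarrow> \<bar>s k\<bar> / 2)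
        \<and> (case i of (x, k) \<Rightarrow> \<bar>s k\<bar> / 2) < r"
      using n[OF k(1)] r by (intro exI[of _ "(x,k)"]) auto
  qed (auto simp: I_def case_prod_unfold)
  have Isub: "I i \<subseteq> {a<..<b}" if "i \<in> C" for i
    using that C(2) by (auto simp: K_def)
  have lm: "I i \<in> lmeasurable" for i by (simp add: Ieq)
  obtain D where D: "D \<subseteq> I ` C" "finite D"
    and mD: "measure lebesgue (\<Union>(I ` C)) - d < measure lebesgue (\<Union>D)"
  proof (rule measure_countable_Union_approachable[of "I ` C" d "b - a"])
    fix D' assume D': "D' \<subseteq> I ` C" "finite D'"
    have "\<Union>D' \<subseteq> {a<..<b}" using D'(1) Isub by blast
    moreover have "\<Union>D' \<in> lmeasurable" using D' lm by (intro fmeasurable.finite_Union) auto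
    ultimately have "measure lebesgue (\<Union>D') \<le> measure lebesgue {a<..<b}"
      by (intro measure_mono_fmeasurable fmeasurableD) auto
    then show "measure lebesgue (\<Union>D') \<le> b - a" using ab by simp
  qed (use C(1) \<open>d > 0\<close> lm in auto)
  obtain F where F: "F \<subseteq> C" "finite F" "D = I ` F"
    using finite_subset_image[OF D(2,1)] by auto
  have disF: "disjoint_family_on I F"
    unfolding disjoint_family_on_def
  proof (intro ballI impI)
    fix i j assume "i \<in> F" "j \<in> F" "i \<noteq> j"
    then have "disjnt (I i) (I j)" using dis F(1) by (auto simp only: pairwise_def)
    then show "I i \<inter> I j = {}" by (simp only: disjnt_def)
  qed
  have mC: "measure lebesgue (\<Union>(I ` C)) = b - a"
  proof -
    have "\<Union>(I ` C) - {a<..<b} = {}" using Isub by blast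
    with neg have "measure lebesgue (\<Union>(I ` C)) = measure lebesgue {a<..<b}"
      by (intro measure_negligible_symdiff) simp_all
    then show ?thesis using ab by simp
  qed
  define R where "R = {a..b} - (\<Union>i\<in>F. I i)"
  have Fsub: "(\<Union>i\<in>F. I i) \<subseteq> {a..b}" using F(1) Isub by fastforce
  have Fm: "(\<Union>i\<in>F. I i) \<in> lmeasurable" using F(2) lm by (auto intro: fmeasurable.finite_UN)
  have Rm: "R \<in> lmeasurable" unfolding R_def using Fm by (intro fmeasurable.Diff) auto
  have mR: "measure lebesgue R \<le> d"
  proof -
    have "measure lebesgue R = measure lebesgue {a..b} - measure lebesgue (\<Union>i\<in>F. I i)"
      unfolding R_def by (rule measurable_measure_Diff) (use Fsub Fm in auto)
    then show ?thesis using mD mC ab F(3) by simp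
  qed
  have UI: "U integrable_on I i" if "i \<in> F" for i
  proof -
    have "{lo i..hi i} \<subseteq> {a..b}" using Fsub that by (simp only: Ieq[symmetric]) blast
    then show ?thesis unfolding Ieq by (rule integrable_on_subinterval[OF int])
  qed
  have sum_le: "(\<Sum>i\<in>F. h (hi i) - h (lo i)) \<le> h b - h a"
    if "mono h" "continuous_on UNIV h" for h :: "real \<Rightarrow> real"
  proof (rule sum_increments_disjoint_le[OF that F(2)])
    show "{lo i..hi i} \<subseteq> {a..b}" if "i \<in> F" for i
      using Fsub that by (simp only: Ieq[symmetric]) blast
    show "disjoint_family_on (\<lambda>i. {lo i..hi i}) F"
      using disF by (simp only: Ieq[symmetric])
  qed (use ab lohi in \<open>auto intro: less_imp_le\<close>)
  have neg0: "pairwise (\<lambda>i j. negligible (I i \<inter> I j)) F"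
    using disF by (auto simp: pairwise_def disjoint_family_on_def)
  have UF: "(U has_integral (\<Sum>i\<in>F. integral (I i) U)) (\<Union>i\<in>F. I i)"
    using F(2) UI neg0 by (intro has_integral_UN) (auto intro: integrable_integral)
  have UR: "(U has_integral (integral {a..b} U - (\<Sum>i\<in>F. integral (I i) U))) R"
    unfolding R_def using integrable_integral[OF int] UF Fsub by (intro has_integral_setdiff) auto
  have "integral {a..b} U - (\<Sum>i\<in>F. integral (I i) U) \<le> L * d"
  proof -
    have "((\<lambda>x. L) has_integral (L * measure lebesgue R)) R"
    proof -
      have "(\<lambda>x. 1::real) integrable_on R" using Rm by (simp only: lmeasurable_iff_integrable_on)
      then have "((\<lambda>x. 1::real) has_integral measure lebesgue R) R"
        unfolding lmeasure_integral[OF Rm] by (rule integrable_integral)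
      from has_integral_mult_right[OF this, of L] show ?thesis by simp
    qed
    with UR have "integral {a..b} U - (\<Sum>i\<in>F. integral (I i) U) \<le> L * measure lebesgue R"
      by (rule has_integral_le) (rule U)
    also have "\<dots> \<le> L * d" using mR L by (rule mult_left_mono)
    finally show ?thesis .
  qed
  moreover have "(\<Sum>i\<in>F. integral (I i) U) \<le> (\<Sum>i\<in>F. f (hi i) - f (lo i)) + d * (b - a) + d"
  proof -
    \<comment> \<open>The tag of an interval is its base point, which is the left or the right end
      point according to the sign of \<open>s k\<close>.\<close>
    let ?g = "\<lambda>i. (fst i, I i)"
    let ?p = "?g ` F"
    have injg: "inj_on ?g F"
    proof (rule inj_onI)
      fix i j assume ij: "i \<in> F" "j \<in> F" "?g i = ?g j"
      show "i = j"
      proof (rule ccontr)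
        assume "i \<noteq> j"
        with ij disF have "I i \<inter> I j = {}" by (auto simp: disjoint_family_on_def)
        with ij(3) xI[of i] show False by auto
      qed
    qed
    have "?p tagged_partial_division_of cbox a b"
      unfolding tagged_partial_division_of_def
    proof (intro conjI allI impI)
      show "finite ?p" using F(2) by simp
      fix x J assume xJ: "(x, J) \<in> ?p"
      then obtain i where "i \<in> F" "x = fst i" "J = I i" by auto
      then show "x \<in> J" "J \<subseteq> cbox a b" using xI[of i] Fsub by auto
      show "\<exists>a b. J = cbox a b" 
      proof -
        obtain i where "J = I i" using xJ by auto
        then have "J = cbox (lo i) (hi i)" by (simp only: Ieq cbox_interval)
        then show ?thesis by (intro exI)
      qed
    next
      fix x1 J1 x2 J2 assume "(x1, J1) \<in> ?p \<and> (x2, J2) \<in> ?p \<and> (x1, J1) \<noteq> (x2, J2)"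
      then obtain i j where ij: "i \<in> F" "j \<in> F" "J1 = I i" "J2 = I j" "i \<noteq> j" by auto
      then have "I i \<inter> I j = {}" using disF by (auto simp: disjoint_family_on_def)
      then show "interior J1 \<inter> interior J2 = {}"
        unfolding ij(3,4) using interior_subset by blast
    qed
    moreover have "\<gamma> fine ?p"
    proof (rule fineI)
      fix x J assume "(x, J) \<in> ?p"
      then obtain i where "i \<in> F" "x = fst i" "J = I i" by auto
      moreover have "i \<in> K" using \<open>i \<in> F\<close> F(1) C(2) by blast
      ultimately show "J \<subseteq> \<gamma> x" by (simp add: K_def case_prod_unfold)
    qed
    ultimately have "(\<Sum>(x,J)\<in>?p. norm (measure lborel J *\<^sub>R U x - integral J U)) < d"
      by (rule hen)
    then have h: "(\<Sum>i\<in>F. \<bar>(hi i - lo i) * U (fst i) - integral (I i) U\<bar>) < d"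
      using lohi by (subst (asm) sum.reindex[OF injg]) (simp add: Ieq less_imp_le)
    have incr: "(hi i - lo i) * U (fst i) - d * (hi i - lo i) \<le> f (hi i) - f (lo i)" if "i \<in> F" for i
    proof -
      obtain x k where i: "i = (x,k)" by (cases i)
      have *: "U x - d < (f (x + s k) - f x) / s k" using that F(1) C(2) i by (auto simp: K_def)
      show ?thesis
      proof (cases "s k > 0")
        case True
        with * show ?thesis by (simp add: i lo_def hi_def min_def max_def field_simps)
      next
        case False
        then have "s k < 0" using s0[of k] by simp
        with * show ?thesis by (simp add: i lo_def hi_def min_def max_def field_simps)
      qed
    qed
    have tot: "(\<Sum>i\<in>F. hi i - lo i) \<le> b - a"
      by (rule sum_le) (auto simp: mono_def)
    have "(\<Sum>i\<in>F. integral (I i) U) \<le> (\<Sum>i\<in>F. (hi i - lo i) * U (fst i) + \<bar>(hi i - lo i) * U (fst i) - integral (I i) U\<bar>)"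
      by (intro sum_mono) auto
    also have "\<dots> \<le> (\<Sum>i\<in>F. (hi i - lo i) * U (fst i)) + d"
      using h by (simp add: sum.distrib)
    also have "\<dots> \<le> (\<Sum>i\<in>F. (f (hi i) - f (lo i)) + d * (hi i - lo i)) + d"
      using incr by (intro add_right_mono sum_mono) fastforce
    also have "\<dots> \<le> (\<Sum>i\<in>F. f (hi i) - f (lo i)) + d * (b - a) + d"
      using tot \<open>d > 0\<close> by (simp add: sum.distrib sum_distrib_left[symmetric])
    finally show ?thesis .
  qed
  moreover have "(\<Sum>i\<in>F. f (hi i) - f (lo i)) \<le> f b - f a"
    by (rule sum_le[OF mono lipschitz_on_continuous_on[OF lip]])
  ultimately show "integral {a..b} U \<le> f b - f a + e"
    unfolding de[symmetric] by (simp add: algebra_simps)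
qed

text \<open>For a Lipschitz function, convergence of the difference quotients along this single sequence,
  which approximates every small number up to a relatively small error, already gives
  differentiability. So all limits below are limits of sequences of measurable functions.\<close>

definition null_step :: "nat \<Rightarrow> real" where
  "null_step k = (- 1) ^ k / real (Suc k)"

lemma null_step_nonzero [simp]: "null_step k \<noteq> 0"
  by (simp add: null_step_def)

lemma abs_null_step: "\<bar>null_step k\<bar> = 1 / real (Suc k)"
  by (simp add: null_step_def abs_mult power_abs)

lemma null_step_tendsto: "null_step \<longlonglongrightarrow> 0"
proof (rule tendsto_rabs_zero_cancel)
  show "(\<lambda>k. \<bar>null_step k\<bar>) \<longlonglongrightarrow> 0"
    unfolding abs_null_step using LIMSEQ_inverse_real_of_nat by (simp add: inverse_eq_divide)
qed

text \<open>Signs alternate, so one of the two largest integers not exceeding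
  \<open>1 / \<bar>t\<bar>\<close> has the parity that gives the sign of \<open>t\<close>.
  Reciprocals that differ by at most 2 give the relative error
  \<open>2 * \<bar>null_step k\<bar>\<close>; the threshold \<open>1 / real (n + 4)\<close> leaves
  room for the shift of the index.\<close>

lemma null_step_near:
  fixes t :: real
  assumes "t \<noteq> 0" and "\<bar>t\<bar> < 1 / real (n + 4)"
  obtains k where "k \<ge> n" "\<bar>null_step k - t\<bar> \<le> 2 * \<bar>null_step k\<bar> * \<bar>t\<bar>" "\<bar>null_step k\<bar> \<le> 2 * \<bar>t\<bar>"
proof -
  define m where "m = nat \<lfloor>1 / \<bar>t\<bar>\<rfloor>"
  have pos: "\<bar>t\<bar> > 0" using assms(1) by simp
  have t1: "1 / \<bar>t\<bar> > real (n + 4)"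
    using assms(2) pos by (simp add: field_simps)
  have m: "real m \<le> 1 / \<bar>t\<bar>" "1 / \<bar>t\<bar> < real m + 1"
    using pos by (simp_all add: m_def)
  then have mn: "m \<ge> n + 4" using t1 by linarith
  obtain k where k: "k + 2 = m \<or> k + 1 = m" "even k \<longleftrightarrow> t > 0"
  proof (cases "even (m - 1) \<longleftrightarrow> t > 0")
    case True
    moreover have "m - 1 + 1 = m" using mn by arith
    ultimately show ?thesis using that by blast
  next
    case False
    moreover have m2: "m - 2 + 2 = m" using mn by arith
    moreover have "even (m - 2) \<longleftrightarrow> \<not> even (m - 1)" using mn by (cases m) auto
    ultimately show ?thesis using that by blast
  qed
  have kn: "k \<ge> n" using k(1) mn by linarith
  have sgn: "null_step k = sgn t * (1 / real (Suc k))"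
    using k(2) assms(1) by (cases "even k") (auto simp: null_step_def)
  have d: "0 \<le> 1 / \<bar>t\<bar> - real (Suc k)" "1 / \<bar>t\<bar> - real (Suc k) \<le> 2"
    using k(1) m by linarith+
  have "\<bar>null_step k - t\<bar> = \<bar>1 / real (Suc k) - \<bar>t\<bar>\<bar>"
    unfolding sgn using assms(1) by (cases "t > 0") auto
  also have "1 / real (Suc k) - \<bar>t\<bar> = (1 / real (Suc k)) * \<bar>t\<bar> * (1 / \<bar>t\<bar> - real (Suc k))"
  proof -
    have "(1 / real (Suc k)) * \<bar>t\<bar> * (1 / \<bar>t\<bar> - real (Suc k)) =
        (1 / real (Suc k)) * (\<bar>t\<bar> * (1 / \<bar>t\<bar>)) - (1 / real (Suc k) * real (Suc k)) * \<bar>t\<bar>"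
      by (simp only: algebra_simps)
    then show ?thesis using pos by simp
  qed
  also have "\<bar>\<dots>\<bar> = \<bar>null_step k\<bar> * \<bar>t\<bar> * (1 / \<bar>t\<bar> - real (Suc k))"
    using d by (simp add: abs_null_step abs_mult)
  also have "\<dots> \<le> \<bar>null_step k\<bar> * \<bar>t\<bar> * 2"
    using d by (intro mult_left_mono) auto
  finally have 1: "\<bar>null_step k - t\<bar> \<le> 2 * \<bar>null_step k\<bar> * \<bar>t\<bar>" by simp
  have "\<bar>null_step k\<bar> \<le> 1 / 2"
  proof -
    have "real (Suc k) \<ge> 2" using mn k(1) by linarith
    then show ?thesis by (simp add: abs_null_step field_simps)
  qed
  then have "2 * \<bar>null_step k\<bar> * \<bar>t\<bar> \<le> 1 * \<bar>t\<bar>"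
    using pos by (intro mult_right_mono) auto
  with 1 have "\<bar>null_step k\<bar> \<le> 2 * \<bar>t\<bar>" by linarith
  with that kn 1 show thesis by blast
qed

text \<open>Moving from \<open>t\<close> to a nearby step costs at most
  \<open>L + \<bar>D\<bar>\<close> times their distance. That distance is quadratically small in
  \<open>t\<close>, so the cost disappears after division by \<open>t\<close>.\<close>

lemma lipschitz_sequential_deriv:
  fixes g :: "real \<Rightarrow> real"
  assumes lip: "L-lipschitz_on UNIV g"
    and lim: "(\<lambda>k. (g (null_step k) - g 0) / null_step k) \<longlonglongrightarrow> D"
  shows "(g has_real_derivative D) (at 0)"
  unfolding has_field_derivative_iff
proof (rule LIM_I)
  fix e :: real assume "e > 0"
  have L: "L \<ge> 0" using lip by (rule lipschitz_on_nonneg)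
  \<comment> \<open>The 2 is the factor in the distance estimate of \<open>null_step_near\<close>;
    the summand 1 keeps \<open>M\<close> positive when \<open>L\<close> and \<open>D\<close>
    vanish.\<close>
  define M where "M = 2 * (L + \<bar>D\<bar>) + 1"
  have M: "M > 0" using L by (simp add: M_def)
  obtain n1 where n1: "\<And>k. k \<ge> n1 \<Longrightarrow> \<bar>(g (null_step k) - g 0) / null_step k - D\<bar> < e / 8"
    using LIMSEQ_D[OF lim, of "e / 8"] \<open>e > 0\<close> by auto
  obtain n2 where n2: "\<And>k. k \<ge> n2 \<Longrightarrow> \<bar>null_step k\<bar> < e / (2 * M)"
    using LIMSEQ_D[OF null_step_tendsto, of "e / (2 * M)"] \<open>e > 0\<close> M by auto
  define n where "n = max n1 n2"
  show "\<exists>d>0. \<forall>t. t \<noteq> 0 \<and> norm (t - 0) < d \<longrightarrow> norm ((g t - g 0) / (t - 0) - D) < e"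
  proof (intro exI[of _ "1 / real (n + 4)"] conjI allI impI)
    fix t :: real assume t: "t \<noteq> 0 \<and> norm (t - 0) < 1 / real (n + 4)"
    then obtain k where k: "k \<ge> n" "\<bar>null_step k - t\<bar> \<le> 2 * \<bar>null_step k\<bar> * \<bar>t\<bar>" "\<bar>null_step k\<bar> \<le> 2 * \<bar>t\<bar>"
      using null_step_near[of t n] by auto
    let ?s = "null_step k"
    let ?q = "(g ?s - g 0) / ?s"
    have "?s * ?q = g ?s - g 0" by simp
    then have "g t - g 0 - t * D = (g t - g ?s) + ?s * (?q - D) + (?s - t) * D"
      by (simp only: algebra_simps)
    then have "\<bar>g t - g 0 - t * D\<bar> \<le> \<bar>g t - g ?s\<bar> + \<bar>?s\<bar> * \<bar>?q - D\<bar> + \<bar>?s - t\<bar> * \<bar>D\<bar>"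
      using abs_triangle_ineq[of "(g t - g ?s) + ?s * (?q - D)" "(?s - t) * D"]
        abs_triangle_ineq[of "g t - g ?s" "?s * (?q - D)"] by (simp only: abs_mult)
    also have "\<dots> \<le> L * \<bar>?s - t\<bar> + (2 * \<bar>t\<bar>) * (e / 8) + \<bar>?s - t\<bar> * \<bar>D\<bar>"
      using lipschitz_onD[OF lip, of t ?s] n1[of k] k(1,3) \<open>e > 0\<close>
      by (intro add_mono mult_mono) (auto simp: dist_real_def abs_minus_commute n_def)
    also have "\<dots> = (L + \<bar>D\<bar>) * \<bar>?s - t\<bar> + \<bar>t\<bar> * (e / 4)"
      by (simp add: algebra_simps)
    also have "\<dots> \<le> (L + \<bar>D\<bar>) * (2 * \<bar>?s\<bar> * \<bar>t\<bar>) + \<bar>t\<bar> * (e / 4)"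
      using k(2) L by (intro add_right_mono mult_left_mono) auto
    also have "\<dots> \<le> M * (\<bar>?s\<bar> * \<bar>t\<bar>) + \<bar>t\<bar> * (e / 4)"
      by (simp add: M_def algebra_simps)
    also have "\<dots> \<le> M * (e / (2 * M) * \<bar>t\<bar>) + \<bar>t\<bar> * (e / 4)"
      using n2[of k] k(1) M by (intro add_right_mono mult_left_mono mult_right_mono) (auto simp: n_def)
    also have "\<dots> = (3 / 4 * e) * \<bar>t\<bar>"
      using M by (simp add: field_simps)
    also have "\<dots> < e * \<bar>t\<bar>"
      using t \<open>e > 0\<close> by (intro mult_strict_right_mono) auto
    finally have "\<bar>g t - g 0 - t * D\<bar> < e * \<bar>t\<bar>" .
    moreover have "(g t - g 0) / (t - 0) - D = (g t - g 0 - t * D) / t"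
      using t by (simp add: field_simps)
    ultimately show "norm ((g t - g 0) / (t - 0) - D) < e"
      using t by (simp add: abs_divide divide_less_eq)
  qed simp
qed

section \<open>Almost everywhere convergence of difference quotients\<close>

lemma lipschitz_borel_measurable:
  fixes f :: "'a::{metric_space, second_countable_topology} \<Rightarrow> 'b::metric_space"
  assumes "L-lipschitz_on UNIV f"
  shows "f \<in> borel_measurable borel"
  using assms by (intro borel_measurable_continuous_onI lipschitz_on_continuous_on)

text \<open>Let \<open>U\<close> and \<open>V\<close> be the upper and lower limits of the
  quotients. Adding \<open>L * x\<close> to \<open>f\<close> and to \<open>- f\<close> gives
  monotone functions, whose increments bound the integrals of \<open>U + L\<close> and
  \<open>L - V\<close>. The increments of \<open>f\<close> cancel in the sum, so the integral of
  \<open>U - V\<close> is at most 0.\<close>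

lemma lipschitz_real_AE_convergent:
  fixes f :: "real \<Rightarrow> real"
  assumes lip: "L-lipschitz_on UNIV f"
  shows "AE x in lborel. convergent (\<lambda>k. (f (x + null_step k) - f x) / null_step k)"
proof -
  define q where "q k x = (f (x + null_step k) - f x) / null_step k" for k x
  have [measurable]: "f \<in> borel_measurable borel" using lip by (rule lipschitz_borel_measurable)
  have qm [measurable]: "q k \<in> borel_measurable borel" for k unfolding q_def by measurable
  have L: "0 \<le> L" using lip by (rule lipschitz_on_nonneg)
  have qL: "\<bar>q k x\<bar> \<le> L" for k x
    using lipschitz_onD[OF lip, of "x + null_step k" x]
    by (simp add: q_def dist_real_def abs_divide divide_le_eq)
  define U where "U x = real_of_ereal (limsup (\<lambda>k. ereal (q k x)))" for x
  define V where "V x = real_of_ereal (liminf (\<lambda>k. ereal (q k x)))" for x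
  have ls: "limsup (\<lambda>k. ereal (q k x)) \<le> ereal L" "ereal (- L) \<le> liminf (\<lambda>k. ereal (q k x))" for x
  proof -
    have "q k x \<le> L" "- L \<le> q k x" for k using qL[of k x] by (simp_all add: abs_le_iff)
    then show "limsup (\<lambda>k. ereal (q k x)) \<le> ereal L" "ereal (- L) \<le> liminf (\<lambda>k. ereal (q k x))"
      by (auto intro!: Limsup_bounded Liminf_bounded always_eventually)
  qed
  have le: "liminf (\<lambda>k. ereal (q k x)) \<le> limsup (\<lambda>k. ereal (q k x))" for x
    by (rule Liminf_le_Limsup) simp
  have UE: "limsup (\<lambda>k. ereal (q k x)) = ereal (U x)" and VE: "liminf (\<lambda>k. ereal (q k x)) = ereal (V x)" for x
    using ls[of x] le[of x] unfolding U_def V_def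
    by (cases "limsup (\<lambda>k. ereal (q k x))"; cases "liminf (\<lambda>k. ereal (q k x))"; simp)+
  have bnd: "- L \<le> V x" "V x \<le> U x" "U x \<le> L" for x
    using ls[of x] le[of x] by (simp_all add: UE VE)
  have [measurable]: "U \<in> borel_measurable borel" "V \<in> borel_measurable borel"
    unfolding U_def V_def by measurable
  have limsupU: "\<exists>k\<ge>n. U x - e < q k x" if "e > 0" for x e n
  proof -
    have "ereal (U x - e) < limsup (\<lambda>k. ereal (q k x))" using that by (simp add: UE)
    also have "\<dots> \<le> (SUP k\<in>{n..}. ereal (q k x))"
      unfolding limsup_INF_SUP by (rule INF_lower) simp
    finally show ?thesis by (auto simp: less_SUP_iff)
  qed
  have liminfV: "\<exists>k\<ge>n. q k x < V x + e" if "e > 0" for x e n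
  proof -
    have "(INF k\<in>{n..}. ereal (q k x)) \<le> liminf (\<lambda>k. ereal (q k x))"
      unfolding liminf_SUP_INF by (rule SUP_upper) simp
    also have "\<dots> < ereal (V x + e)" using that by (simp add: VE)
    finally show ?thesis by (auto simp: INF_less_iff)
  qed
  have bint: "h integrable_on {a..b}" if [measurable]: "h \<in> borel_measurable borel" and h: "\<And>x. \<bar>h x\<bar> \<le> 2 * L"
    for h :: "real \<Rightarrow> real" and a b
  proof (rule measurable_bounded_by_integrable_imp_integrable_real[where g = "\<lambda>_. 2 * L"])
    show "h \<in> borel_measurable (lebesgue_on {a..b})"
      by (intro measurable_restrict_space1 measurable_completion) simp
  qed (use h in auto)
  have UV: "(\<lambda>x. U x - V x) integrable_on {a..b}" for a b
  proof (rule bint)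
    show "\<bar>U x - V x\<bar> \<le> 2 * L" for x using bnd[of x] by linarith
  qed simp
  have main: "integral {a..b} (\<lambda>x. U x - V x) = 0" if "a < b" for a b
  proof -
    have int: "(\<lambda>x. U x + L) integrable_on {a..b}" "(\<lambda>x. L - V x) integrable_on {a..b}"
    proof -
      show "(\<lambda>x. U x + L) integrable_on {a..b}"
      proof (rule bint)
        show "\<bar>U x + L\<bar> \<le> 2 * L" for x using bnd[of x] by linarith
      qed simp
      show "(\<lambda>x. L - V x) integrable_on {a..b}"
      proof (rule bint)
        show "\<bar>L - V x\<bar> \<le> 2 * L" for x using bnd[of x] by linarith
      qed simp
    qed
    have "integral {a..b} (\<lambda>x. U x + L) \<le> (f b + L * b) - (f a + L * a)"
    proof (rule integral_upper_derivative_le[where L = "2 * L" and s = null_step, OF _ _ that null_step_nonzero null_step_tendsto int(1)])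
      show "mono (\<lambda>x. f x + L * x)"
      proof (rule monoI)
        fix x y :: real assume "x \<le> y"
        then show "f x + L * x \<le> f y + L * y"
          using lipschitz_onD[OF lip, of x y] by (auto simp: dist_real_def algebra_simps abs_le_iff)
      qed
      have "(L + \<bar>L\<bar> * 1)-lipschitz_on UNIV (\<lambda>x. f x + L * x)"
        by (intro lipschitz_on_add lip lipschitz_on_cmult_real lipschitz_on_id)
      then show "(2 * L)-lipschitz_on UNIV (\<lambda>x. f x + L * x)" using L by simp
      show "\<exists>k\<ge>n. U x + L - e < (f (x + null_step k) + L * (x + null_step k) - (f x + L * x)) / null_step k"
        if e: "e > 0" for x e n
      proof -
        have "(f (x + null_step k) + L * (x + null_step k) - (f x + L * x)) / null_step k = q k x + L" for k
          by (simp add: q_def field_simps)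
        then show ?thesis using limsupU[OF e, of n x] by auto
      qed
      show "0 \<le> U x + L" "U x + L \<le> 2 * L" for x using bnd[of x] by linarith+
    qed
    moreover have "integral {a..b} (\<lambda>x. L - V x) \<le> (L * b - f b) - (L * a - f a)"
    proof (rule integral_upper_derivative_le[where L = "2 * L" and s = null_step, OF _ _ that null_step_nonzero null_step_tendsto int(2)])
      show "mono (\<lambda>x. L * x - f x)"
      proof (rule monoI)
        fix x y :: real assume "x \<le> y"
        then show "L * x - f x \<le> L * y - f y"
          using lipschitz_onD[OF lip, of x y] by (auto simp: dist_real_def algebra_simps abs_le_iff)
      qed
      have "(\<bar>L\<bar> * 1 + L)-lipschitz_on UNIV (\<lambda>x. L * x - f x)"
        by (intro lipschitz_on_diff lip lipschitz_on_cmult_real lipschitz_on_id)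
      then show "(2 * L)-lipschitz_on UNIV (\<lambda>x. L * x - f x)" using L by simp
      show "\<exists>k\<ge>n. L - V x - e < (L * (x + null_step k) - f (x + null_step k) - (L * x - f x)) / null_step k"
        if e: "e > 0" for x e n
      proof -
        have "(L * (x + null_step k) - f (x + null_step k) - (L * x - f x)) / null_step k = L - q k x" for k
          by (simp add: q_def field_simps)
        then show ?thesis using liminfV[OF e, of n x] by auto
      qed
      show "0 \<le> L - V x" "L - V x \<le> 2 * L" for x using bnd[of x] by linarith+
    qed
    moreover have "integral {a..b} (\<lambda>x. U x + L) + integral {a..b} (\<lambda>x. L - V x) =
        integral {a..b} (\<lambda>x. (U x - V x) + 2 * L)"
      using int by (subst integral_add[symmetric]) (auto simp: algebra_simps)
    moreover have "integral {a..b} (\<lambda>x. (U x - V x) + 2 * L) = integral {a..b} (\<lambda>x. U x - V x) + 2 * L * (b - a)"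
    proof -
      show ?thesis using that UV by (subst integral_add) auto
    qed
    ultimately have "integral {a..b} (\<lambda>x. U x - V x) \<le> 0" by (simp add: algebra_simps)
    moreover have "0 \<le> integral {a..b} (\<lambda>x. U x - V x)"
      by (rule integral_nonneg[OF UV]) (use bnd in simp)
    ultimately show ?thesis by simp
  qed
  have "AE x in lborel. \<bar>x\<bar> < real (Suc n) \<longrightarrow> U x = V x" for n
  proof -
    let ?I = "{- real (Suc n)..real (Suc n)}"
    have "(\<lambda>x. U x - V x) integrable_on ?I"
      by (rule UV)
    then have "((\<lambda>x. U x - V x) has_integral 0) ?I"
      using main[of "- real (Suc n)" "real (Suc n)"] integrable_integral by fastforce
    then have "(\<integral>\<^sup>+x. ennreal (U x - V x) * indicator ?I x \<partial>lborel) = ennreal 0"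
      by (rule nn_integral_has_integral_lebesgue'[rotated]) (use bnd in simp)
    then have "AE x in lborel. ennreal (U x - V x) * indicator ?I x = 0"
      by (subst (asm) ennreal_0, subst (asm) nn_integral_0_iff_AE) auto
    then show ?thesis
      by eventually_elim (use bnd in \<open>auto simp: indicator_def ennreal_eq_0_iff split: if_splits intro: antisym\<close>)
  qed
  then have "AE x in lborel. \<forall>n. \<bar>x\<bar> < real (Suc n) \<longrightarrow> U x = V x"
    unfolding AE_all_countable by (rule allI)
  then show ?thesis
  proof eventually_elim
    case (elim x)
    obtain n where "\<bar>x\<bar> < real n" using reals_Archimedean2 by blast
    then have "\<bar>x\<bar> < real (Suc n)" by simp
    with elim have "U x = V x" by blast
    then have "(\<lambda>k. ereal (q k x)) \<longlonglongrightarrow> ereal (U x)"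
      by (subst tendsto_iff_Liminf_eq_Limsup) (simp_all add: UE VE)
    then have "(\<lambda>k. q k x) \<longlonglongrightarrow> U x" by simp
    then show ?case unfolding q_def by (rule convergentI)
  qed
qed

text \<open>The exceptional set is averaged over its translates along \<open>v\<close>. Integrated
  over \<open>t\<close> first, the double integral vanishes by the one-dimensional result on lines;
  integrated over \<open>z\<close> first, it is the measure of the set, by translation invariance.
  No coordinates adapted to \<open>v\<close> enter.\<close>

lemma lipschitz_AE_directional:
  fixes f :: "'a::euclidean_space \<Rightarrow> real"
  assumes lip: "L-lipschitz_on UNIV f"
  shows "AE z in lborel. convergent (\<lambda>k. (f (z + null_step k *\<^sub>R v) - f z) / null_step k)"
proof -
  define N where "N = {z. \<not> convergent (\<lambda>k. (f (z + null_step k *\<^sub>R v) - f z) / null_step k)}"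
  have [measurable]: "f \<in> borel_measurable borel" using lip by (rule lipschitz_borel_measurable)
  have Nm [measurable]: "N \<in> sets borel"
  proof -
    have "{z \<in> space borel. \<not> Cauchy (\<lambda>k. (f (z + null_step k *\<^sub>R v) - f z) / null_step k)} \<in> sets borel"
      by measurable
    then show ?thesis by (simp add: N_def Cauchy_convergent_iff)
  qed
  have line: "AE t in lborel. z + t *\<^sub>R v \<notin> N" for z
  proof -
    have "(L * (norm v))-lipschitz_on UNIV (\<lambda>t. f (z + t *\<^sub>R v))"
    proof (rule lipschitz_onI)
      fix s t :: real
      have "dist (f (z + s *\<^sub>R v)) (f (z + t *\<^sub>R v)) \<le> L * dist (z + s *\<^sub>R v) (z + t *\<^sub>R v)"
        by (rule lipschitz_onD[OF lip]) auto
      also have "dist (z + s *\<^sub>R v) (z + t *\<^sub>R v) = norm v * dist s t"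
        by (simp add: dist_norm scaleR_diff_left[symmetric])
      finally show "dist (f (z + s *\<^sub>R v)) (f (z + t *\<^sub>R v)) \<le> L * norm v * dist s t" by simp
    qed (use lipschitz_on_nonneg[OF lip] in auto)
    from lipschitz_real_AE_convergent[OF this] show ?thesis
      by eventually_elim (simp add: N_def scaleR_add_left add.assoc)
  qed
  have "0 = (\<integral>\<^sup>+z. (\<integral>\<^sup>+t. indicator N (z + t *\<^sub>R v) * indicator {0..1} t \<partial>lborel) \<partial>lborel)"
  proof -
    have "(\<integral>\<^sup>+t. indicator N (z + t *\<^sub>R v) * indicator {0..1} t \<partial>lborel) = 0" for z
      using line[of z] by (subst nn_integral_0_iff_AE) (auto elim: eventually_mono)
    then show ?thesis by simp
  qed
  also have "\<dots> = (\<integral>\<^sup>+t. (\<integral>\<^sup>+z. indicator N (z + t *\<^sub>R v) * indicator {0..1} t \<partial>lborel) \<partial>lborel)"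
    by (rule lborel_pair.Fubini'[symmetric]) measurable
  also have "\<dots> = (\<integral>\<^sup>+t. emeasure lborel N * indicator {0..1::real} t \<partial>lborel)"
  proof (rule nn_integral_cong)
    fix t :: real
    have "(\<integral>\<^sup>+z. indicator N (z + t *\<^sub>R v) \<partial>lborel) = (\<integral>\<^sup>+z. indicator N z \<partial>distr lborel borel ((+) (t *\<^sub>R v)))"
      by (subst nn_integral_distr) (auto simp: add.commute)
    also have "\<dots> = emeasure lborel N" by (simp add: lborel_distr_plus)
    finally have eq: "(\<integral>\<^sup>+z. indicator N (z + t *\<^sub>R v) \<partial>lborel) = emeasure lborel N" .
    show "(\<integral>\<^sup>+z. indicator N (z + t *\<^sub>R v) * indicator {0..1} t \<partial>lborel) = emeasure lborel N * indicator {0..1} t"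
      by (subst nn_integral_multc) (auto simp: eq)
  qed
  also have "\<dots> = emeasure lborel N"
    by (subst nn_integral_cmult_indicator) auto
  finally have "N \<in> null_sets lborel" by (intro null_setsI) auto
  then have "AE z in lborel. z \<notin> N" by (rule AE_not_in)
  then show ?thesis by (simp add: N_def)
qed


text \<open>A limit along one fixed sequence makes this a Borel function of \<open>z\<close>. Where
  the quotients diverge, the value is whatever \<open>lim\<close> returns and carries no
  information.\<close>

definition dir_deriv :: "('a::real_normed_vector \<Rightarrow> real) \<Rightarrow> 'a \<Rightarrow> 'a \<Rightarrow> real" where
  "dir_deriv f v z = lim (\<lambda>k. (f (z + null_step k *\<^sub>R v) - f z) / null_step k)"

lemma dir_deriv_borel_measurable [measurable]:
  fixes f :: "'a::euclidean_space \<Rightarrow> real"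
  assumes [measurable]: "f \<in> borel_measurable borel"
  shows "dir_deriv f v \<in> borel_measurable borel"
  unfolding dir_deriv_def by measurable

lemma lipschitz_quotient_bound:
  fixes f :: "'a::real_normed_vector \<Rightarrow> real"
  assumes lip: "L-lipschitz_on UNIV f" and "s \<noteq> 0"
  shows "\<bar>(f (z + s *\<^sub>R v) - f z) / s\<bar> \<le> L * norm v"
  using lipschitz_onD[OF lip, of "z + s *\<^sub>R v" z] assms(2)
  by (simp add: dist_norm abs_divide divide_le_eq mult.commute mult.left_commute)

lemma indicator_box_translate_tendsto:
  fixes l u w :: "'a::euclidean_space" and s :: "nat \<Rightarrow> real"
  assumes s: "s \<longlonglongrightarrow> 0" and z: "z \<notin> cbox l u - box l u"
  shows "(\<lambda>k. indicator (box l u) (z - s k *\<^sub>R w) :: real) \<longlonglongrightarrow> indicator (box l u) z"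
proof -
  have lim: "(\<lambda>k. z - s k *\<^sub>R w) \<longlonglongrightarrow> z"
    using tendsto_diff[OF tendsto_const[of z] tendsto_scaleR[OF s tendsto_const[of w]]] by simp
  consider "z \<in> box l u" | "z \<notin> cbox l u" using z by blast
  then show ?thesis
  proof cases
    case 1
    then have "eventually (\<lambda>k. z - s k *\<^sub>R w \<in> box l u) sequentially"
      using lim open_box by (rule topological_tendstoD[rotated 2])
    then have "eventually (\<lambda>k. indicator (box l u) (z - s k *\<^sub>R w) = (indicator (box l u) z :: real)) sequentially"
      by eventually_elim (use 1 in simp)
    then show ?thesis by (rule tendsto_eventually)
  next
    case 2
    then have "eventually (\<lambda>k. z - s k *\<^sub>R w \<in> - cbox l u) sequentially"
      using lim by (intro topological_tendstoD[of _ z]) (auto simp: closed_cbox)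
    then have "eventually (\<lambda>k. indicator (box l u) (z - s k *\<^sub>R w) = (indicator (box l u) z :: real)) sequentially"
      by eventually_elim (use 2 box_subset_cbox[of l u] in \<open>auto simp: indicator_def\<close>)
    then show ?thesis by (rule tendsto_eventually)
  qed
qed

text \<open>As \<open>F\<close> is bounded, \<open>1 + F / c\<close> is nonnegative for large
  \<open>c\<close>. Used as a density it changes no box measure, so it defines Lebesgue measure
  again, and densities are unique almost everywhere.\<close>

lemma AE_zero_of_box_integrals:
  fixes F :: "'a::euclidean_space \<Rightarrow> real"
  assumes [measurable]: "F \<in> borel_measurable borel" and bnd: "\<And>z. \<bar>F z\<bar> \<le> C"
    and zero: "\<And>l u. (\<integral>z. indicator (box l u) z * F z \<partial>lborel) = 0"
  shows "AE z in lborel. F z = 0"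
proof -
  define c where "c = C + 1"
  have "0 \<le> C" using bnd[of 0] by linarith
  then have c: "c > 0" by (simp add: c_def)
  define g where "g z = 1 + F z / c" for z
  have g0: "0 \<le> g z" "g z \<le> 2" for z
  proof -
    have "\<bar>F z / c\<bar> \<le> 1" using bnd[of z] c by (simp add: abs_divide c_def)
    then show "0 \<le> g z" "g z \<le> 2" unfolding g_def by linarith+
  qed
  have [measurable]: "g \<in> borel_measurable borel" unfolding g_def by measurable
  have "lborel = density lborel (\<lambda>z. ennreal (g z))"
  proof (rule lborel_eqI)
    fix l u :: 'a assume lu: "\<And>b. b \<in> Basis \<Longrightarrow> l \<bullet> b \<le> u \<bullet> b"
    have i1: "integrable lborel (indicator (box l u) :: 'a \<Rightarrow> real)"
      by (rule integrable_real_indicator) (use emeasure_lborel_box_finite[of l u] in auto)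
    have i2: "integrable lborel (\<lambda>z. indicator (box l u) z * F z)"
      by (rule Bochner_Integration.integrable_bound[OF integrable_mult_right[OF i1, of C]])
        (use bnd \<open>0 \<le> C\<close> in \<open>auto simp: indicator_def\<close>)
    have eq: "g z * indicator (box l u) z = indicator (box l u) z + (indicator (box l u) z * F z) / c" for z
      by (simp add: g_def field_simps)
    have "emeasure (density lborel (\<lambda>z. ennreal (g z))) (box l u) =
        (\<integral>\<^sup>+z. ennreal (g z * indicator (box l u) z) \<partial>lborel)"
      by (subst emeasure_density) (auto intro!: nn_integral_cong simp: indicator_def)
    also have "\<dots> = ennreal (\<integral>z. g z * indicator (box l u) z \<partial>lborel)"
    proof (rule nn_integral_eq_integral)
      show "integrable lborel (\<lambda>z. g z * indicator (box l u) z)"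
        unfolding eq using i1 i2 by simp
    qed (use g0 in simp)
    also have "(\<integral>z. g z * indicator (box l u) z \<partial>lborel) = measure lborel (box l u)"
      unfolding eq using i1 i2 zero[of l u] by (subst Bochner_Integration.integral_add) simp_all
    also have "ennreal (measure lborel (box l u)) = emeasure lborel (box l u)"
      using emeasure_lborel_box_finite[of l u] by (simp add: emeasure_eq_ennreal_measure less_top)
    finally show "emeasure (density lborel (\<lambda>z. ennreal (g z))) (box l u) = (\<Prod>b\<in>Basis. (u - l) \<bullet> b)"
      using lu by (simp add: emeasure_lborel_box)
  qed simp
  then have "density lborel (\<lambda>_. 1) = density lborel (\<lambda>z. ennreal (g z))" by (simp add: density_1)
  then have "AE z in lborel. 1 = ennreal (g z)"
    by (subst (asm) sigma_finite_measure.density_unique_iff[OF sigma_finite_lborel]) simp_all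
  then show ?thesis
  proof eventually_elim
    case (elim z)
    then have "g z = 1" using g0[of z] by (metis ennreal_1 ennreal_inj zero_le_one)
    then show "F z = 0" using c by (simp add: g_def)
  qed
qed

lemma dir_deriv_bound:
  assumes "L-lipschitz_on UNIV f" "convergent (\<lambda>k. (f (z + null_step k *\<^sub>R v) - f z) / null_step k)"
  shows "\<bar>dir_deriv f v z\<bar> \<le> L * norm v"
proof -
  have "(\<lambda>k. \<bar>(f (z + null_step k *\<^sub>R v) - f z) / null_step k\<bar>) \<longlonglongrightarrow> \<bar>dir_deriv f v z\<bar>"
    using assms(2) unfolding convergent_LIMSEQ_iff dir_deriv_def by (rule tendsto_rabs)
  then show ?thesis
    by (rule LIMSEQ_le_const2) (use lipschitz_quotient_bound[OF assms(1)] in simp)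
qed

text \<open>The quotient along \<open>v + w\<close> is the quotient along \<open>v\<close> at
  \<open>z\<close> plus the quotient along \<open>w\<close> at a point shifted along
  \<open>v\<close>, where no pointwise limit is available. Integrated over a box, the shift passes
  to the indicator and vanishes in the limit by dominated convergence.\<close>

lemma dir_deriv_add:
  fixes f :: "'a::euclidean_space \<Rightarrow> real"
  assumes lip: "L-lipschitz_on UNIV f"
  shows "AE z in lborel. dir_deriv f (v + w) z = dir_deriv f v z + dir_deriv f w z"
proof -
  define q where "q v k z = (f (z + null_step k *\<^sub>R v) - f z) / null_step k" for v k z
  have [measurable]: "f \<in> borel_measurable borel" using lip by (rule lipschitz_borel_measurable)
  have qm [measurable]: "q v k \<in> borel_measurable borel" for v k unfolding q_def by measurable
  have qb: "\<bar>q v k z\<bar> \<le> L * norm v" for v k z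
    unfolding q_def by (rule lipschitz_quotient_bound[OF lip]) simp
  have L: "0 \<le> L" using lip by (rule lipschitz_on_nonneg)
  have conv: "AE z in lborel. (\<lambda>k. q v k z) \<longlonglongrightarrow> dir_deriv f v z" for v
    using lipschitz_AE_directional[OF lip, of v]
    by eventually_elim (simp add: q_def dir_deriv_def convergent_LIMSEQ_iff)
  have db: "AE z in lborel. \<bar>dir_deriv f v z\<bar> \<le> L * norm v" for v
    using lipschitz_AE_directional[OF lip, of v] by eventually_elim (rule dir_deriv_bound[OF lip])
  \<comment> \<open>Truncation leaves \<open>dir_deriv\<close> unchanged almost everywhere and gives
    a bound at every point, as the criterion with box integrals requires.\<close>
  define D where "D v z = max (- (L * norm v)) (min (L * norm v) (dir_deriv f v z))" for v z
  have Db: "\<bar>D v z\<bar> \<le> L * norm v" for v z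
    using L by (auto simp: D_def min_def max_def)
  have Dm [measurable]: "D v \<in> borel_measurable borel" for v unfolding D_def by measurable
  have Deq: "AE z in lborel. D v z = dir_deriv f v z" for v
    using db[of v] by eventually_elim (auto simp: D_def)
  have convD: "AE z in lborel. (\<lambda>k. q v k z) \<longlonglongrightarrow> D v z" for v
    using conv[of v] Deq[of v] by eventually_elim simp
  have "AE z in lborel. D (v + w) z - D v z - D w z = 0"
  proof (rule AE_zero_of_box_integrals)
    show "\<bar>D (v + w) z - D v z - D w z\<bar> \<le> L * norm (v + w) + L * norm v + L * norm w" for z
      using Db[of "v + w" z] Db[of v z] Db[of w z] by linarith
    fix l u :: 'a
    let ?B = "indicator (box l u) :: 'a \<Rightarrow> real"
    have iB: "integrable lborel ?B"
      by (rule integrable_real_indicator) (use emeasure_lborel_box_finite[of l u] in auto)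
    have ib: "integrable lborel (\<lambda>z. ?B z * h z)"
      if "h \<in> borel_measurable borel" "\<And>z. \<bar>h z\<bar> \<le> M" for h M
    proof (rule Bochner_Integration.integrable_bound[OF integrable_mult_right[OF iB, of M]])
      show "AE z in lborel. norm (?B z * h z) \<le> norm (M * ?B z)"
        using that(2) by (intro AE_I2) (auto simp: indicator_def intro: order_trans[OF _ abs_ge_self])
    qed (use that(1) in measurable)
    have t1: "(\<lambda>k. \<integral>z. ?B z * q v k z \<partial>lborel) \<longlonglongrightarrow> (\<integral>z. ?B z * D v z \<partial>lborel)" for v
    proof (rule integral_dominated_convergence)
      show "integrable lborel (\<lambda>z. (L * norm v) * ?B z)" using iB by simp
      show "AE z in lborel. (\<lambda>k. ?B z * q v k z) \<longlonglongrightarrow> ?B z * D v z"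
        using convD[of v] by eventually_elim (intro tendsto_intros)
      show "AE z in lborel. norm (?B z * q v k z) \<le> L * norm v * ?B z" for k
        using qb[of v k] by (auto simp: indicator_def)
    qed measurable
    have t2: "(\<lambda>k. \<integral>z. ?B z * q w k (z + null_step k *\<^sub>R v) \<partial>lborel) \<longlonglongrightarrow> (\<integral>z. ?B z * D w z \<partial>lborel)"
    proof -
      have shift: "(\<integral>z. ?B z * q w k (z + null_step k *\<^sub>R v) \<partial>lborel) =
          (\<integral>z. ?B (z - null_step k *\<^sub>R v) * q w k z \<partial>lborel)" for k
      proof -
        have "(\<integral>z. ?B (z - null_step k *\<^sub>R v) * q w k z \<partial>lborel) =
            (\<integral>z. ?B (z - null_step k *\<^sub>R v) * q w k z \<partial>distr lborel borel ((+) (null_step k *\<^sub>R v)))"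
          by (simp add: lborel_distr_plus)
        also have "\<dots> = (\<integral>z. ?B z * q w k (z + null_step k *\<^sub>R v) \<partial>lborel)"
          by (subst integral_distr) (auto simp: add.commute)
        finally show ?thesis by simp
      qed
      \<comment> \<open>All steps are at most 1 in absolute value, so the box enlarged by
        \<open>norm v\<close> in each coordinate contains every translate and yields the dominating
        function.\<close>
      let ?R = "cbox (l - (\<Sum>b\<in>Basis. norm v *\<^sub>R b)) (u + (\<Sum>b\<in>Basis. norm v *\<^sub>R b))"
      have sub: "?B (z - null_step k *\<^sub>R v) \<le> indicator ?R z" for k z
      proof (cases "z - null_step k *\<^sub>R v \<in> box l u")
        case True
        have "z \<in> ?R"
          unfolding mem_box
        proof
          fix b :: 'a assume b: "b \<in> Basis"
          have "\<bar>null_step k\<bar> \<le> 1" by (simp add: abs_null_step)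
          moreover have "\<bar>v \<bullet> b\<bar> \<le> norm v" by (rule Basis_le_norm[OF b])
          ultimately have "\<bar>null_step k * (v \<bullet> b)\<bar> \<le> 1 * norm v"
            unfolding abs_mult by (intro mult_mono) auto
          moreover have "l \<bullet> b < z \<bullet> b - null_step k * (v \<bullet> b)" "z \<bullet> b - null_step k * (v \<bullet> b) < u \<bullet> b"
            using True b by (auto simp: mem_box inner_diff_left)
          moreover have "(\<Sum>b\<in>Basis. norm v *\<^sub>R b) \<bullet> b = norm v"
            using b by simp
          ultimately show "(l - (\<Sum>b\<in>Basis. norm v *\<^sub>R b)) \<bullet> b \<le> z \<bullet> b \<and> z \<bullet> b \<le> (u + (\<Sum>b\<in>Basis. norm v *\<^sub>R b)) \<bullet> b"
            unfolding inner_diff_left inner_add_left by linarith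
        qed
        then show ?thesis by (simp add: indicator_def)
      qed simp
      show ?thesis unfolding shift
      proof (rule integral_dominated_convergence)
        show "integrable lborel (\<lambda>z. (L * norm w) * indicator ?R z)"
          by (intro integrable_mult_right integrable_real_indicator) (use emeasure_lborel_cbox_finite in auto)
        have "cbox l u - box l u \<in> null_sets lborel"
          using negligible_frontier_interval[of l u] by (simp add: negligible_iff_null_sets null_sets_completion_iff)
        then have "AE z in lborel. z \<notin> cbox l u - box l u" by (rule AE_not_in)
        with convD[of w] show "AE z in lborel. (\<lambda>k. ?B (z - null_step k *\<^sub>R v) * q w k z) \<longlonglongrightarrow> ?B z * D w z"
          by eventually_elim (intro tendsto_mult indicator_box_translate_tendsto null_step_tendsto)
        show "AE z in lborel. norm (?B (z - null_step k *\<^sub>R v) * q w k z) \<le> L * norm w * indicator ?R z" for k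
        proof (rule AE_I2)
          fix z
          have "norm (?B (z - null_step k *\<^sub>R v) * q w k z) = ?B (z - null_step k *\<^sub>R v) * \<bar>q w k z\<bar>"
            by (simp add: abs_mult)
          also have "\<dots> \<le> indicator ?R z * (L * norm w)"
            by (intro mult_mono sub qb) auto
          finally show "norm (?B (z - null_step k *\<^sub>R v) * q w k z) \<le> L * norm w * indicator ?R z"
            by (simp add: mult.commute)
        qed
      qed measurable
    qed
    have split: "(\<integral>z. ?B z * q (v + w) k z \<partial>lborel) =
        (\<integral>z. ?B z * q v k z \<partial>lborel) + (\<integral>z. ?B z * q w k (z + null_step k *\<^sub>R v) \<partial>lborel)" for k
    proof -
      have "?B z * q (v + w) k z = ?B z * q v k z + ?B z * q w k (z + null_step k *\<^sub>R v)" for z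
        by (simp add: q_def scaleR_add_right add.assoc diff_divide_distrib algebra_simps)
      moreover have "integrable lborel (\<lambda>z. ?B z * q v k z)"
        by (rule ib[OF qm qb])
      moreover have "integrable lborel (\<lambda>z. ?B z * q w k (z + null_step k *\<^sub>R v))"
        by (rule ib[OF _ qb]) measurable
      ultimately show ?thesis by simp
    qed
    have "(\<integral>z. ?B z * D (v + w) z \<partial>lborel) = (\<integral>z. ?B z * D v z \<partial>lborel) + (\<integral>z. ?B z * D w z \<partial>lborel)"
      by (rule LIMSEQ_unique[OF t1]) (unfold split, rule tendsto_add[OF t1 t2])
    then show "(\<integral>z. ?B z * (D (v + w) z - D v z - D w z) \<partial>lborel) = 0"
      using ib[OF Dm[of "v + w"] Db] ib[OF Dm[of v] Db] ib[OF Dm[of w] Db]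
      by (simp add: right_diff_distrib)
  qed measurable
  then show ?thesis
    using Deq[of "v + w"] Deq[of v] Deq[of w] by eventually_elim simp
qed

lemma line_has_deriv:
  fixes f :: "'a::euclidean_space \<Rightarrow> real"
  assumes lip: "L-lipschitz_on UNIV f"
    and conv: "convergent (\<lambda>k. (f (z + null_step k *\<^sub>R v) - f z) / null_step k)"
  shows "((\<lambda>t. f (z + t *\<^sub>R v)) has_real_derivative dir_deriv f v z) (at 0)"
proof (rule lipschitz_sequential_deriv)
  show "(L * norm v)-lipschitz_on UNIV (\<lambda>t. f (z + t *\<^sub>R v))"
  proof (rule lipschitz_onI)
    fix s t :: real
    have "dist (f (z + s *\<^sub>R v)) (f (z + t *\<^sub>R v)) \<le> L * dist (z + s *\<^sub>R v) (z + t *\<^sub>R v)"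
      by (rule lipschitz_onD[OF lip]) auto
    also have "dist (z + s *\<^sub>R v) (z + t *\<^sub>R v) = norm v * dist s t"
      by (simp add: dist_norm scaleR_diff_left[symmetric])
    finally show "dist (f (z + s *\<^sub>R v)) (f (z + t *\<^sub>R v)) \<le> L * norm v * dist s t" by simp
  qed (use lipschitz_on_nonneg[OF lip] in auto)
  show "(\<lambda>k. (f (z + null_step k *\<^sub>R v) - f (z + 0 *\<^sub>R v)) / null_step k) \<longlonglongrightarrow> dir_deriv f v z"
    using conv by (simp add: convergent_LIMSEQ_iff dir_deriv_def)
qed

lemma dir_deriv_eqI:
  assumes "((\<lambda>t. f (z + t *\<^sub>R v)) has_real_derivative d) (at 0)"
  shows "dir_deriv f v z = d"
proof -
  have "((\<lambda>t. (f (z + t *\<^sub>R v) - f z) / t) \<longlongrightarrow> d) (at 0)"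
    using assms by (simp add: has_field_derivative_iff)
  then have "(\<lambda>k. (f (z + null_step k *\<^sub>R v) - f z) / null_step k) \<longlonglongrightarrow> d"
    by (rule filterlim_compose) (simp add: filterlim_at null_step_tendsto)
  then show ?thesis unfolding dir_deriv_def by (rule limI)
qed

lemma dir_deriv_scaleR:
  fixes f :: "'a::euclidean_space \<Rightarrow> real"
  assumes lip: "L-lipschitz_on UNIV f"
    and conv: "convergent (\<lambda>k. (f (z + null_step k *\<^sub>R v) - f z) / null_step k)"
  shows "dir_deriv f (c *\<^sub>R v) z = c * dir_deriv f v z"
proof (rule dir_deriv_eqI)
  have "((\<lambda>t. c * t) has_real_derivative c) (at 0)"
    by (auto intro!: derivative_eq_intros)
  then have "((\<lambda>t. f (z + (c * t) *\<^sub>R v)) has_real_derivative dir_deriv f v z * c) (at 0)"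
    using line_has_deriv[OF lip conv] DERIV_chain2[of "\<lambda>t. f (z + t *\<^sub>R v)" "dir_deriv f v z" "\<lambda>t. c * t" 0 c UNIV]
    by simp
  then show "((\<lambda>t. f (z + t *\<^sub>R c *\<^sub>R v)) has_real_derivative c * dir_deriv f v z) (at 0)"
    by (simp add: mult.commute)
qed

lemma dir_deriv_zero: "dir_deriv f 0 z = 0"
  by (rule dir_deriv_eqI) simp

lemma AE_dir_deriv_linear:
  fixes f :: "'a::euclidean_space \<Rightarrow> real"
  assumes lip: "L-lipschitz_on UNIV f"
  shows "AE z in lborel. dir_deriv f v z = (\<Sum>b\<in>Basis. (v \<bullet> b) * dir_deriv f b z)"
proof -
  have "AE z in lborel. dir_deriv f (\<Sum>b\<in>B. (v \<bullet> b) *\<^sub>R b) z = (\<Sum>b\<in>B. (v \<bullet> b) * dir_deriv f b z)"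
    if "finite B" for B :: "'a set"
    using that
  proof (induction B rule: finite_induct)
    case empty show ?case by (simp add: dir_deriv_zero)
  next
    case (insert b B)
    from insert.IH dir_deriv_add[OF lip, of "(v \<bullet> b) *\<^sub>R b" "\<Sum>b\<in>B. (v \<bullet> b) *\<^sub>R b"] lipschitz_AE_directional[OF lip, of b]
    show ?case
    proof eventually_elim
      case (elim z)
      with insert.hyps dir_deriv_scaleR[OF lip elim(3), of "v \<bullet> b"] show ?case by simp
    qed
  qed
  from this[of Basis] show ?thesis by (simp add: euclidean_representation)
qed

text \<open>Compactness of the unit sphere selects finitely many directions of \<open>Q\<close>, for
  which the limits are uniform; Lipschitz continuity carries the estimate from these to all
  directions.\<close>

lemma differentiable_of_dense_directions:
  fixes f :: "'a::euclidean_space \<Rightarrow> real"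
  assumes lip: "L-lipschitz_on UNIV f"
    and dense: "\<And>x e. 0 < e \<Longrightarrow> \<exists>v\<in>Q. dist v x < e"
    and Q: "\<And>v. v \<in> Q \<Longrightarrow> ((\<lambda>t. f (z + t *\<^sub>R v)) has_real_derivative v \<bullet> g) (at 0)"
  shows "(f has_derivative (\<lambda>h. h \<bullet> g)) (at z)"
  unfolding has_derivative_at_within
proof (intro conjI)
  show "bounded_linear (\<lambda>h. h \<bullet> g)" by (rule bounded_linear_inner_left)
  have L: "0 \<le> L" using lip by (rule lipschitz_on_nonneg)
  show "((\<lambda>y. (f y - f z - (y - z) \<bullet> g) /\<^sub>R norm (y - z)) \<longlongrightarrow> 0) (at z)"
  proof (rule LIM_I)
    fix e :: real assume e: "e > 0"
    \<comment> \<open>Replacing a unit direction by one at distance less than \<open>d\<close> costs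
      \<open>L * d\<close> in \<open>f\<close> and \<open>d * norm g\<close> in the linear form;
      another \<open>d\<close> is the error of the quotient itself. In total this is
      \<open>M * d = e / 2\<close>.\<close>
    define M where "M = L + norm g + 1"
    define d where "d = e / (2 * M)"
    have M: "M > 0" using L by (simp add: M_def add_nonneg_pos)
    have d: "d > 0" using e M by (simp add: d_def)
    have cov: "sphere 0 1 \<subseteq> (\<Union>v\<in>Q. ball v d)"
      using dense[OF d] by auto
    obtain Q' where Q': "Q' \<subseteq> Q" "finite Q'" "sphere 0 1 \<subseteq> (\<Union>v\<in>Q'. ball v d)"
      by (rule compactE_image[OF compact_sphere _ cov]) auto
    have "\<exists>r>0. \<forall>t. t \<noteq> 0 \<and> \<bar>t\<bar> < r \<longrightarrow> \<bar>(f (z + t *\<^sub>R v) - f z) / t - v \<bullet> g\<bar> < d" if "v \<in> Q'" for v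
    proof -
      have "(\<lambda>t. (f (z + t *\<^sub>R v) - f z) / t) \<midarrow>0\<rightarrow> v \<bullet> g"
        using Q[of v] that Q'(1) by (auto simp: has_field_derivative_iff)
      from LIM_D[OF this d] show ?thesis by simp
    qed
    then obtain r where r: "\<And>v. v \<in> Q' \<Longrightarrow> r v > 0"
      "\<And>v t. v \<in> Q' \<Longrightarrow> t \<noteq> 0 \<Longrightarrow> \<bar>t\<bar> < r v \<Longrightarrow> \<bar>(f (z + t *\<^sub>R v) - f z) / t - v \<bullet> g\<bar> < d"
      by metis
    define R where "R = Min (insert 1 (r ` Q'))"
    have R: "R > 0" "\<And>v. v \<in> Q' \<Longrightarrow> R \<le> r v"
      using Q'(2) r(1) by (auto simp: R_def)
    show "\<exists>s>0. \<forall>x. x \<noteq> z \<and> norm (x - z) < s \<longrightarrow> norm ((f x - f z - (x - z) \<bullet> g) /\<^sub>R norm (x - z) - 0) < e"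
    proof (intro exI[of _ R] conjI allI impI R(1))
      fix x assume x: "x \<noteq> z \<and> norm (x - z) < R"
      define t where "t = norm (x - z)"
      define h where "h = (x - z) /\<^sub>R t"
      have t: "t > 0" using x by (simp add: t_def)
      have xh: "x = z + t *\<^sub>R h" using t by (simp add: h_def)
      have "norm h = 1" using t by (simp add: h_def t_def)
      then obtain v where v: "v \<in> Q'" "dist v h < d" using Q'(3) by auto
      have a: "\<bar>f x - f (z + t *\<^sub>R v)\<bar> \<le> L * (t * d)"
      proof -
        have "dist (f x) (f (z + t *\<^sub>R v)) \<le> L * dist x (z + t *\<^sub>R v)"
          by (rule lipschitz_onD[OF lip]) auto
        also have "dist x (z + t *\<^sub>R v) = t * dist v h"
          using t by (simp add: xh dist_norm scaleR_diff_right[symmetric] norm_minus_commute)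
        also have "L * (t * dist v h) \<le> L * (t * d)"
          using L t v(2) by (intro mult_left_mono) auto
        finally show ?thesis by (simp add: dist_real_def)
      qed
      have b: "\<bar>f (z + t *\<^sub>R v) - f z - t * (v \<bullet> g)\<bar> \<le> t * d"
      proof -
        have "\<bar>(f (z + t *\<^sub>R v) - f z) / t - v \<bullet> g\<bar> < d"
          using r(2)[OF v(1), of t] R(2)[OF v(1)] x t by (auto simp: t_def)
        then have "t * \<bar>(f (z + t *\<^sub>R v) - f z) / t - v \<bullet> g\<bar> \<le> t * d" using t by (intro mult_left_mono) auto
        moreover have "t * \<bar>(f (z + t *\<^sub>R v) - f z) / t - v \<bullet> g\<bar> = \<bar>t * ((f (z + t *\<^sub>R v) - f z) / t - v \<bullet> g)\<bar>"
          using t by (simp add: abs_mult)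
        moreover have "t * ((f (z + t *\<^sub>R v) - f z) / t - v \<bullet> g) = f (z + t *\<^sub>R v) - f z - t * (v \<bullet> g)"
          using t by (simp add: field_simps)
        ultimately show ?thesis by simp
      qed
      have c: "\<bar>t * (v \<bullet> g) - (x - z) \<bullet> g\<bar> \<le> t * (d * norm g)"
      proof -
        have "t * (v \<bullet> g) - (x - z) \<bullet> g = t * ((v - h) \<bullet> g)"
          by (simp add: xh inner_diff_left right_diff_distrib)
        also have "\<bar>\<dots>\<bar> \<le> t * (norm (v - h) * norm g)"
          using t Cauchy_Schwarz_ineq2[of "v - h" g] by (simp add: abs_mult)
        also have "\<dots> \<le> t * (d * norm g)"
          using t v(2) by (intro mult_left_mono mult_right_mono) (auto simp: dist_norm)
        finally show ?thesis .
      qed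
      have "\<bar>f x - f z - (x - z) \<bullet> g\<bar> \<le> L * (t * d) + t * d + t * (d * norm g)"
        using a b c by linarith
      also have "\<dots> = (M * d) * t" by (simp add: M_def algebra_simps)
      also have "M * d = e / 2" using M by (simp add: d_def)
      finally have "\<bar>f x - f z - (x - z) \<bullet> g\<bar> / t \<le> e / 2"
        using t by (simp add: divide_le_eq)
      then show "norm ((f x - f z - (x - z) \<bullet> g) /\<^sub>R norm (x - z) - 0) < e"
      proof -
        have "norm (X /\<^sub>R t - 0) = \<bar>X\<bar> / t" for X :: real
          using t by (simp add: abs_mult inverse_eq_divide)
        then have "norm ((f x - f z - (x - z) \<bullet> g) /\<^sub>R t - 0) \<le> e / 2"
          using \<open>\<bar>f x - f z - (x - z) \<bullet> g\<bar> / t \<le> e / 2\<close> by (simp only:)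
        then show ?thesis unfolding t_def using e by linarith
      qed
    qed
  qed
qed

text \<open>The null set off which a direction behaves linearly depends on the direction, so only a
  countable dense set of directions is treated simultaneously.\<close>

theorem rademacher_real:
  fixes f :: "'a::euclidean_space \<Rightarrow> real"
  assumes lip: "L-lipschitz_on UNIV f"
  shows "AE z in lborel. f differentiable (at z)"
proof -
  obtain Q :: "'a set" where Q: "countable Q" "\<And>X. open X \<Longrightarrow> X \<noteq> {} \<Longrightarrow> \<exists>d\<in>Q. d \<in> X"
    by (rule countable_dense_setE) blast
  have "AE z in lborel. \<forall>v\<in>Q. convergent (\<lambda>k. (f (z + null_step k *\<^sub>R v) - f z) / null_step k)"
    using Q(1) lipschitz_AE_directional[OF lip] by (simp add: AE_ball_countable)
  moreover have "AE z in lborel. \<forall>v\<in>Q. dir_deriv f v z = (\<Sum>b\<in>Basis. (v \<bullet> b) * dir_deriv f b z)"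
    using Q(1) AE_dir_deriv_linear[OF lip] by (simp add: AE_ball_countable)
  ultimately show ?thesis
  proof eventually_elim
    case (elim z)
    let ?g = "\<Sum>b\<in>Basis. dir_deriv f b z *\<^sub>R b"
    have "(f has_derivative (\<lambda>h. h \<bullet> ?g)) (at z)"
    proof (rule differentiable_of_dense_directions[OF lip])
      show "\<exists>v\<in>Q. dist v x < e" if "0 < e" for x e
        using Q(2)[of "ball x e"] that by (auto simp: dist_commute)
      fix v assume v: "v \<in> Q"
      have "dir_deriv f v z = v \<bullet> ?g"
        using elim(2) v by (simp add: inner_sum_right mult.commute)
      with line_has_deriv[OF lip bspec[OF elim(1) v]]
      show "((\<lambda>t. f (z + t *\<^sub>R v)) has_real_derivative v \<bullet> ?g) (at 0)" by simp
    qed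
    then show ?case by (rule differentiableI)
  qed
qed

theorem rademacher:
  fixes f :: "'a::euclidean_space \<Rightarrow> 'b::euclidean_space"
  assumes lip: "L-lipschitz_on UNIV f"
  shows "AE z in lborel. f differentiable (at z)"
proof -
  have "AE z in lborel. \<forall>i\<in>Basis. (\<lambda>x. f x \<bullet> i) differentiable (at z)"
  proof (subst AE_ball_countable)
    show "\<forall>i\<in>Basis. AE z in lborel. (\<lambda>x. f x \<bullet> i) differentiable (at z)"
    proof
      fix i :: 'b assume i: "i \<in> Basis"
      have "L-lipschitz_on UNIV (\<lambda>x. f x \<bullet> i)"
      proof (rule lipschitz_onI)
        fix x y :: 'a
        have "dist (f x \<bullet> i) (f y \<bullet> i) \<le> dist (f x) (f y)"
          using Basis_le_norm[OF i, of "f x - f y"] by (simp add: dist_norm inner_diff_left)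
        also have "\<dots> \<le> L * dist x y" by (rule lipschitz_onD[OF lip]) auto
        finally show "dist (f x \<bullet> i) (f y \<bullet> i) \<le> L * dist x y" .
      qed (rule lipschitz_on_nonneg[OF lip])
      then show "AE z in lborel. (\<lambda>x. f x \<bullet> i) differentiable (at z)" by (rule rademacher_real)
    qed
  qed (simp add: uncountable_def countable_finite)
  then show ?thesis
    by eventually_elim (simp add: differentiable_componentwise_within[of f])
qed

section \<open>Gradients of convex functions\<close>

lemma convex_on_gradient_below:
  fixes \<phi> :: "'a::euclidean_space \<Rightarrow> real"
  assumes cvx: "convex_on \<Omega> \<phi>" and x: "x \<in> interior \<Omega>" and der: "GDERIV \<phi> x :> g" and w: "w \<in> \<Omega>"
  shows "\<phi> x + g \<bullet> (w - x) \<le> \<phi> w"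
proof -
  define h where "h t = \<phi> (x + t *\<^sub>R (w - x))" for t :: real
  have "((\<lambda>t. x + t *\<^sub>R (w - x)) has_derivative (\<lambda>t. t *\<^sub>R (w - x))) (at 0)"
    by (auto intro!: derivative_eq_intros)
  moreover have "(\<phi> has_derivative (\<lambda>k. k \<bullet> g)) (at (x + 0 *\<^sub>R (w - x)))"
    using der by (simp add: gderiv_def)
  ultimately have "(h has_derivative (\<lambda>t. (t *\<^sub>R (w - x)) \<bullet> g)) (at 0)"
    unfolding h_def by (rule has_derivative_compose)
  then have "(h has_real_derivative (w - x) \<bullet> g) (at 0)"
    by (simp add: has_field_derivative_def mult_commute_abs)
  then have lim: "((\<lambda>t. (h t - h 0) / t) \<longlongrightarrow> (w - x) \<bullet> g) (at_right 0)"
    unfolding has_field_derivative_iff by (simp add: filterlim_at_split)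
  have "(w - x) \<bullet> g \<le> \<phi> w - \<phi> x"
  proof (rule tendsto_upperbound[OF lim])
    have "eventually (\<lambda>t. t \<in> {0<..<1}) (at_right (0::real))"
      by (rule eventually_at_right_real) simp
    then show "eventually (\<lambda>t. (h t - h 0) / t \<le> \<phi> w - \<phi> x) (at_right 0)"
    proof eventually_elim
      case (elim t)
      have "h t = \<phi> ((1 - t) *\<^sub>R x + t *\<^sub>R w)" by (simp add: h_def algebra_simps)
      also have "\<dots> \<le> (1 - t) * \<phi> x + t * \<phi> w"
        using cvx elim w interior_subset[of \<Omega>] x by (intro convex_onD) auto
      finally have "h t - h 0 \<le> t * (\<phi> w - \<phi> x)" by (simp add: h_def algebra_simps)
      then show ?case using elim by (simp add: divide_le_eq mult.commute)
    qed
  qed simp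
  then show ?thesis by (simp add: inner_commute)
qed

text \<open>In the intended case \<open>u\<close> is the Legendre transform of \<open>\<phi> + |x|\<^sup>2/2\<close> on \<open>\<Omega>\<close>, and \<open>J = \<nabla>u\<close> is the resolvent
  \<open>(id + \<partial>\<phi>)\<inverse>\<close>; the inequality between them encodes both convexity and smoothness of \<open>u\<close>.\<close>

locale resolvent =
  fixes u :: "'a::euclidean_space \<Rightarrow> real" and J :: "'a \<Rightarrow> 'a"
  assumes potential: "u z' + (z - z') \<bullet> J z' + (norm (J z - J z'))\<^sup>2 / 2 \<le> u z"

text \<open>The epigraph of \<phi> need not be closed, so the supremum defining \<open>u z\<close>
  may fail to be attained. Strong concavity of \<open>val z\<close> still makes a maximising
  sequence converge, and \<open>J z\<close> is its limit, possibly outside \<Omega>. The single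
  point of differentiability \<open>x0\<close> keeps \<open>u\<close> finite.\<close>

lemma convex_resolvent_exists:
  fixes \<phi> :: "'a::euclidean_space \<Rightarrow> real"
  assumes cvx: "convex_on \<Omega> \<phi>" and x0: "x0 \<in> interior \<Omega>" and der0: "GDERIV \<phi> x0 :> g0"
  obtains u :: "'a \<Rightarrow> real" and J :: "'a \<Rightarrow> 'a"
  where "resolvent u J" and "\<forall>x\<in>interior \<Omega>. \<forall>g. (GDERIV \<phi> x :> g) \<longrightarrow> J (x + g) = x"
proof -
  define val where "val z x = z \<bullet> x - \<phi> x - (norm x)\<^sup>2 / 2" for z x
  define u where "u z = (SUP x\<in>\<Omega>. val z x)" for z
  have x0\<Omega>: "x0 \<in> \<Omega>" using x0 interior_subset by blast
  \<comment> \<open>The supporting affine function at \<open>x0\<close> bounds \<phi> from below;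
    completing the square then bounds \<open>val z x\<close> independently of
    \<open>x\<close>.\<close>
  have bdd: "bdd_above (val z ` \<Omega>)" for z
  proof (rule bdd_aboveI2)
    fix x assume "x \<in> \<Omega>"
    then have "\<phi> x0 + g0 \<bullet> (x - x0) \<le> \<phi> x" by (rule convex_on_gradient_below[OF cvx x0 der0])
    moreover have "0 \<le> (norm (z - g0 - x))\<^sup>2" by simp
    moreover have "(norm (z - g0 - x))\<^sup>2 = (norm (z - g0))\<^sup>2 - 2 * ((z - g0) \<bullet> x) + (norm x)\<^sup>2"
      by (simp add: power2_norm_eq_inner inner_diff_left inner_diff_right inner_commute)
    moreover have "(z - g0) \<bullet> x = z \<bullet> x - g0 \<bullet> x" "g0 \<bullet> (x - x0) = g0 \<bullet> x - g0 \<bullet> x0"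
      by (simp_all add: inner_diff_left inner_diff_right)
    ultimately show "val z x \<le> (norm (z - g0))\<^sup>2 / 2 - \<phi> x0 + g0 \<bullet> x0"
      unfolding val_def by linarith
  qed
  have val_le: "val z x \<le> u z" if "x \<in> \<Omega>" for z x
    unfolding u_def using that bdd by (rule cSUP_upper)
  \<comment> \<open>The gain comes from the quadratic term of \<open>val\<close>, through the
    identity for the squared norm of a convex combination.\<close>
  have strong: "(1 - t) * val z x + t * val z y + t * (1 - t) * (norm (x - y))\<^sup>2 / 2 \<le> u z"
    if "x \<in> \<Omega>" "y \<in> \<Omega>" "0 \<le> t" "t \<le> 1" for z x y t
  proof -
    let ?w = "(1 - t) *\<^sub>R x + t *\<^sub>R y"
    have w: "?w \<in> \<Omega>" using convex_on_imp_convex[OF cvx] that by (intro convexD) auto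
    have "\<phi> ?w \<le> (1 - t) * \<phi> x + t * \<phi> y" using cvx that by (intro convex_onD) auto
    moreover have "(norm ?w)\<^sup>2 = (1 - t) * (norm x)\<^sup>2 + t * (norm y)\<^sup>2 - t * (1 - t) * (norm (x - y))\<^sup>2"
      by (simp add: power2_norm_eq_inner inner_simps inner_commute[of y x] algebra_simps)
    moreover have "z \<bullet> ?w = (1 - t) * (z \<bullet> x) + t * (z \<bullet> y)" by (simp add: inner_simps)
    ultimately have "(1 - t) * val z x + t * val z y + t * (1 - t) * (norm (x - y))\<^sup>2 / 2 \<le> val z ?w"
      unfolding val_def by (simp add: algebra_simps add_divide_distrib diff_divide_distrib)
    also have "\<dots> \<le> u z" by (rule val_le[OF w])
    finally show ?thesis .
  qed
  \<comment> \<open>\<open>p\<close> replaces a maximiser: the values decay quadratically away from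
    it, and it is approached by points of \<Omega> whose values tend to the supremum.\<close>
  have ex: "\<exists>p. (\<forall>x\<in>\<Omega>. val z x + (norm (x - p))\<^sup>2 / 2 \<le> u z) \<and>
      (\<exists>X. (\<forall>k::nat. X k \<in> \<Omega>) \<and> X \<longlonglongrightarrow> p \<and> (\<lambda>k. val z (X k)) \<longlonglongrightarrow> u z)" for z
  proof -
    have "\<exists>x\<in>\<Omega>. u z - 1 / real (Suc k) < val z x" for k
      using less_cSUP_iff[OF _ bdd, of "u z - 1 / real (Suc k)" z] x0\<Omega> by (auto simp: u_def)
    then obtain X where X: "\<And>k. X k \<in> \<Omega>" "\<And>k. u z - 1 / real (Suc k) < val z (X k)"
      by metis
    have limv: "(\<lambda>k. val z (X k)) \<longlonglongrightarrow> u z"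
    proof (rule tendsto_sandwich[of "\<lambda>k. u z - 1 / real (Suc k)" _ _ "\<lambda>_. u z"])
      have "(\<lambda>k. u z - inverse (real (Suc k))) \<longlonglongrightarrow> u z - 0"
        by (intro tendsto_diff tendsto_const LIMSEQ_inverse_real_of_nat)
      then show "(\<lambda>k. u z - 1 / real (Suc k)) \<longlonglongrightarrow> u z" by (simp add: inverse_eq_divide)
    qed (use X val_le in \<open>auto intro!: always_eventually less_imp_le simp del: of_nat_Suc\<close>)
    have "Cauchy X"
    proof (rule metric_CauchyI)
      fix e :: real assume e: "e > 0"
      obtain n where n: "8 / e\<^sup>2 < real n" using reals_Archimedean2 by blast
      have "dist (X i) (X j) < e" if "i \<ge> n" "j \<ge> n" for i j
      proof -
        have "0 < 8 / e\<^sup>2" using e by simp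
        have k: "1 / real (Suc k) < e\<^sup>2 / 8" if "k \<ge> n" for k
        proof -
          have "8 / e\<^sup>2 < real (Suc k)" using n that by linarith
          then show ?thesis using e by (simp add: field_simps)
        qed
        have "(1 - 1/2) * val z (X i) + 1/2 * val z (X j) + 1/2 * (1 - 1/2) * (norm (X i - X j))\<^sup>2 / 2 \<le> u z"
          by (rule strong) (use X in auto)
        then have "(norm (X i - X j))\<^sup>2 < e\<^sup>2"
          using X(2)[of i] X(2)[of j] k[OF that(1)] k[OF that(2)] by simp
        then show ?thesis using e by (simp add: dist_norm power_less_imp_less_base)
      qed
      then show "\<exists>M. \<forall>m\<ge>M. \<forall>n\<ge>M. dist (X m) (X n) < e" by blast
    qed
    then obtain p where p: "X \<longlonglongrightarrow> p" using Cauchy_convergent_iff convergent_def by blast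
    have "val z x + (norm (x - p))\<^sup>2 / 2 \<le> u z" if x: "x \<in> \<Omega>" for x
    proof -
      \<comment> \<open>Strong concavity between \<open>x\<close> and the maximising sequence, with
        weight \<open>t\<close> on the latter, leaves a factor \<open>t\<close> after division by
        \<open>1 - t\<close>; letting \<open>t\<close> tend to 1 removes it.\<close>
      have "t * ((norm (x - p))\<^sup>2 / 2) \<le> u z - val z x" if t: "0 < t" "t < 1" for t
      proof -
        have "(1 - t) * val z x + t * u z + t * (1 - t) * (norm (x - p))\<^sup>2 / 2 \<le> u z"
        proof (rule LIMSEQ_le_const2)
          show "(\<lambda>k. (1 - t) * val z x + t * val z (X k) + t * (1 - t) * (norm (x - X k))\<^sup>2 / 2)
            \<longlonglongrightarrow> (1 - t) * val z x + t * u z + t * (1 - t) * (norm (x - p))\<^sup>2 / 2"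
            by (intro tendsto_intros limv p) auto
          show "\<exists>N. \<forall>k\<ge>N. (1 - t) * val z x + t * val z (X k) + t * (1 - t) * (norm (x - X k))\<^sup>2 / 2 \<le> u z"
            using strong[OF x X(1)] t by auto
        qed
        then have "(1 - t) * (t * ((norm (x - p))\<^sup>2 / 2)) \<le> (1 - t) * (u z - val z x)"
          by (simp add: algebra_simps)
        then show ?thesis using t by (simp add: mult_le_cancel_left_pos)
      qed
      then have "(norm (x - p))\<^sup>2 / 2 \<le> u z - val z x" by (rule field_le_mult_one_interval)
      then show ?thesis by simp
    qed
    with X(1) p limv show ?thesis by blast
  qed
  then obtain J where J1: "\<And>z x. x \<in> \<Omega> \<Longrightarrow> val z x + (norm (x - J z))\<^sup>2 / 2 \<le> u z"
    and J2: "\<And>z. \<exists>X. (\<forall>k::nat. X k \<in> \<Omega>) \<and> X \<longlonglongrightarrow> J z \<and> (\<lambda>k. val z (X k)) \<longlonglongrightarrow> u z"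
    by metis
  show thesis
  proof (rule that)
    show "resolvent u J"
    proof
      fix z z'
      obtain X where X: "\<And>k::nat. X k \<in> \<Omega>" "X \<longlonglongrightarrow> J z'" "(\<lambda>k. val z' (X k)) \<longlonglongrightarrow> u z'"
        using J2 by blast
      show "u z' + (z - z') \<bullet> J z' + (norm (J z - J z'))\<^sup>2 / 2 \<le> u z"
      proof (rule LIMSEQ_le_const2)
        show "(\<lambda>k. val z' (X k) + (z - z') \<bullet> X k + (norm (J z - X k))\<^sup>2 / 2) \<longlonglongrightarrow>
            u z' + (z - z') \<bullet> J z' + (norm (J z - J z'))\<^sup>2 / 2"
          by (intro tendsto_intros X) auto
        \<comment> \<open>\<open>val\<close> is affine in \<open>z\<close> with slope
          \<open>x\<close>, so the decay estimate at \<open>z\<close>, evaluated at points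
          approaching \<open>J z'\<close>, becomes the potential inequality.\<close>
        have "val z' (X k) + (z - z') \<bullet> X k + (norm (J z - X k))\<^sup>2 / 2 \<le> u z" for k
          using J1[OF X(1), of z k] by (simp add: val_def inner_diff_left norm_minus_commute)
        then show "\<exists>N. \<forall>k\<ge>N. val z' (X k) + (z - z') \<bullet> X k + (norm (J z - X k))\<^sup>2 / 2 \<le> u z" by blast
      qed
    qed
  next
    show "\<forall>x\<in>interior \<Omega>. \<forall>g. (GDERIV \<phi> x :> g) \<longrightarrow> J (x + g) = x"
    proof (intro ballI allI impI)
      fix x g assume x: "x \<in> interior \<Omega>" and g: "GDERIV \<phi> x :> g"
      have x\<Omega>: "x \<in> \<Omega>" using x interior_subset by blast
      have "val (x + g) w \<le> val (x + g) x" if "w \<in> \<Omega>" for w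
      proof -
        have "\<phi> x + g \<bullet> (w - x) \<le> \<phi> w" using convex_on_gradient_below[OF cvx x g that] .
        moreover have "0 \<le> (norm (w - x))\<^sup>2" by simp
        moreover have "(norm (w - x))\<^sup>2 = (norm w)\<^sup>2 - 2 * (x \<bullet> w) + (norm x)\<^sup>2"
          by (simp add: power2_norm_eq_inner inner_diff_left inner_diff_right inner_commute)
        moreover have "x \<bullet> x = (norm x)\<^sup>2" by (simp add: power2_norm_eq_inner)
        ultimately show ?thesis by (simp add: val_def inner_simps)
      qed
      then have "u (x + g) \<le> val (x + g) x"
        unfolding u_def using x0\<Omega> by (intro cSUP_least) auto
      with J1[OF x\<Omega>, of "x + g"] have "(norm (x - J (x + g)))\<^sup>2 \<le> 0" by linarith
      then show "J (x + g) = x" by simp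
    qed
  qed
qed

section \<open>Calculus of the resolvent\<close>

context resolvent
begin

text \<open>Firm nonexpansiveness is the sum of the potential inequality and its copy with the two
  points exchanged.\<close>

lemma cocoercive: "(norm (J z - J z'))\<^sup>2 \<le> (z - z') \<bullet> (J z - J z')"
proof -
  have "(z - z') \<bullet> (J z - J z') = - ((z - z') \<bullet> J z') - (z' - z) \<bullet> J z"
    by (simp add: inner_diff_left inner_diff_right)
  then show ?thesis
    using potential[of z' z] potential[of z z'] by (simp add: norm_minus_commute)
qed

lemma monotone: "0 \<le> (z - z') \<bullet> (J z - J z')"
  using cocoercive[of z z'] by (meson order_trans zero_le_power2)

lemma nonexpansive: "norm (J z - J z') \<le> norm (z - z')"
proof (cases "J z = J z'")
  case False
  have "norm (J z - J z') * norm (J z - J z') \<le> norm (z - z') * norm (J z - J z')"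
    using cocoercive[of z z'] norm_cauchy_schwarz[of "z - z'" "J z - J z'"] by (simp add: power2_eq_square)
  with False show ?thesis by simp
qed simp

lemma lipschitz: "1-lipschitz_on UNIV J"
  by (rule lipschitz_onI) (simp_all add: dist_norm nonexpansive)

lemma potential_has_derivative: "(u has_derivative (\<lambda>h. h \<bullet> J z)) (at z)"
  unfolding has_derivative_at_alt
proof (intro conjI allI impI)
  show "bounded_linear (\<lambda>h. h \<bullet> J z)" by (rule bounded_linear_inner_left)
  fix e :: real assume e: "e > 0"
  show "\<exists>d>0. \<forall>y. norm (y - z) < d \<longrightarrow> norm (u y - u z - (y - z) \<bullet> J z) \<le> e * norm (y - z)"
  proof (intro exI[of _ e] conjI allI impI e)
    fix y assume y: "norm (y - z) < e"
    have lo: "0 \<le> u y - u z - (y - z) \<bullet> J z"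
      using potential[of z y] zero_le_power2[of "norm (J y - J z)"] by linarith
    have "u y - u z - (y - z) \<bullet> J z \<le> (y - z) \<bullet> (J y - J z)"
    proof -
      have "u y + (z - y) \<bullet> J y \<le> u z"
        using potential[of y z] zero_le_power2[of "norm (J z - J y)"] by linarith
      then show ?thesis by (simp add: inner_diff_left inner_diff_right)
    qed
    also have "\<dots> \<le> norm (y - z) * norm (J y - J z)" by (rule norm_cauchy_schwarz)
    also have "\<dots> \<le> norm (y - z) * norm (y - z)" by (intro mult_left_mono nonexpansive) simp
    also have "\<dots> \<le> e * norm (y - z)" using y by (intro mult_right_mono) auto
    finally show "norm (u y - u z - (y - z) \<bullet> J z) \<le> e * norm (y - z)" using lo by simp
  qed
qed

lemma potential_line_derivative:
  "((\<lambda>t. u (w + t *\<^sub>R k)) has_real_derivative (k \<bullet> J (w + t *\<^sub>R k))) (at t)"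
proof -
  have "((\<lambda>t. w + t *\<^sub>R k) has_derivative (\<lambda>s. s *\<^sub>R k)) (at t)"
    by (auto intro!: derivative_eq_intros)
  from has_derivative_compose[OF this potential_has_derivative]
  show ?thesis by (simp add: has_field_derivative_def mult_commute_abs)
qed

text \<open>The core of Schwarz's theorem for a function whose gradient is known to be
  differentiable only at the one point \<open>z\<close>: the mean value theorem is applied in the
  direction \<open>k\<close> alone and turns the second difference into values of \<open>J\<close>
  near \<open>z\<close>.\<close>

lemma second_difference:
  assumes D: "(J has_derivative D) (at z)" and e: "e > 0"
  shows "\<exists>d>0. \<forall>s. 0 < s \<and> s < d \<longrightarrow>
    \<bar>u (z + s *\<^sub>R h + s *\<^sub>R k) - u (z + s *\<^sub>R h) - u (z + s *\<^sub>R k) + u z - s\<^sup>2 * (k \<bullet> D h)\<bar> \<le> s\<^sup>2 * e"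
proof -
  interpret D: bounded_linear D using D by (rule has_derivative_bounded_linear)
  define C where "C = norm h + norm k + 1"
  have C: "C > 0" by (simp add: C_def add_nonneg_pos)
  \<comment> \<open>One factor \<open>C\<close> bounds \<open>norm k\<close>, the other the
    displacement divided by \<open>s\<close>, and 2 counts the two error terms.\<close>
  define e' where "e' = e / (2 * C * C)"
  have e': "e' > 0" using e C by (simp add: e'_def)
  obtain d where d: "d > 0" "\<And>y. norm (y - z) < d \<Longrightarrow> norm (J y - J z - D (y - z)) \<le> e' * norm (y - z)"
    using D e' unfolding has_derivative_at_alt by blast
  have r: "norm (J (z + v) - J z - D v) \<le> e' * (s * C)" if "norm v \<le> s * C" "s * C < d" for v s
  proof -
    have "norm (J (z + v) - J z - D v) \<le> e' * norm v"
      using d(2)[of "z + v"] that by simp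
    also have "\<dots> \<le> e' * (s * C)" using that e' by (intro mult_left_mono) auto
    finally show ?thesis .
  qed
  show ?thesis
  proof (intro exI[of _ "d / C"] conjI allI impI)
    show "0 < d / C" using d(1) C by simp
    fix s :: real assume s: "0 < s \<and> s < d / C"
    then have sC: "s * C < d" using C by (simp add: field_simps)
    define \<xi> where "\<xi> t = u (z + s *\<^sub>R h + t *\<^sub>R k) - u (z + t *\<^sub>R k)" for t
    have der: "(\<xi> has_real_derivative (k \<bullet> J (z + s *\<^sub>R h + t *\<^sub>R k) - k \<bullet> J (z + t *\<^sub>R k))) (at t)" for t
      unfolding \<xi>_def by (intro DERIV_diff potential_line_derivative)
    obtain t where t: "0 < t" "t < s"
      "\<xi> s - \<xi> 0 = (s - 0) * (k \<bullet> J (z + s *\<^sub>R h + t *\<^sub>R k) - k \<bullet> J (z + t *\<^sub>R k))"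
      using MVT2[of 0 s \<xi>, OF _ der] s by blast
    let ?a = "J (z + (s *\<^sub>R h + t *\<^sub>R k)) - J z - D (s *\<^sub>R h + t *\<^sub>R k)"
    let ?b = "J (z + t *\<^sub>R k) - J z - D (t *\<^sub>R k)"
    have tk: "norm (t *\<^sub>R k) \<le> s * norm k" using t by (simp add: mult_right_mono)
    have "norm (s *\<^sub>R h + t *\<^sub>R k) \<le> s * C"
      using norm_triangle_ineq[of "s *\<^sub>R h" "t *\<^sub>R k"] tk s by (simp add: C_def algebra_simps)
    then have a: "norm ?a \<le> e' * (s * C)" using sC by (rule r)
    have "norm (t *\<^sub>R k) \<le> s * C"
    proof -
      have "s * norm k \<le> s * C" using s by (intro mult_left_mono) (auto simp: C_def)
      with tk show ?thesis by linarith
    qed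
    then have b: "norm ?b \<le> e' * (s * C)" using sC by (rule r)
    have "\<xi> s - \<xi> 0 - s\<^sup>2 * (k \<bullet> D h) = s * (k \<bullet> (?a - ?b))"
      unfolding t(3) by (simp add: D.add D.scaleR inner_simps add.assoc power2_eq_square algebra_simps)
    also have "\<bar>\<dots>\<bar> \<le> s * (norm k * norm (?a - ?b))"
      using s Cauchy_Schwarz_ineq2[of k "?a - ?b"] by (simp add: abs_mult)
    also have "\<dots> \<le> s * (C * (2 * (e' * (s * C))))"
    proof (intro mult_left_mono mult_mono)
      show "norm (?a - ?b) \<le> 2 * (e' * (s * C))" using norm_triangle_ineq4[of ?a ?b] a b by linarith
    qed (use s C in \<open>auto simp: C_def\<close>)
    also have "\<dots> = s\<^sup>2 * e" using C by (simp add: e'_def power2_eq_square field_simps)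
    finally have "\<bar>\<xi> s - \<xi> 0 - s\<^sup>2 * (k \<bullet> D h)\<bar> \<le> s\<^sup>2 * e" .
    then show "\<bar>u (z + s *\<^sub>R h + s *\<^sub>R k) - u (z + s *\<^sub>R h) - u (z + s *\<^sub>R k) + u z - s\<^sup>2 * (k \<bullet> D h)\<bar> \<le> s\<^sup>2 * e"
      by (simp add: \<xi>_def algebra_simps)
  qed
qed

text \<open>Both sides are the limit of one second difference divided by \<open>s\<^sup>2\<close>,
  and that difference is symmetric in \<open>h\<close> and \<open>k\<close>.\<close>

lemma derivative_symmetric:
  assumes D: "(J has_derivative D) (at z)"
  shows "k \<bullet> D h = h \<bullet> D k"
proof -
  have "\<bar>k \<bullet> D h - h \<bullet> D k\<bar> \<le> 0 + e" if e: "e > 0" for e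
  proof -
    have e2: "e / 2 > 0" using e by simp
    obtain d1 where d1: "d1 > 0" "\<And>s. 0 < s \<Longrightarrow> s < d1 \<Longrightarrow>
      \<bar>u (z + s *\<^sub>R h + s *\<^sub>R k) - u (z + s *\<^sub>R h) - u (z + s *\<^sub>R k) + u z - s\<^sup>2 * (k \<bullet> D h)\<bar> \<le> s\<^sup>2 * (e / 2)"
      using second_difference[OF D e2, of h k] by blast
    obtain d2 where d2: "d2 > 0" "\<And>s. 0 < s \<Longrightarrow> s < d2 \<Longrightarrow>
      \<bar>u (z + s *\<^sub>R k + s *\<^sub>R h) - u (z + s *\<^sub>R k) - u (z + s *\<^sub>R h) + u z - s\<^sup>2 * (h \<bullet> D k)\<bar> \<le> s\<^sup>2 * (e / 2)"
      using second_difference[OF D e2, of k h] by blast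
    define s where "s = min d1 d2 / 2"
    have s: "0 < s" "s < d1" "s < d2" using d1(1) d2(1) by (auto simp: s_def)
    have "z + s *\<^sub>R k + s *\<^sub>R h = z + s *\<^sub>R h + s *\<^sub>R k" by simp
    then have "\<bar>s\<^sup>2 * (k \<bullet> D h) - s\<^sup>2 * (h \<bullet> D k)\<bar> \<le> s\<^sup>2 * (e / 2) + s\<^sup>2 * (e / 2)"
      using d1(2)[OF s(1,2)] d2(2)[OF s(1,3)] by (simp only:)
    also have "s\<^sup>2 * (k \<bullet> D h) - s\<^sup>2 * (h \<bullet> D k) = s\<^sup>2 * (k \<bullet> D h - h \<bullet> D k)"
      by (simp only: right_diff_distrib)
    finally have "s\<^sup>2 * \<bar>k \<bullet> D h - h \<bullet> D k\<bar> \<le> s\<^sup>2 * e"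
      by (simp only: abs_mult abs_power2 distrib_left[symmetric]) simp
    then have "\<bar>k \<bullet> D h - h \<bullet> D k\<bar> \<le> e"
      by (rule mult_left_le_imp_le) (use s(1) in simp)
    then show ?thesis by simp
  qed
  then have "\<bar>k \<bullet> D h - h \<bullet> D k\<bar> \<le> 0" by (rule field_le_epsilon)
  then show ?thesis by simp
qed

lemma derivative_cocoercive:
  assumes D: "(J has_derivative D) (at z)"
  shows "(norm (D h))\<^sup>2 \<le> h \<bullet> D h"
proof -
  interpret D: bounded_linear D using D by (rule has_derivative_bounded_linear)
  have lim: "((\<lambda>t. (J (z + t *\<^sub>R h) - J z) /\<^sub>R t) \<longlongrightarrow> D h) (at 0)"
  proof (rule LIM_I)
    fix e :: real assume e: "e > 0"
    have h1: "norm h + 1 > 0" by (simp add: add_nonneg_pos)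
    have e': "e / (norm h + 1) > 0" using e h1 by simp
    obtain r where r: "r > 0" "\<And>y. norm (y - z) < r \<Longrightarrow> norm (J y - J z - D (y - z)) \<le> e / (norm h + 1) * norm (y - z)"
      using D e' unfolding has_derivative_at_alt by blast
    show "\<exists>s>0. \<forall>t. t \<noteq> 0 \<and> norm (t - 0) < s \<longrightarrow> norm ((J (z + t *\<^sub>R h) - J z) /\<^sub>R t - D h) < e"
    proof (intro exI[of _ "r / (norm h + 1)"] conjI allI impI)
      show "0 < r / (norm h + 1)" using r(1) h1 by simp
      fix t :: real assume t: "t \<noteq> 0 \<and> norm (t - 0) < r / (norm h + 1)"
      then have "\<bar>t\<bar> * (norm h + 1) < r" using h1 by (simp add: field_simps)
      moreover have "\<bar>t\<bar> * norm h \<le> \<bar>t\<bar> * (norm h + 1)" by (intro mult_left_mono) auto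
      ultimately have "norm (z + t *\<^sub>R h - z) < r" by simp
      from r(2)[OF this] have *: "norm (J (z + t *\<^sub>R h) - J z - t *\<^sub>R D h) \<le> e / (norm h + 1) * (\<bar>t\<bar> * norm h)"
        by (simp add: D.scaleR)
      have "(J (z + t *\<^sub>R h) - J z) /\<^sub>R t - D h = (J (z + t *\<^sub>R h) - J z - t *\<^sub>R D h) /\<^sub>R t"
        using t by (simp add: scaleR_diff_right)
      then have "norm ((J (z + t *\<^sub>R h) - J z) /\<^sub>R t - D h) = norm (J (z + t *\<^sub>R h) - J z - t *\<^sub>R D h) / \<bar>t\<bar>"
        by (simp add: divide_inverse mult.commute)
      also have "\<dots> \<le> e / (norm h + 1) * (\<bar>t\<bar> * norm h) / \<bar>t\<bar>"
        using * by (rule divide_right_mono) simp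
      also have "\<dots> = e * (norm h / (norm h + 1))" using t by simp
      also have "\<dots> < e * 1" using e h1 by (intro mult_strict_left_mono) auto
      finally show "norm ((J (z + t *\<^sub>R h) - J z) /\<^sub>R t - D h) < e" by simp
    qed
  qed
  show ?thesis
  proof (rule tendsto_le[OF _ _ _])
    show "((\<lambda>t. h \<bullet> ((J (z + t *\<^sub>R h) - J z) /\<^sub>R t)) \<longlongrightarrow> h \<bullet> D h) (at 0)"
      by (intro tendsto_intros lim)
    show "((\<lambda>t. (norm ((J (z + t *\<^sub>R h) - J z) /\<^sub>R t))\<^sup>2) \<longlongrightarrow> (norm (D h))\<^sup>2) (at 0)"
      by (intro tendsto_intros lim)
    show "eventually (\<lambda>t. (norm ((J (z + t *\<^sub>R h) - J z) /\<^sub>R t))\<^sup>2 \<le> h \<bullet> ((J (z + t *\<^sub>R h) - J z) /\<^sub>R t)) (at 0)"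
      unfolding eventually_at_filter
    proof (intro always_eventually allI impI)
      fix t :: real assume t: "t \<noteq> 0"
      define w where "w = J (z + t *\<^sub>R h) - J z"
      have "(norm w)\<^sup>2 \<le> t * (h \<bullet> w)"
        using cocoercive[of "z + t *\<^sub>R h" z] by (simp add: w_def)
      then have "(norm w)\<^sup>2 / t\<^sup>2 \<le> t * (h \<bullet> w) / t\<^sup>2"
        by (rule divide_right_mono) simp
      also have "t * (h \<bullet> w) / t\<^sup>2 = h \<bullet> (w /\<^sub>R t)"
        using t by (simp add: power2_eq_square divide_inverse mult.commute)
      also have "(norm w)\<^sup>2 / t\<^sup>2 = (norm (w /\<^sub>R t))\<^sup>2"
        by (simp add: power_mult_distrib power_inverse divide_inverse mult.commute)
      finally show "(norm ((J (z + t *\<^sub>R h) - J z) /\<^sub>R t))\<^sup>2 \<le> h \<bullet> ((J (z + t *\<^sub>R h) - J z) /\<^sub>R t)"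
        by (simp only: w_def)
    qed
  qed simp
qed

text \<open>Equality in the nonexpansiveness of \<open>J\<close> forces \<open>J\<close> to be a translation along the segment.\<close>

lemma affine_on_segment:
  assumes eq: "J (z + d) - J z = d" and s: "0 \<le> s" "s \<le> 1"
  shows "J (z + s *\<^sub>R d) = J z + s *\<^sub>R d"
proof -
  define e where "e = J (z + s *\<^sub>R d) - J z - s *\<^sub>R d"
  have a: "J (z + s *\<^sub>R d) - J z = s *\<^sub>R d + e" by (simp add: e_def)
  have b: "J (z + d) - J (z + s *\<^sub>R d) = (1 - s) *\<^sub>R d - e" using eq by (simp add: e_def algebra_simps)
  have "(norm (s *\<^sub>R d + e))\<^sup>2 \<le> (s *\<^sub>R d) \<bullet> (s *\<^sub>R d + e)"
    using cocoercive[of "z + s *\<^sub>R d" z] by (simp add: a)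
  then have 1: "(norm e)\<^sup>2 + s * (d \<bullet> e) \<le> 0"
    by (simp add: power2_norm_eq_inner inner_simps inner_commute algebra_simps)
  have "z + d - (z + s *\<^sub>R d) = (1 - s) *\<^sub>R d" by (simp add: algebra_simps)
  then have "(norm ((1 - s) *\<^sub>R d - e))\<^sup>2 \<le> ((1 - s) *\<^sub>R d) \<bullet> ((1 - s) *\<^sub>R d - e)"
    using cocoercive[of "z + d" "z + s *\<^sub>R d"] by (simp only: b)
  then have 2: "(norm e)\<^sup>2 - (1 - s) * (d \<bullet> e) \<le> 0"
    by (simp add: power2_norm_eq_inner inner_simps inner_commute algebra_simps)
  have "(1 - s) * ((norm e)\<^sup>2 + s * (d \<bullet> e)) + s * ((norm e)\<^sup>2 - (1 - s) * (d \<bullet> e)) \<le> 0"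
    using mult_left_mono[OF 1, of "1 - s"] mult_left_mono[OF 2, of s] s by simp
  then have "(norm e)\<^sup>2 \<le> 0" by (simp add: algebra_simps)
  then show ?thesis by (simp add: e_def algebra_simps)
qed

text \<open>A source of injectivity. If two points have the same gradient, \<open>id + G\<close>
  displaces them equally, so \<open>J\<close> reproduces the difference \<open>d\<close> of its
  arguments. That the derivative fixes \<open>d\<close> then means that \<open>d\<close> lies in the
  kernel of the Hessian.\<close>

lemma derivative_along_segment:
  assumes D: "(J has_derivative D) (at z)" and eq: "J (z + d) - J z = d"
  shows "D d = d"
proof -
  have "norm (D d - d) \<le> 0 + e" if e: "e > 0" for e
  proof -
    have e': "e / (norm d + 1) > 0" using e by (simp add: add_nonneg_pos)
    obtain r where r: "r > 0" "\<And>y. norm (y - z) < r \<Longrightarrow> norm (J y - J z - D (y - z)) \<le> e / (norm d + 1) * norm (y - z)"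
      using D e' unfolding has_derivative_at_alt by blast
    define s where "s = min 1 (r / (2 * (norm d + 1)))"
    have d1: "norm d + 1 > 0" by (simp add: add_nonneg_pos)
    have s: "0 < s" "s \<le> 1" using r(1) d1 by (auto simp: s_def)
    have "s * norm d \<le> r / (2 * (norm d + 1)) * (norm d + 1)"
      using d1 r(1) by (intro mult_mono) (auto simp: s_def)
    also have "\<dots> = r / 2"
    proof -
      have "r / (2 * N) * N = r / 2" if "N > 0" for N using that by simp
      from this[OF d1] show ?thesis .
    qed
    also have "\<dots> < r" using r(1) by simp
    finally have "norm (z + s *\<^sub>R d - z) < r" using s by simp
    from r(2)[OF this] have "norm (s *\<^sub>R d - D (s *\<^sub>R d)) \<le> e / (norm d + 1) * (s * norm d)"
      using affine_on_segment[OF eq, of s] s by simp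
    also have "s *\<^sub>R d - D (s *\<^sub>R d) = s *\<^sub>R (d - D d)"
      by (simp add: linear_scale[OF has_derivative_linear[OF D]] scaleR_diff_right)
    also have "norm (s *\<^sub>R (d - D d)) = s * norm (d - D d)" using s by simp
    also have "e / (norm d + 1) * (s * norm d) = s * (e * (norm d / (norm d + 1)))" by simp
    finally have "s * norm (d - D d) \<le> s * (e * (norm d / (norm d + 1)))" .
    then have "norm (d - D d) \<le> e * (norm d / (norm d + 1))" by (rule mult_left_le_imp_le[OF _ s(1)])
    also have "\<dots> \<le> e * 1" using e d1 by (intro mult_left_mono) (auto simp: divide_le_eq)
    finally show ?thesis by (simp add: norm_minus_commute)
  qed
  then have "norm (D d - d) \<le> 0" by (rule field_le_epsilon)
  then show ?thesis by simp
qed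

text \<open>\<open>F\<close> is an arbitrary section of \<open>J\<close> over \<open>S\<close>, and
  even its continuity at \<open>x\<close> has to be won from monotonicity: invertibility of
  \<open>D\<close> makes \<open>J\<close> strongly monotone around \<open>F x\<close>, and
  monotonicity along rays then prevents \<open>F y\<close> from staying far away while
  \<open>y\<close> approaches \<open>x\<close>.\<close>

lemma inverse_has_derivative:
  assumes D: "(J has_derivative D) (at (F x))" and E: "linear E" "\<And>h. E (D h) = h" "\<And>h. D (E h) = h"
    and F: "\<And>y. y \<in> S \<Longrightarrow> J (F y) = y" and x: "x \<in> S"
  shows "(F has_derivative E) (at x within S)"
proof -
  let ?z = "F x"
  have blE: "bounded_linear E" using E(1) by (rule linear_conv_bounded_linear[THEN iffD1])
  interpret E: bounded_linear E by (rule blE)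
  interpret D: bounded_linear D using D by (rule has_derivative_bounded_linear)
  obtain K where K: "K > 0" "\<And>h. norm (E h) \<le> norm h * K" using E.pos_bounded by blast
  \<comment> \<open>\<open>K\<close> bounds the inverse \<open>E\<close>, so
    \<open>norm h \<le> K * norm (D h)\<close>; cocoercivity of \<open>D\<close> turns this into the
    lower bound \<open>m\<close> for its quadratic form.\<close>
  define m where "m = 1 / K\<^sup>2"
  have m: "m > 0" using K(1) by (simp add: m_def)
  have Dpos: "m * (norm h)\<^sup>2 \<le> h \<bullet> D h" for h
  proof -
    have "norm h \<le> norm (D h) * K" using K(2)[of "D h"] E(2)[of h] by simp
    then have "(norm h)\<^sup>2 \<le> (norm (D h) * K)\<^sup>2" by (rule power_mono) simp
    then have "m * (norm h)\<^sup>2 \<le> (norm (D h))\<^sup>2" using K(1) by (simp add: m_def power_mult_distrib field_simps)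
    also have "\<dots> \<le> h \<bullet> D h" by (rule derivative_cocoercive[OF D])
    finally show ?thesis .
  qed
  have "m / 2 > 0" using m by simp
  then obtain d where d: "d > 0" "\<And>y. norm (y - ?z) < d \<Longrightarrow> norm (J y - J ?z - D (y - ?z)) \<le> m / 2 * norm (y - ?z)"
    using D unfolding has_derivative_at_alt by blast
  have mono_near: "m / 2 * (norm v)\<^sup>2 \<le> v \<bullet> (J (?z + v) - J ?z)" if "norm v < d" for v
  proof -
    have "\<bar>v \<bullet> (J (?z + v) - J ?z - D v)\<bar> \<le> norm v * norm (J (?z + v) - J ?z - D v)"
      by (rule Cauchy_Schwarz_ineq2)
    also have "\<dots> \<le> norm v * (m / 2 * norm v)"
      using d(2)[of "?z + v"] that by (intro mult_left_mono) auto
    also have "norm v * (m / 2 * norm v) = m / 2 * (norm v)\<^sup>2" by (simp add: power2_eq_square)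
    also have "v \<bullet> (J (?z + v) - J ?z - D v) = v \<bullet> (J (?z + v) - J ?z) - v \<bullet> D v"
      by (simp only: inner_diff_right)
    finally show ?thesis using Dpos[of v] by linarith
  qed
  have calm: "m / 2 * norm (F y - ?z) \<le> norm (y - x)" "norm (F y - ?z) < d"
    if y: "y \<in> S" and near: "norm (y - x) < m / 2 * (d / 2)" for y
  proof -
    define v where "v = F y - ?z"
    show lt: "norm (F y - ?z) < d"
    proof (rule ccontr)
      assume "\<not> ?thesis"
      then have vd: "norm v \<ge> d" by (simp add: v_def)
      then have v0: "norm v > 0" using d(1) by linarith
      \<comment> \<open>The scaling puts \<open>s *\<^sub>R v\<close> at norm \<open>d / 2\<close>,
        inside the region of strong monotonicity; by monotonicity the inequality obtained there
        persists further out on the ray.\<close>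
      define s where "s = (d / 2) / norm v"
      have s: "0 < s" "s < 1" using d(1) vd v0 by (auto simp: s_def divide_less_eq)
      have nsv: "norm (s *\<^sub>R v) = d / 2" using v0 d(1) by (simp add: s_def)
      have "0 \<le> (?z + v - (?z + s *\<^sub>R v)) \<bullet> (J (?z + v) - J (?z + s *\<^sub>R v))" by (rule monotone)
      also have "?z + v - (?z + s *\<^sub>R v) = (1 - s) *\<^sub>R v" by (simp add: algebra_simps)
      finally have "0 \<le> v \<bullet> (J (?z + v) - J (?z + s *\<^sub>R v))" using s by (simp add: zero_le_mult_iff)
      moreover have "m / 2 * (norm (s *\<^sub>R v))\<^sup>2 \<le> (s *\<^sub>R v) \<bullet> (J (?z + s *\<^sub>R v) - J ?z)"
        by (rule mono_near) (use nsv d(1) in simp)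
      ultimately have "m / 2 * (d / 2)\<^sup>2 \<le> s * (v \<bullet> (J (?z + v) - J ?z))"
      proof -
        assume 1: "0 \<le> v \<bullet> (J (?z + v) - J (?z + s *\<^sub>R v))"
          and 2: "m / 2 * (norm (s *\<^sub>R v))\<^sup>2 \<le> (s *\<^sub>R v) \<bullet> (J (?z + s *\<^sub>R v) - J ?z)"
        have "m / 2 * (d / 2)\<^sup>2 \<le> s * (v \<bullet> (J (?z + s *\<^sub>R v) - J ?z))"
          using 2 unfolding nsv by simp
        also have "\<dots> \<le> s * (v \<bullet> (J (?z + v) - J ?z))"
          using 1 s(1) by (intro mult_left_mono) (simp_all add: inner_diff_right)
        finally show ?thesis .
      qed
      also have "\<dots> \<le> s * (norm v * norm (J (?z + v) - J ?z))"
        using s norm_cauchy_schwarz by (intro mult_left_mono) auto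
      also have "\<dots> = (d / 2) * norm (y - x)"
        using F[OF y] F[OF x] v0 by (simp add: s_def v_def)
      also have "\<dots> < (d / 2) * (m / 2 * (d / 2))"
        using near d(1) by (intro mult_strict_left_mono) auto
      finally show False by (simp add: power2_eq_square algebra_simps)
    qed
    have "m / 2 * (norm v)\<^sup>2 \<le> v \<bullet> (J (?z + v) - J ?z)" by (rule mono_near) (use lt in \<open>simp add: v_def\<close>)
    also have "\<dots> = v \<bullet> (y - x)" using F[OF y] F[OF x] by (simp add: v_def)
    also have "\<dots> \<le> norm v * norm (y - x)" by (rule norm_cauchy_schwarz)
    finally have "norm v * (m / 2 * norm v) \<le> norm v * norm (y - x)"
      by (simp add: power2_eq_square algebra_simps)
    then show "m / 2 * norm (F y - ?z) \<le> norm (y - x)"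
      unfolding v_def[symmetric] by (cases "v = 0") auto
  qed
  show ?thesis
    unfolding has_derivative_within_alt
  proof (intro conjI allI impI blE)
    fix e :: real assume e: "e > 0"
    define e' where "e' = e * (m / 2) / K"
    have e': "e' > 0" using e m K(1) by (simp add: e'_def)
    obtain r where r: "r > 0" "\<And>y. norm (y - ?z) < r \<Longrightarrow> norm (J y - J ?z - D (y - ?z)) \<le> e' * norm (y - ?z)"
      using D e' unfolding has_derivative_at_alt by blast
    show "\<exists>\<delta>>0. \<forall>y\<in>S. norm (y - x) < \<delta> \<longrightarrow> norm (F y - F x - E (y - x)) \<le> e * norm (y - x)"
    proof (intro exI[of _ "min (m / 2 * (d / 2)) (m / 2 * r)"] conjI ballI impI)
      show "0 < min (m / 2 * (d / 2)) (m / 2 * r)" using m d(1) r(1) by simp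
      fix y assume y: "y \<in> S" and near: "norm (y - x) < min (m / 2 * (d / 2)) (m / 2 * r)"
      have c: "m / 2 * norm (F y - ?z) \<le> norm (y - x)" using calm(1)[OF y] near by simp
      then have "m / 2 * norm (F y - ?z) < m / 2 * r" using near by simp
      then have "norm (F y - ?z) < r" using m by (simp only: mult_less_cancel_left_pos \<open>m / 2 > 0\<close>)
      from r(2)[OF this] have *: "norm (y - x - D (F y - ?z)) \<le> e' * norm (F y - ?z)"
        using F[OF y] F[OF x] by simp
      have "F y - F x - E (y - x) = - E (y - x - D (F y - ?z))"
        by (simp add: E.diff E(2))
      then have "norm (F y - F x - E (y - x)) \<le> norm (y - x - D (F y - ?z)) * K"
        using K(2)[of "y - x - D (F y - ?z)"] by (simp only: norm_minus_cancel)
      also have "\<dots> \<le> e' * norm (F y - ?z) * K" using * K(1) by (intro mult_right_mono) auto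
      also have "\<dots> = e * (m / 2 * norm (F y - ?z))" using K(1) by (simp add: e'_def)
      also have "\<dots> \<le> e * norm (y - x)" using c e by (intro mult_left_mono) auto
      finally show "norm (F y - F x - E (y - x)) \<le> e * norm (y - x)" .
    qed
  qed
qed

end

section \<open>Second derivatives of convex functions almost everywhere\<close>

lemma negligible_subset_null_borel:
  fixes A :: "'a::euclidean_space set"
  assumes "negligible A"
  obtains N where "N \<in> null_sets lborel" "A \<subseteq> N"
proof -
  have "AE x in lebesgue. x \<notin> A"
    using assms by (intro AE_not_in) (simp add: negligible_iff_null_sets)
  then have "AE x in lborel. x \<notin> A" by (simp add: AE_completion_iff)
  then obtain N where "{x \<in> space lborel. \<not> x \<notin> A} \<subseteq> N" "emeasure lborel N = 0" "N \<in> sets lborel"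
    by (rule AE_E)
  then show thesis by (intro that[of N]) auto
qed

lemma lebesgue_inner_borel:
  fixes E :: "'a::euclidean_space set"
  assumes "E \<in> sets lebesgue"
  obtains B N where "B \<in> sets borel" "N \<in> null_sets lborel" "B \<subseteq> E" "E \<subseteq> B \<union> N"
proof -
  obtain B N' where B: "B \<in> sets borel" "negligible N'" "B \<union> N' = E"
    using sets_lebesgue_almost_borel[OF assms] .
  obtain N where "N \<in> null_sets lborel" "N' \<subseteq> N" using negligible_subset_null_borel[OF B(2)] .
  with B show thesis by (intro that[of B N]) auto
qed

lemma matrix_inv_cancel:
  fixes A :: "'a::semiring_1^'n^'m"
  assumes "invertible A"
  shows "A ** matrix_inv A = mat 1" and "matrix_inv A ** A = mat 1"
  using someI_ex[OF assms[unfolded invertible_def]] unfolding matrix_inv_def by auto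

lemma symmetric_matrix_of_inner:
  fixes f :: "real^'n \<Rightarrow> real^'n"
  assumes "linear f" and sym: "\<And>h k. k \<bullet> f h = h \<bullet> f k"
  shows "transpose (matrix f) = matrix f"
proof -
  have "matrix f $ i $ j = matrix f $ j $ i" for i j
    using sym[of "axis i 1" "axis j 1"] by (simp add: matrix_def inner_axis inner_axis')
  then show ?thesis by (simp add: transpose_def vec_eq_iff)
qed

text \<open>Equality in monotonicity makes the supporting affine function at \<open>x\<close> touch
  \<phi> at \<open>y\<close> as well. The difference of the two then has a minimum at the interior
  point \<open>y\<close>, where its derivative \<open>k - g\<close> must vanish.\<close>

lemma gradient_eq_of_tight:
  fixes \<phi> :: "'a::euclidean_space \<Rightarrow> real"
  assumes cvx: "convex_on \<Omega> \<phi>"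
    and x: "x \<in> interior \<Omega>" "GDERIV \<phi> x :> g" and y: "y \<in> interior \<Omega>" "GDERIV \<phi> y :> k"
    and eq: "(g - k) \<bullet> (x - y) = 0"
  shows "g = k"
proof -
  have x\<Omega>: "x \<in> \<Omega>" and y\<Omega>: "y \<in> \<Omega>" using x y interior_subset by auto
  have 1: "\<phi> x + g \<bullet> (y - x) \<le> \<phi> y" by (rule convex_on_gradient_below[OF cvx x y\<Omega>])
  have 2: "\<phi> y + k \<bullet> (x - y) \<le> \<phi> x" by (rule convex_on_gradient_below[OF cvx y x\<Omega>])
  have "\<phi> y \<le> \<phi> x + g \<bullet> (y - x)"
    using 2 eq by (simp add: inner_diff_left inner_diff_right)
  then have tight: "\<phi> y - g \<bullet> y \<le> \<phi> w - g \<bullet> w" if "w \<in> \<Omega>" for w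
    using convex_on_gradient_below[OF cvx x that] by (simp add: inner_diff_right)
  have "((\<lambda>w. \<phi> w - g \<bullet> w) has_derivative (\<lambda>h. h \<bullet> k - g \<bullet> h)) (at y)"
    using y(2) unfolding gderiv_def
    by (intro has_derivative_diff bounded_linear_imp_has_derivative bounded_linear_inner_right)
  moreover have "eventually (\<lambda>w. \<phi> y - g \<bullet> y \<le> \<phi> w - g \<bullet> w) (at y)"
  proof -
    have "eventually (\<lambda>w. w \<in> interior \<Omega>) (at y)"
      using y(1) open_interior by (intro eventually_at_in_open') auto
    then show ?thesis by eventually_elim (use tight interior_subset in blast)
  qed
  ultimately have "(\<lambda>h. h \<bullet> k - g \<bullet> h) = (\<lambda>h. 0)" by (rule has_derivative_local_min)
  then have "(k - g) \<bullet> k - g \<bullet> (k - g) = 0" by meson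
  then have "(k - g) \<bullet> (k - g) = 0" by (simp add: inner_diff_left inner_diff_right inner_commute)
  then show ?thesis by simp
qed

text \<open>A weak form of Alexandrov's theorem: differentiability is only claimed relative to the
  set \<open>S\<close>, which is all that the change of variables formula needs.\<close>

definition regular_gradient :: "(real^'n \<Rightarrow> real^'n) \<Rightarrow> (real^'n) set \<Rightarrow> (real^'n \<Rightarrow> real^'n^'n) \<Rightarrow> bool" where
  "regular_gradient G S M \<longleftrightarrow>
    (\<forall>x\<in>S. (G has_derivative (\<lambda>h. M x *v h)) (at x within S) \<and> transpose (M x) = M x \<and>
      (\<forall>h. 0 \<le> h \<bullet> (M x *v h))) \<and>
    (\<forall>x\<in>S. \<forall>y\<in>S. (G x = G y \<longrightarrow> M x *v (y - x) = 0) \<and> 0 \<le> (G x - G y) \<bullet> (x - y) \<and>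
      ((G x - G y) \<bullet> (x - y) = 0 \<longrightarrow> G x = G y))"

text \<open>Every good point is \<open>x = J (F x)\<close> with \<open>F = id + G\<close>, so a set
  of bad arguments of \<open>J\<close> spoils only the points of its image under \<open>J\<close>.
  This turns exceptional sets in the range of \<open>F\<close>, which says nothing about
  \<open>\<mu>\<close>, into null sets in the domain.\<close>

lemma convex_gradient_regular:
  fixes \<mu> :: "(real^'n) measure"
  assumes prob: "prob_space \<mu>" and sets: "sets \<mu> = sets borel"
    and ac: "absolutely_continuous lborel \<mu>" and pot: "convex_potential_gradient \<mu> \<Omega> \<phi> G"
  obtains S M where "S \<in> sets borel" "AE x in \<mu>. x \<in> S" "regular_gradient G S M"
proof -
  have cvx: "convex_on \<Omega> \<phi>" and [measurable]: "G \<in> borel_measurable borel"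
    and ae: "AE x in \<mu>. x \<in> interior \<Omega> \<and> (GDERIV \<phi> x :> G x)"
    using pot by (auto simp: convex_potential_gradient_def)
  have space: "space \<mu> = UNIV" using sets_eq_imp_space_eq[OF sets] by simp
  obtain N0 where N0: "{x \<in> space \<mu>. \<not> (x \<in> interior \<Omega> \<and> (GDERIV \<phi> x :> G x))} \<subseteq> N0"
    "emeasure \<mu> N0 = 0" "N0 \<in> sets \<mu>"
    using AE_E[OF ae] .
  have good: "x \<in> interior \<Omega>" "GDERIV \<phi> x :> G x" if "x \<notin> N0" for x
    using N0(1) that space by auto
  \<comment> \<open>A probability measure charges the complement of \<open>N0\<close>, which
    supplies the one point of differentiability that the construction of the resolvent starts
    from.\<close>
  have "N0 \<noteq> UNIV" using N0(2) prob_space.emeasure_space_1[OF prob] space by auto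
  then obtain x0 where x0: "x0 \<notin> N0" by auto
  obtain u J where "resolvent u J"
    and JF: "\<forall>x\<in>interior \<Omega>. \<forall>g. (GDERIV \<phi> x :> g) \<longrightarrow> J (x + g) = x"
    by (rule convex_resolvent_exists[OF cvx good[OF x0]])
  interpret resolvent u J by fact
  define F where "F x = x + G x" for x
  have Fm [measurable]: "F \<in> borel_measurable borel" unfolding F_def by measurable
  have JF': "J (F x) = x" if "x \<notin> N0" for x unfolding F_def using good[OF that] JF by blast
  have "AE z in lborel. J differentiable (at z)" by (rule rademacher[OF lipschitz])
  then obtain N1 where N1: "{z \<in> space lborel. \<not> J differentiable (at z)} \<subseteq> N1"
    "emeasure lborel N1 = 0" "N1 \<in> sets lborel"
    by (rule AE_E)
  define D where "D z = frechet_derivative J (at z)" for z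
  have D: "(J has_derivative D z) (at z)" if "z \<notin> N1" for z
    unfolding D_def using N1(1) that by (subst frechet_derivative_works[symmetric]) auto
  have "negligible N1" using N1(2,3) by (auto simp: negligible_iff_null_sets null_sets_completion_iff null_sets_def)
  then have "negligible (J ` N1)"
  proof (rule negligible_locally_Lipschitz_image[OF order_refl])
    show "\<exists>T B. open T \<and> x \<in> T \<and> (\<forall>y\<in>N1 \<inter> T. norm (J y - J x) \<le> B * norm (y - x))" for x
      using nonexpansive[of _ x] by (intro exI[of _ UNIV] exI[of _ 1]) auto
  qed
  then obtain N2 where N2: "N2 \<in> null_sets lborel" "J ` N1 \<subseteq> N2"
    by (rule negligible_subset_null_borel)
  have "negligible (J ` {z. z \<notin> N1 \<and> det (matrix (D z)) = 0})"
    by (rule negligible_singular_image[where f' = D]) (auto intro: has_derivative_at_withinI D)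
  then obtain N3 where N3: "N3 \<in> null_sets lborel" "J ` {z. z \<notin> N1 \<and> det (matrix (D z)) = 0} \<subseteq> N3"
    by (rule negligible_subset_null_borel)
  define S where "S = - (N0 \<union> N2 \<union> N3)"
  define E where "E x = matrix_inv (matrix (D (F x)))" for x
  \<comment> \<open>The inverse of the derivative of \<open>J\<close> is the derivative of
    \<open>F = id + G\<close>, so the identity is subtracted.\<close>
  define M where "M x = E x - mat 1" for x
  have S: "x \<notin> N0" "F x \<notin> N1" "det (matrix (D (F x))) \<noteq> 0" if "x \<in> S" for x
  proof -
    show 0: "x \<notin> N0" using that by (simp add: S_def)
    have "x \<notin> N2" "x \<notin> N3" using that by (simp_all add: S_def)
    show 1: "F x \<notin> N1"
    proof
      assume "F x \<in> N1"
      then have "x \<in> J ` N1" using JF'[OF 0] by (metis imageI)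
      with N2(2) \<open>x \<notin> N2\<close> show False by blast
    qed
    show "det (matrix (D (F x))) \<noteq> 0"
    proof
      assume "det (matrix (D (F x))) = 0"
      with 1 have "J (F x) \<in> J ` {z. z \<notin> N1 \<and> det (matrix (D z)) = 0}" by blast
      with N3(2) \<open>x \<notin> N3\<close> JF'[OF 0] show False by auto
    qed
  qed
  have linD: "linear (D (F x))" if "x \<in> S" for x
    using D[OF S(2)[OF that]] by (rule has_derivative_linear)
  have Dm: "D (F x) h = matrix (D (F x)) *v h" if "x \<in> S" for x h
    using linD[OF that] by (simp add: matrix_works)
  have ED: "E x *v D (F x) h = h" "D (F x) (E x *v h) = h" if "x \<in> S" for x h
  proof -
    have inv: "invertible (matrix (D (F x)))" using S(3)[OF that] by (simp add: invertible_det_nz)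
    show "E x *v D (F x) h = h"
      by (subst Dm[OF that], unfold E_def) (simp add: matrix_vector_mul_assoc matrix_inv_cancel[OF inv])
    show "D (F x) (E x *v h) = h"
      by (subst Dm[OF that], unfold E_def) (simp add: matrix_vector_mul_assoc matrix_inv_cancel[OF inv])
  qed
  have Mv: "M x *v h = E x *v h - h" for x h
    by (simp add: M_def matrix_vector_mult_diff_rdistrib)
  show thesis
  proof (rule that)
    have "N0 \<in> sets borel" using N0(3) by (simp only: sets)
    moreover have "N2 \<in> sets borel" "N3 \<in> sets borel"
      using null_setsD2[OF N2(1)] null_setsD2[OF N3(1)] by simp_all
    ultimately show "S \<in> sets borel" unfolding S_def by (intro borel_comp sets.Un)
    have "N0 \<in> null_sets \<mu>" using N0(2,3) by (rule null_setsI)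
    moreover have "N2 \<in> null_sets \<mu>" "N3 \<in> null_sets \<mu>"
      using subsetD[OF ac[unfolded absolutely_continuous_def]] N2(1) N3(1) by simp_all
    ultimately have "N0 \<union> N2 \<union> N3 \<in> null_sets \<mu>" by (intro null_sets.Un)
    from AE_not_in[OF this] show "AE x in \<mu>. x \<in> S" by (simp add: S_def)
    show "regular_gradient G S M"
      unfolding regular_gradient_def
    proof (intro conjI ballI allI impI)
      fix x assume x: "x \<in> S"
      have "(F has_derivative (\<lambda>h. E x *v h)) (at x within S)"
      proof (rule inverse_has_derivative[where F = F and x = x, OF D[OF S(2)[OF x]]])
        show "J (F y) = y" if "y \<in> S" for y using JF' S(1)[OF that] by blast
      qed (use ED x in auto)
      then have "((\<lambda>x. F x - x) has_derivative (\<lambda>h. E x *v h - h)) (at x within S)"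
        by (intro has_derivative_diff has_derivative_ident)
      then show "(G has_derivative (\<lambda>h. M x *v h)) (at x within S)"
        by (simp add: F_def Mv)
      have "transpose (E x) = E x"
      proof -
        have "k \<bullet> (E x *v h) = h \<bullet> (E x *v k)" for h k
          using derivative_symmetric[OF D[OF S(2)[OF x]], of "E x *v k" "E x *v h"] ED(2)[OF x]
          by (simp add: inner_commute)
        from symmetric_matrix_of_inner[OF matrix_vector_mul_linear this] show ?thesis by simp
      qed
      then show "transpose (M x) = M x"
        by (simp add: M_def transpose_def vec_eq_iff mat_def)
      fix h
      \<comment> \<open>Cocoercivity of the derivative at \<open>E x *v h\<close> reads
        \<open>(norm h)\<^sup>2 \<le> h \<bullet> (E x *v h)\<close>, which is semidefiniteness of
        \<open>E x - mat 1\<close>.\<close>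
      show "0 \<le> h \<bullet> (M x *v h)"
        using derivative_cocoercive[OF D[OF S(2)[OF x]], of "E x *v h"] ED(2)[OF x]
        by (simp add: Mv inner_diff_right power2_norm_eq_inner inner_commute)
    next
      fix x y assume x: "x \<in> S" and y: "y \<in> S" and eq: "G x = G y"
      have "F y = F x + (y - x)" using eq by (simp add: F_def)
      then have "J (F x + (y - x)) - J (F x) = y - x"
        using JF'[OF S(1)[OF x]] JF'[OF S(1)[OF y]] by simp
      from derivative_along_segment[OF D[OF S(2)[OF x]] this]
      have "D (F x) (y - x) = y - x" .
      then have "E x *v (y - x) = y - x" using ED(1)[OF x, of "y - x"] by simp
      then show "M x *v (y - x) = 0" by (simp add: Mv)
    next
      fix x y assume x: "x \<in> S" and y: "y \<in> S"
      note gx = good[OF S(1)[OF x]] and gy = good[OF S(1)[OF y]]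
      have "x \<in> \<Omega>" "y \<in> \<Omega>" using gx(1) gy(1) interior_subset by auto
      then show "0 \<le> (G x - G y) \<bullet> (x - y)"
        using convex_on_gradient_below[OF cvx gx, of y] convex_on_gradient_below[OF cvx gy, of x]
        by (simp add: inner_diff_left inner_diff_right)
      assume "(G x - G y) \<bullet> (x - y) = 0"
      with gradient_eq_of_tight[OF cvx gx gy] show "G x = G y" .
    qed
  qed
qed

section \<open>Absolutely continuous images and the Jacobian equation\<close>

text \<open>By Sard's lemma the singular points have a null image, and an absolutely continuous
  pushforward gives that image no mass.\<close>

lemma nonsingular_of_absolutely_continuous_image:
  fixes T :: "real^'n \<Rightarrow> real^'n"
  assumes [measurable]: "T \<in> borel_measurable borel" and sets: "sets \<mu> = sets borel"
    and der: "\<And>x. x \<in> S \<Longrightarrow> (T has_derivative T' x) (at x within S)"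
    and ac: "absolutely_continuous lborel (distr \<mu> borel T)"
  obtains N where "N \<in> null_sets \<mu>" "\<forall>x\<in>S - N. det (matrix (T' x)) \<noteq> 0"
proof -
  have [measurable]: "T \<in> borel_measurable \<mu>" using sets by (simp cong: measurable_cong_sets)
  have space: "space \<mu> = UNIV" using sets_eq_imp_space_eq[OF sets] by simp
  let ?W = "{x \<in> S. det (matrix (T' x)) = 0}"
  have "negligible (T ` ?W)"
    by (rule negligible_singular_image[where f' = T']) (auto intro: has_derivative_subset[OF der])
  then obtain N where N: "N \<in> null_sets lborel" "T ` ?W \<subseteq> N" by (rule negligible_subset_null_borel)
  then have "N \<in> null_sets (distr \<mu> borel T)" using ac by (auto simp: absolutely_continuous_def)
  then have "T -` N \<inter> space \<mu> \<in> null_sets \<mu>" by (subst (asm) null_sets_distr_iff) auto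
  then show thesis using N(2) by (intro that[of "T -` N \<inter> space \<mu>"]) (auto simp: space)
qed

text \<open>The area formula on the parts of \<open>S\<close> that map into a given Borel set
  identifies the pushforward of the Jacobian density with Lebesgue measure on the image. The image
  itself may fail to be Borel, hence its Borel core \<open>B\<close>.\<close>

lemma distr_weighted_jacobian:
  fixes T :: "real^'n \<Rightarrow> real^'n"
  assumes S [measurable]: "S \<in> sets borel" and [measurable]: "T \<in> borel_measurable borel"
    and der: "\<And>x. x \<in> S \<Longrightarrow> (T has_derivative T' x) (at x within S)" and inj: "inj_on T S"
    and B: "B \<in> sets borel" "N \<in> null_sets lborel" "B \<subseteq> T ` S" "T ` S \<subseteq> B \<union> N"
    and [measurable]: "h \<in> borel_measurable borel"
  shows "(\<integral>\<^sup>+x. h (T x) * (ennreal \<bar>det (matrix (T' x))\<bar> * indicator S x) \<partial>lebesgue)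
    = (\<integral>\<^sup>+y. h y * indicator B y \<partial>lborel)"
proof -
  let ?k = "\<lambda>x. ennreal \<bar>det (matrix (T' x))\<bar> * indicator S x"
  have SL: "S \<in> sets lebesgue" using S by simp
  have km [measurable]: "?k \<in> borel_measurable lebesgue"
    by (rule emeasure_differentiable_image(2)[OF SL der inj])
  have TL [measurable]: "T \<in> lebesgue \<rightarrow>\<^sub>M borel" by (rule measurable_completion) simp
  have [measurable]: "B \<in> sets borel" by (rule B(1))
  have eq: "distr (density lebesgue ?k) borel T = density lborel (indicator B)"
  proof (rule measure_eqI)
    fix X assume "X \<in> sets (distr (density lebesgue ?k) borel T)"
    then have X [measurable]: "X \<in> sets borel" by simp
    let ?P = "S \<inter> T -` X"
    have Pb: "?P \<in> sets borel" using measurable_sets[of T borel borel X] by simp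
    then have P: "?P \<in> sets lebesgue" by simp
    have TX: "T -` X \<in> sets lebesgue" using measurable_sets[OF TL X] by simp
    have "emeasure (distr (density lebesgue ?k) borel T) X = emeasure (density lebesgue ?k) (T -` X)"
      by (subst emeasure_distr) auto
    also have "\<dots> = (\<integral>\<^sup>+x. ?k x * indicator (T -` X) x \<partial>lebesgue)"
      using TX by (subst emeasure_density) auto
    also have "\<dots> = (\<integral>\<^sup>+x. ennreal \<bar>det (matrix (T' x))\<bar> * indicator ?P x \<partial>lebesgue)"
      by (intro nn_integral_cong) (auto simp: indicator_def)
    also have "\<dots> = emeasure lebesgue (T ` ?P)"
      by (rule emeasure_differentiable_image(3)[symmetric, OF P])
        (use has_derivative_subset[OF der] inj in \<open>auto intro: inj_on_subset\<close>)
    also have "T ` ?P = T ` S \<inter> X" by auto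
    also have "emeasure lebesgue (T ` S \<inter> X) = emeasure lebesgue (B \<inter> X)"
    proof (rule emeasure_eq_AE)
      have "AE y in lebesgue. y \<notin> N"
        using B(2) by (intro AE_not_in) (simp add: null_sets_completionI)
      then show "AE y in lebesgue. y \<in> T ` S \<inter> X \<longleftrightarrow> y \<in> B \<inter> X"
        by eventually_elim (use B in auto)
      show "T ` S \<inter> X \<in> sets lebesgue"
        using emeasure_differentiable_image(1)[OF SL der inj] by (intro sets.Int) auto
      show "B \<inter> X \<in> sets lebesgue" by simp
    qed
    also have "\<dots> = emeasure lborel (B \<inter> X)" by simp
    also have "\<dots> = emeasure (density lborel (indicator B)) X"
      by (subst emeasure_density) (auto simp: indicator_inter_arith[symmetric] nn_integral_indicator)
    finally show "emeasure (distr (density lebesgue ?k) borel T) X = emeasure (density lborel (indicator B)) X" .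
  qed simp
  have "(\<integral>\<^sup>+x. h (T x) * ?k x \<partial>lebesgue) = (\<integral>\<^sup>+x. h (T x) \<partial>density lebesgue ?k)"
  proof -
    have "(\<integral>\<^sup>+x. h (T x) \<partial>density lebesgue ?k) = (\<integral>\<^sup>+x. ?k x * h (T x) \<partial>lebesgue)"
      by (rule nn_integral_density[OF km]) measurable
    also have "\<dots> = (\<integral>\<^sup>+x. h (T x) * ?k x \<partial>lebesgue)"
      by (rule nn_integral_cong) (rule mult.commute)
    finally show ?thesis by (rule sym)
  qed
  also have "\<dots> = (\<integral>\<^sup>+y. h y \<partial>distr (density lebesgue ?k) borel T)"
    by (subst nn_integral_distr) auto
  also have "\<dots> = (\<integral>\<^sup>+y. h y * indicator B y \<partial>lborel)"
    unfolding eq by (subst nn_integral_density) (auto simp: mult.commute)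
  finally show ?thesis .
qed

text \<open>If \<open>N\<close> is null, the Jacobian integrates to 0 over the points of
  \<open>S\<close> that \<open>T\<close> sends into \<open>N\<close>; as the determinant does not
  vanish, these points form a null set.\<close>

lemma absolutely_continuous_image:
  fixes T :: "real^'n \<Rightarrow> real^'n"
  assumes S [measurable]: "S \<in> sets borel" and [measurable]: "T \<in> borel_measurable borel"
    and der: "\<And>x. x \<in> S \<Longrightarrow> (T has_derivative T' x) (at x within S)" and inj: "inj_on T S"
    and det: "\<And>x. x \<in> S \<Longrightarrow> det (matrix (T' x)) \<noteq> 0"
    and sets: "sets \<mu> = sets borel" and ac: "absolutely_continuous lborel \<mu>" and ae: "AE x in \<mu>. x \<in> S"
  shows "absolutely_continuous lborel (distr \<mu> borel T)"
  unfolding absolutely_continuous_def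
proof
  fix N assume N: "N \<in> null_sets (lborel :: (real^'n) measure)"
  then have Nb [measurable]: "N \<in> sets borel" by auto
  have Tm: "T \<in> borel_measurable \<mu>" using sets by (simp cong: measurable_cong_sets)
  have space: "space \<mu> = UNIV" using sets_eq_imp_space_eq[OF sets] by simp
  let ?P = "S \<inter> T -` N"
  have Pb: "?P \<in> sets borel" using measurable_sets[of T borel borel N] by simp
  then have P: "?P \<in> sets lebesgue" by simp
  have der': "(T has_derivative T' x) (at x within ?P)" if "x \<in> ?P" for x
    using that by (intro has_derivative_subset[OF der]) auto
  have inj': "inj_on T ?P" using inj by (rule inj_on_subset) auto
  note * = emeasure_differentiable_image[OF P der' inj']
  have "emeasure lebesgue (T ` ?P) \<le> emeasure lebesgue N" by (rule emeasure_mono) auto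
  also have "\<dots> = 0" using N by auto
  finally have "(\<integral>\<^sup>+x. ennreal \<bar>det (matrix (T' x))\<bar> * indicator ?P x \<partial>lebesgue) = 0" using *(3) by simp
  then have "AE x in lebesgue. ennreal \<bar>det (matrix (T' x))\<bar> * indicator ?P x = 0"
    using *(2) by (subst (asm) nn_integral_0_iff_AE) auto
  then have "AE x in lebesgue. x \<notin> ?P"
    by eventually_elim (use det in \<open>auto simp: indicator_def ennreal_eq_0_iff split: if_splits\<close>)
  then have "AE x in lborel. x \<notin> ?P" by (simp add: AE_completion_iff)
  then have "?P \<in> null_sets lborel" using Pb by (subst AE_iff_null_sets) auto
  then have "?P \<in> null_sets \<mu>" using ac by (auto simp: absolutely_continuous_def)
  from AE_not_in[OF this] ae have "AE x in \<mu>. x \<notin> T -` N" by eventually_elim auto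
  then have "T -` N \<inter> space \<mu> \<in> null_sets \<mu>"
    using measurable_sets[OF Tm Nb] by (subst AE_iff_null_sets) (auto simp: space)
  then show "N \<in> null_sets (distr \<mu> borel T)"
    using Tm by (subst null_sets_distr_iff) auto
qed

text \<open>Both sides are compared as densities on sets \<open>S \<inter> A\<close>: the area
  formula turns the left one into the mass that \<open>density lborel f\<close> gives to the image
  of that set, and the pushforward relation together with injectivity turns this back into the mass
  of the set itself.\<close>

lemma jacobian_equation:
  fixes T :: "real^'n \<Rightarrow> real^'n" and f0 f :: "real^'n \<Rightarrow> ennreal"
  assumes S [measurable]: "S \<in> sets borel" and T [measurable]: "T \<in> borel_measurable borel"
    and der: "\<And>x. x \<in> S \<Longrightarrow> (T has_derivative T' x) (at x within S)" and inj: "inj_on T S"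
    and f0 [measurable]: "f0 \<in> borel_measurable borel" and f [measurable]: "f \<in> borel_measurable borel"
    and ae: "AE x in density lborel f0. x \<in> S"
    and push: "distr (density lborel f0) borel T = density lborel f"
  shows "AE x in lborel. x \<in> S \<longrightarrow> f (T x) * ennreal \<bar>det (matrix (T' x))\<bar> = f0 x"
proof -
  let ?\<mu> = "density lborel f0"
  let ?k = "\<lambda>x. ennreal \<bar>det (matrix (T' x))\<bar> * indicator S x"
  have SL: "S \<in> sets lebesgue" using S by simp
  have km [measurable]: "?k \<in> borel_measurable lebesgue"
    by (rule emeasure_differentiable_image(2)[OF SL der inj])
  have TL [measurable]: "T \<in> lebesgue \<rightarrow>\<^sub>M borel" by (rule measurable_completion) simp
  have [measurable]: "(\<lambda>x. f (T x)) \<in> borel_measurable lebesgue" by measurable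
  have gm: "(\<lambda>x. f (T x) * ?k x) \<in> borel_measurable lebesgue" by measurable
  \<comment> \<open>The determinant is only known to be Lebesgue measurable, so a Borel
    representative serves as the density over \<open>lborel\<close>.\<close>
  then obtain g where g [measurable]: "g \<in> borel_measurable lborel"
    and geq: "AE x in lborel. f (T x) * ?k x = g x"
    using completion_ex_borel_measurable by blast
  have push': "emeasure (density lborel f) X = emeasure ?\<mu> (T -` X)" if "X \<in> sets borel" for X
    unfolding push[symmetric] using that by (subst emeasure_distr) auto
  have "density lborel g = density lborel (\<lambda>x. f0 x * indicator S x)"
  proof (rule measure_eqI)
    fix A assume "A \<in> sets (density lborel g)"
    then have A [measurable]: "A \<in> sets borel" by simp
    let ?P = "S \<inter> A"
    have P: "?P \<in> sets borel" by simp
    have der': "(T has_derivative T' x) (at x within ?P)" if "x \<in> ?P" for x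
      using that by (intro has_derivative_subset[OF der]) auto
    have inj': "inj_on T ?P" using inj by (rule inj_on_subset) auto
    have "?P \<in> sets lebesgue" by simp
    then have "T ` ?P \<in> sets lebesgue" by (rule emeasure_differentiable_image(1)[OF _ der' inj'])
    then obtain B N where B: "B \<in> sets borel" "N \<in> null_sets lborel" "B \<subseteq> T ` ?P" "T ` ?P \<subseteq> B \<union> N"
      by (rule lebesgue_inner_borel)
    have [measurable]: "B \<in> sets borel" "N \<in> sets borel" using B by auto
    have "emeasure (density lborel g) A = (\<integral>\<^sup>+x. g x * indicator A x \<partial>lborel)"
      by (subst emeasure_density) auto
    also have "\<dots> = (\<integral>\<^sup>+x. (f (T x) * ?k x) * indicator A x \<partial>lborel)"
      by (rule nn_integral_cong_AE) (use geq in \<open>eventually_elim, simp\<close>)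
    also have "\<dots> = (\<integral>\<^sup>+x. f (T x) * (ennreal \<bar>det (matrix (T' x))\<bar> * indicator ?P x) \<partial>lborel)"
      by (intro nn_integral_cong) (auto simp: indicator_def)
    also have "\<dots> = (\<integral>\<^sup>+x. f (T x) * (ennreal \<bar>det (matrix (T' x))\<bar> * indicator ?P x) \<partial>lebesgue)"
      by (simp add: nn_integral_completion)
    also have "\<dots> = (\<integral>\<^sup>+y. f y * indicator B y \<partial>lborel)"
      by (rule distr_weighted_jacobian[OF P T der' inj' B f])
    also have "\<dots> = emeasure (density lborel f) B"
      by (subst emeasure_density) auto
    also have "\<dots> = emeasure ?\<mu> (T -` B)" by (rule push') simp
    \<comment> \<open>Injectivity on \<open>S\<close> makes the preimage of \<open>B\<close> equal
      to \<open>S \<inter> A\<close> up to the preimage of \<open>N\<close>, which carries no mass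
      because the pushforward has a density.\<close>
    also have "\<dots> = emeasure ?\<mu> ?P"
    proof (rule emeasure_eq_AE)
      have "N \<in> null_sets (density lborel f)"
        using absolutely_continuousI_density[of f lborel] B(2) f by (auto simp: absolutely_continuous_def)
      then have "emeasure ?\<mu> (T -` N) = 0" using push'[of N] by auto
      moreover have "T -` N \<in> sets borel" using measurable_sets[OF T, of N] by simp
      ultimately have "T -` N \<in> null_sets ?\<mu>" by auto
      from AE_not_in[OF this] ae show "AE x in ?\<mu>. x \<in> T -` B \<longleftrightarrow> x \<in> ?P"
      proof eventually_elim
        case (elim x)
        show ?case
        proof
          assume "x \<in> T -` B"
          then obtain y where y: "y \<in> ?P" "T x = T y" using B(3) by auto
          then have "x = y" using inj elim by (auto dest: inj_onD)
          with y show "x \<in> ?P" by simp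
        next
          assume "x \<in> ?P"
          then have "T x \<in> B \<union> N" using B(4) by blast
          with elim show "x \<in> T -` B" by auto
        qed
      qed
      show "T -` B \<in> sets ?\<mu>" using measurable_sets[OF T, of B] by simp
    qed simp
    also have "\<dots> = (\<integral>\<^sup>+x. f0 x * indicator ?P x \<partial>lborel)" by (subst emeasure_density) auto
    also have "\<dots> = (\<integral>\<^sup>+x. f0 x * indicator S x * indicator A x \<partial>lborel)"
      by (intro nn_integral_cong) (auto simp: indicator_def)
    also have "\<dots> = emeasure (density lborel (\<lambda>x. f0 x * indicator S x)) A"
      by (subst emeasure_density) auto
    finally show "emeasure (density lborel g) A = emeasure (density lborel (\<lambda>x. f0 x * indicator S x)) A" .
  qed simp
  then have "AE x in lborel. g x = f0 x * indicator S x"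
    by (subst (asm) sigma_finite_measure.density_unique_iff[OF sigma_finite_lborel]) auto
  with geq show ?thesis by eventually_elim (auto simp: indicator_def)
qed

section \<open>Symmetric positive definite matrices\<close>

text \<open>The first-order condition for a minimum at \<open>s = 0\<close>: with
  \<open>d = \<bar>c\<bar> + 1\<close>, the choice \<open>s = - b / d\<close> lets the linear term
  prevail.\<close>

lemma linear_coeff_zero_of_nonneg:
  fixes b c :: real
  assumes "\<And>s. 0 \<le> 2 * s * b + s\<^sup>2 * c"
  shows "b = 0"
proof (rule ccontr)
  assume b: "b \<noteq> 0"
  define d where "d = \<bar>c\<bar> + 1"
  have d: "d > 0" "c < d * 2" by (auto simp: d_def)
  have "0 \<le> 2 * (- b / d) * b + (- b / d)\<^sup>2 * c" by (rule assms)
  also have "\<dots> = (b\<^sup>2 / d\<^sup>2) * (c - d * 2)"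
    using d by (simp add: power2_eq_square field_simps)
  also have "\<dots> < 0" using b d by (intro mult_pos_neg) auto
  finally show False by simp
qed

lemma symmetric_inner:
  fixes A :: "real^'n^'n"
  assumes "transpose A = A"
  shows "v \<bullet> (A *v w) = w \<bullet> (A *v v)"
  by (metis assms dot_lmul_matrix inner_commute vector_transpose_matrix)

text \<open>\<open>R\<close> is the maximum of the quotient of the two quadratic forms on
  \<open>V\<close>, attained by compactness of the unit sphere. The first-order condition there is
  the generalised eigenvalue equation, tested against vectors of \<open>V\<close>.\<close>

lemma relative_rayleigh:
  fixes A B :: "real^'n^'n"
  assumes A: "sym_pos_def A" and B: "transpose B = B" and V: "subspace V" "\<exists>v\<in>V. v \<noteq> 0"
  obtains v R where "v \<in> V" "v \<bullet> (A *v v) = 1"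
    "\<And>w. w \<in> V \<Longrightarrow> w \<bullet> (B *v v) = R * (w \<bullet> (A *v v))"
    "\<And>w. w \<in> V \<Longrightarrow> w \<bullet> (B *v w) \<le> R * (w \<bullet> (A *v w))"
proof -
  have As: "transpose A = A" and Ap: "\<And>v. v \<noteq> 0 \<Longrightarrow> v \<bullet> (A *v v) > 0"
    using A by (auto simp: sym_pos_def_def)
  let ?K = "V \<inter> sphere 0 1"
  let ?r = "\<lambda>v. (v \<bullet> (B *v v)) / (v \<bullet> (A *v v))"
  have "compact ?K" using closed_subspace[OF V(1)] by (intro closed_Int_compact) auto
  moreover have "?K \<noteq> {}"
  proof -
    obtain v where v: "v \<in> V" "v \<noteq> 0" using V(2) by blast
    then have "v /\<^sub>R norm v \<in> ?K" using V(1) by (auto intro: subspace_scale)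
    then show ?thesis by blast
  qed
  moreover have "continuous_on ?K ?r"
  proof (intro continuous_intros)
    show "\<forall>v\<in>?K. v \<bullet> (A *v v) \<noteq> 0"
    proof
      fix v assume "v \<in> ?K"
      then have "v \<noteq> 0" by auto
      then show "v \<bullet> (A *v v) \<noteq> 0" using Ap[of v] by simp
    qed
  qed
  ultimately obtain v0 where v0: "v0 \<in> ?K" "\<And>w. w \<in> ?K \<Longrightarrow> ?r w \<le> ?r v0"
    using continuous_attains_sup[of ?K ?r] by blast
  define R where "R = ?r v0"
  have v0n: "v0 \<noteq> 0" using v0(1) by auto
  have max: "w \<bullet> (B *v w) \<le> R * (w \<bullet> (A *v w))" if w: "w \<in> V" for w
  proof (cases "w = 0")
    case False
    let ?w = "w /\<^sub>R norm w"
    have "?w \<in> ?K" using w False V(1) by (auto intro: subspace_scale)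
    then have "?r ?w \<le> R" unfolding R_def by (rule v0(2))
    moreover have "?r ?w = ?r w" using False by (simp add: matrix_vector_mult_scaleR)
    ultimately show ?thesis using Ap[OF False] by (simp add: divide_le_eq)
  qed simp
  define a where "a = v0 \<bullet> (A *v v0)"
  have a: "a > 0" using Ap[OF v0n] by (simp add: a_def)
  define q where "q = sqrt a"
  have q: "q > 0" "q * q = a" using a by (simp_all add: q_def)
  define v where "v = v0 /\<^sub>R q"
  have vV: "v \<in> V" using v0(1) V(1) by (auto simp: v_def intro: subspace_scale)
  have vA: "v \<bullet> (A *v v) = 1"
  proof -
    have "v \<bullet> (A *v v) = (v0 \<bullet> (A *v v0)) / (q * q)"
      using q(1) by (simp add: v_def matrix_vector_mult_scaleR field_simps)
    then show ?thesis using a by (simp add: q(2) a_def[symmetric])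
  qed
  have vB: "v \<bullet> (B *v v) = R"
  proof -
    have "v \<bullet> (B *v v) = (v0 \<bullet> (B *v v0)) / (q * q)"
      using q(1) by (simp add: v_def matrix_vector_mult_scaleR field_simps)
    then show ?thesis by (simp add: q(2) R_def a_def[symmetric])
  qed
  have crit: "w \<bullet> (B *v v) = R * (w \<bullet> (A *v v))" if w: "w \<in> V" for w
  proof -
    have "R * (w \<bullet> (A *v v)) - w \<bullet> (B *v v) = 0"
    proof (rule linear_coeff_zero_of_nonneg[where c = "R * (w \<bullet> (A *v w)) - w \<bullet> (B *v w)"])
      fix s :: real
      have "v + s *\<^sub>R w \<in> V" using vV w V(1) by (auto intro: subspace_add subspace_scale)
      from max[OF this]
      have "0 \<le> R * ((v + s *\<^sub>R w) \<bullet> (A *v (v + s *\<^sub>R w))) - (v + s *\<^sub>R w) \<bullet> (B *v (v + s *\<^sub>R w))"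
        by simp
      also have "\<dots> = 2 * s * (R * (w \<bullet> (A *v v)) - w \<bullet> (B *v v)) + s\<^sup>2 * (R * (w \<bullet> (A *v w)) - w \<bullet> (B *v w))"
        using vA vB symmetric_inner[OF As, of v w] symmetric_inner[OF B, of v w]
        by (simp add: matrix_vector_right_distrib matrix_vector_mult_scaleR inner_simps power2_eq_square algebra_simps)
      finally show "0 \<le> 2 * s * (R * (w \<bullet> (A *v v)) - w \<bullet> (B *v v)) + s\<^sup>2 * (R * (w \<bullet> (A *v w)) - w \<bullet> (B *v w))" .
    qed
    then show ?thesis by simp
  qed
  from that[OF vV vA crit max] show thesis .
qed

text \<open>The vectors are successive maximisers on \<open>A\<close>-orthogonal complements. The
  third conjunct strengthens the induction: the complement is also \<open>B\<close>-orthogonal to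
  the vectors already found, so the next maximiser is conjugate to them for both forms.\<close>

lemma simultaneous_diagonalisation_aux:
  fixes A B :: "real^'n^'n"
  assumes A: "sym_pos_def A" and B: "transpose B = B"
  shows "k \<le> CARD('n) \<Longrightarrow> \<exists>v :: nat \<Rightarrow> real^'n.
    (\<forall>i<k. \<forall>j<k. v i \<bullet> (A *v v j) = (if i = j then 1 else 0)) \<and>
    (\<forall>i<k. \<forall>j<k. i \<noteq> j \<longrightarrow> v i \<bullet> (B *v v j) = 0) \<and>
    (\<forall>w. (\<forall>j<k. w \<bullet> (A *v v j) = 0) \<longrightarrow> (\<forall>i<k. w \<bullet> (B *v v i) = 0))"
proof (induction k)
  case 0
  show ?case by simp
next
  case (Suc k)
  then obtain v :: "nat \<Rightarrow> real^'n" where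
    v1: "\<forall>i<k. \<forall>j<k. v i \<bullet> (A *v v j) = (if i = j then 1 else 0)" and
    v2: "\<forall>i<k. \<forall>j<k. i \<noteq> j \<longrightarrow> v i \<bullet> (B *v v j) = 0" and
    v3: "\<forall>w. (\<forall>j<k. w \<bullet> (A *v v j) = 0) \<longrightarrow> (\<forall>i<k. w \<bullet> (B *v v i) = 0)"
    by fastforce
  have As: "transpose A = A" using A by (simp add: sym_pos_def_def)
  define V where "V = {w. \<forall>j<k. w \<bullet> (A *v v j) = 0}"
  have sV: "subspace V" by (auto simp: V_def subspace_def inner_simps)
  \<comment> \<open>\<open>V\<close> is cut out by \<open>k\<close> linear equations, fewer than the
    dimension.\<close>
  have "\<exists>w\<in>V. w \<noteq> 0"
  proof -
    let ?S = "(\<lambda>j. A *v v j) ` {..<k}"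
    have "dim ?S \<le> card ?S" by (rule dim_le_card) (auto intro: span_base)
    also have "\<dots> \<le> k" using card_image_le[of "{..<k}" "\<lambda>j. A *v v j"] by simp
    finally have "dim ?S < DIM(real^'n)" using Suc.prems by simp
    then obtain w where w: "w \<noteq> 0" "\<And>y. y \<in> span ?S \<Longrightarrow> orthogonal w y"
      by (rule orthogonal_to_subspace_exists) auto
    then have "w \<in> V" by (auto simp: V_def orthogonal_def span_base)
    with w(1) show ?thesis by blast
  qed
  then obtain x R where x: "x \<in> V" "x \<bullet> (A *v x) = 1"
    and xB: "\<And>w. w \<in> V \<Longrightarrow> w \<bullet> (B *v x) = R * (w \<bullet> (A *v x))"
    using relative_rayleigh[OF A B sV] by metis
  have xv: "x \<bullet> (A *v v j) = 0" "v j \<bullet> (A *v x) = 0" "x \<bullet> (B *v v j) = 0" "v j \<bullet> (B *v x) = 0" if "j < k" for j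
  proof -
    show 1: "x \<bullet> (A *v v j) = 0" using x(1) that by (simp add: V_def)
    then show "v j \<bullet> (A *v x) = 0" using symmetric_inner[OF As] by metis
    show 2: "x \<bullet> (B *v v j) = 0" using x(1) that v3 by (simp add: V_def)
    then show "v j \<bullet> (B *v x) = 0" using symmetric_inner[OF B] by metis
  qed
  define v' where "v' = v(k := x)"
  have v'k: "v' k = x" and v'l: "\<And>i. i < k \<Longrightarrow> v' i = v i" by (auto simp: v'_def)
  show ?case
  proof (intro exI[of _ v'] conjI allI impI)
    fix i j assume ij: "i < Suc k" "j < Suc k"
    then consider "i < k" "j < k" | "i = k" "j < k" | "i < k" "j = k" | "i = k" "j = k" by linarith
    then show "v' i \<bullet> (A *v v' j) = (if i = j then 1 else 0)"
      by cases (simp_all add: v'k v'l v1 xv x)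
    assume "i \<noteq> j"
    then consider "i < k" "j < k" | "i = k" "j < k" | "i < k" "j = k" using ij by linarith
    then show "v' i \<bullet> (B *v v' j) = 0"
      by cases (use \<open>i \<noteq> j\<close> in \<open>simp_all add: v'k v'l v2 xv\<close>)
  next
    fix w i assume w: "\<forall>j<Suc k. w \<bullet> (A *v v' j) = 0" and i: "i < Suc k"
    have wk: "\<forall>j<k. w \<bullet> (A *v v j) = 0" 
    proof (intro allI impI)
      fix j assume "j < k"
      then show "w \<bullet> (A *v v j) = 0" using w[rule_format, of j] v'l[of j] by simp
    qed
    have wx: "w \<bullet> (A *v x) = 0" using w v'k by auto
    show "w \<bullet> (B *v v' i) = 0"
    proof (cases "i = k")
      case True
      have "w \<in> V" using wk by (simp add: V_def)
      from xB[OF this] show ?thesis using True wx by (simp add: v'k)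
    next
      case False
      then have "i < k" using i by simp
      with v3 wk show ?thesis by (simp add: v'l)
    qed
  qed
qed

lemma simultaneous_diagonalisation:
  fixes A B :: "real^'n^'n"
  assumes A: "sym_pos_def A" and B: "transpose B = B"
  obtains P :: "real^'n^'n" and d :: "'n \<Rightarrow> real"
  where "transpose P ** A ** P = mat 1" "transpose P ** B ** P = (\<chi> i j. if i = j then d i else 0)"
    "\<forall>i. \<exists>v. v \<noteq> 0 \<and> d i = v \<bullet> (B *v v)"
proof -
  obtain v :: "nat \<Rightarrow> real^'n" where
    v1: "\<forall>i<CARD('n). \<forall>j<CARD('n). v i \<bullet> (A *v v j) = (if i = j then 1 else 0)" and
    v2: "\<forall>i<CARD('n). \<forall>j<CARD('n). i \<noteq> j \<longrightarrow> v i \<bullet> (B *v v j) = 0"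
    using simultaneous_diagonalisation_aux[OF A B order_refl] by (elim exE conjE) simp
  obtain f :: "'n \<Rightarrow> nat" where f: "bij_betw f UNIV {..<CARD('n)}"
    using ex_bij_betw_finite_nat[of "UNIV :: 'n set"] by (auto simp: lessThan_atLeast0)
  have fl: "f i < CARD('n)" and fi: "f i = f j \<longleftrightarrow> i = j" for i j
    using f by (auto simp: bij_betw_def inj_on_def)
  define P :: "real^'n^'n" where "P = (\<chi> i j. v (f j) $ i)"
  have ent: "(transpose P ** C ** P) $ i $ j = v (f i) \<bullet> (C *v v (f j))" for C :: "real^'n^'n" and i j
  proof -
    have "(transpose P ** C ** P) $ i $ j = (\<Sum>l\<in>UNIV. (\<Sum>m\<in>UNIV. v (f i) $ m * C $ m $ l) * v (f j) $ l)"
      by (simp add: P_def matrix_matrix_mult_def transpose_def)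
    also have "\<dots> = (\<Sum>l\<in>UNIV. \<Sum>m\<in>UNIV. v (f i) $ m * C $ m $ l * v (f j) $ l)"
      by (simp add: sum_distrib_right)
    also have "\<dots> = (\<Sum>m\<in>UNIV. \<Sum>l\<in>UNIV. v (f i) $ m * C $ m $ l * v (f j) $ l)" by (rule sum.swap)
    also have "\<dots> = v (f i) \<bullet> (C *v v (f j))"
      by (simp add: inner_vec_def matrix_vector_mult_def sum_distrib_left mult.assoc)
    finally show ?thesis .
  qed
  show thesis
  proof (rule that[of P "\<lambda>i. v (f i) \<bullet> (B *v v (f i))"])
    show "transpose P ** A ** P = mat 1"
      by (simp add: vec_eq_iff ent v1 fl fi mat_def)
    show "transpose P ** B ** P = (\<chi> i j. if i = j then v (f i) \<bullet> (B *v v (f i)) else 0)"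
      by (auto simp: vec_eq_iff ent v2 fl fi)
    show "\<forall>i. \<exists>w. w \<noteq> 0 \<and> v (f i) \<bullet> (B *v v (f i)) = w \<bullet> (B *v w)"
    proof
      fix i
      have "v (f i) \<noteq> 0" using v1[rule_format, OF fl fl, of i i] by auto
      then show "\<exists>w. w \<noteq> 0 \<and> v (f i) \<bullet> (B *v v (f i)) = w \<bullet> (B *v w)" by blast
    qed
  qed
qed

lemma sym_pos_def_det_pos:
  fixes A :: "real^'n^'n"
  assumes "sym_pos_def A"
  shows "det A > 0"
proof -
  have "transpose A = A" using assms by (simp add: sym_pos_def_def)
  then obtain P :: "real^'n^'n" and d where "transpose P ** A ** P = mat 1"
    by (rule simultaneous_diagonalisation[OF assms])
  then have "det P * det A * det P = 1" by (metis det_I det_mul det_transpose)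
  then have *: "(det P)\<^sup>2 * det A = 1" by (simp add: power2_eq_square mult.commute mult.left_commute)
  show ?thesis
  proof (rule ccontr)
    assume "\<not> det A > 0"
    then have "(det P)\<^sup>2 * det A \<le> 0" by (simp add: mult_nonneg_nonpos)
    with * show False by simp
  qed
qed

lemma sym_pos_def_convex:
  fixes A B :: "real^'n^'n"
  assumes "sym_pos_def A" "sym_pos_def B" "0 \<le> t" "t \<le> 1"
  shows "sym_pos_def ((1 - t) *\<^sub>R A + t *\<^sub>R B)"
  unfolding sym_pos_def_def
proof (intro conjI allI impI)
  show "transpose ((1 - t) *\<^sub>R A + t *\<^sub>R B) = (1 - t) *\<^sub>R A + t *\<^sub>R B"
    using assms(1,2) by (simp add: sym_pos_def_def transpose_def vec_eq_iff)
  fix v :: "real^'n" assume "v \<noteq> 0"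
  then have "v \<bullet> (A *v v) > 0" "v \<bullet> (B *v v) > 0" using assms(1,2) by (auto simp: sym_pos_def_def)
  then have "0 < (1 - t) * (v \<bullet> (A *v v)) + t * (v \<bullet> (B *v v))"
    using assms(3,4) by (cases "t = 0") (auto intro: add_nonneg_pos)
  then show "0 < v \<bullet> (((1 - t) *\<^sub>R A + t *\<^sub>R B) *v v)"
    by (simp add: matrix_vector_mult_add_rdistrib scaleR_matrix_vector_assoc[symmetric] inner_simps)
qed

text \<open>A congruence takes \<open>A\<close> to the identity and \<open>B\<close> to a diagonal
  matrix with positive entries, which reduces the claim to concavity of the scalar logarithm between
  1 and each entry. The factor \<open>(det P)\<^sup>2\<close> cancels, as the weights add up to
  1.\<close>

lemma ln_det_concave:
  fixes A B :: "real^'n^'n"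
  assumes A: "sym_pos_def A" and B: "sym_pos_def B" and t: "0 \<le> t" "t \<le> 1"
  shows "(1 - t) * ln (det A) + t * ln (det B) \<le> ln (det ((1 - t) *\<^sub>R A + t *\<^sub>R B))"
proof -
  let ?C = "(1 - t) *\<^sub>R A + t *\<^sub>R B"
  have "transpose B = B" using B by (simp add: sym_pos_def_def)
  then obtain P :: "real^'n^'n" and d where PA: "transpose P ** A ** P = mat 1"
    and PB: "transpose P ** B ** P = (\<chi> i j. if i = j then d i else 0)"
    and d: "\<forall>i. \<exists>v. v \<noteq> 0 \<and> d i = v \<bullet> (B *v v)"
    by (rule simultaneous_diagonalisation[OF A])
  have d0: "d i > 0" for i using spec[OF d, of i] B by (auto simp: sym_pos_def_def)
  have PC: "transpose P ** ?C ** P = (\<chi> i j. if i = j then (1 - t) + t * d i else 0)"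
  proof -
    have "X ** ((1 - t) *\<^sub>R Y + t *\<^sub>R Z) ** W = (1 - t) *\<^sub>R (X ** Y ** W) + t *\<^sub>R (X ** Z ** W)"
      for X Y Z W :: "real^'n^'n"
      by (simp add: vec_eq_iff matrix_matrix_mult_def sum.distrib sum_distrib_left sum_distrib_right
          sum_subtractf algebra_simps)
    from this[of "transpose P" A B P]
    have "transpose P ** ?C ** P = (1 - t) *\<^sub>R (transpose P ** A ** P) + t *\<^sub>R (transpose P ** B ** P)" .
    then show ?thesis unfolding PA PB by (simp add: vec_eq_iff mat_def)
  qed
  have c0: "(1 - t) + t * d i > 0" for i
    using t d0[of i] by (cases "t = 0") (auto intro: add_nonneg_pos)
  define p where "p = (det P)\<^sup>2"
  have dt: "p * det C = det (transpose P ** C ** P)" for C :: "real^'n^'n"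
    by (simp add: det_mul p_def power2_eq_square mult.commute mult.left_commute)
  have detA: "p * det A = 1" by (simp add: dt PA)
  have detB: "p * det B = (\<Prod>i\<in>UNIV. d i)" unfolding dt PB by (subst det_diagonal) auto
  have detC: "p * det ?C = (\<Prod>i\<in>UNIV. (1 - t) + t * d i)" unfolding dt PC by (subst det_diagonal) auto
  have p: "p > 0"
    using detA sym_pos_def_det_pos[OF A] by (metis less_numeral_extra(1) zero_less_mult_pos2)
  have lnA: "ln (det A) = - ln p"
    using detA p sym_pos_def_det_pos[OF A] ln_mult[of p "det A"] by simp
  have lnB: "ln (det B) = (\<Sum>i\<in>UNIV. ln (d i)) - ln p"
  proof -
    have "ln p + ln (det B) = ln (p * det B)" using p sym_pos_def_det_pos[OF B] by (simp add: ln_mult)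
    also have "\<dots> = (\<Sum>i\<in>UNIV. ln (d i))" unfolding detB by (rule ln_prod) (use d0 in \<open>auto simp: less_le\<close>)
    finally show ?thesis by simp
  qed
  have lnC: "ln (det ?C) = (\<Sum>i\<in>UNIV. ln ((1 - t) + t * d i)) - ln p"
  proof -
    have "ln p + ln (det ?C) = ln (p * det ?C)"
      using p sym_pos_def_det_pos[OF sym_pos_def_convex[OF A B t]] by (simp add: ln_mult)
    also have "\<dots> = (\<Sum>i\<in>UNIV. ln ((1 - t) + t * d i))" unfolding detC by (rule ln_prod) (use c0 in \<open>auto simp: less_le\<close>)
    finally show ?thesis by simp
  qed
  have "t * ln (d i) \<le> ln ((1 - t) + t * d i)" for i
  proof -
    have "(1 - t) * ln 1 + t * ln (d i) \<le> ln ((1 - t) *\<^sub>R 1 + t *\<^sub>R d i)"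
      using concave_onD[OF ln_concave t, of 1 "d i"] d0[of i] by simp
    then show ?thesis by simp
  qed
  then have "(\<Sum>i\<in>UNIV. t * ln (d i)) \<le> (\<Sum>i\<in>UNIV. ln ((1 - t) + t * d i))" by (rule sum_mono)
  then show ?thesis unfolding lnA lnB lnC by (simp add: sum_distrib_left[symmetric] algebra_simps)
qed

text \<open>A vector on which a semidefinite form vanishes minimises it and so lies in the kernel of
  \<open>M\<close>; invertibility leaves only the zero vector.\<close>

lemma sym_pos_def_of_semidefinite:
  fixes M :: "real^'n^'n"
  assumes sym: "transpose M = M" and nonneg: "\<And>h. 0 \<le> h \<bullet> (M *v h)" and det: "det M \<noteq> 0"
  shows "sym_pos_def M"
  unfolding sym_pos_def_def
proof (intro conjI allI impI sym)
  fix v :: "real^'n" assume v: "v \<noteq> 0"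
  have "v \<bullet> (M *v v) \<noteq> 0"
  proof
    assume z: "v \<bullet> (M *v v) = 0"
    have "w \<bullet> (M *v v) = 0" for w
    proof (rule linear_coeff_zero_of_nonneg[where c = "w \<bullet> (M *v w)"])
      fix s :: real
      have "0 \<le> (v + s *\<^sub>R w) \<bullet> (M *v (v + s *\<^sub>R w))" by (rule nonneg)
      also have "\<dots> = 2 * s * (w \<bullet> (M *v v)) + s\<^sup>2 * (w \<bullet> (M *v w))"
        using z symmetric_inner[OF sym, of v w]
        by (simp add: matrix_vector_right_distrib matrix_vector_mult_scaleR inner_simps power2_eq_square algebra_simps)
      finally show "0 \<le> 2 * s * (w \<bullet> (M *v v)) + s\<^sup>2 * (w \<bullet> (M *v w))" .
    qed
    from this[of "M *v v"] have "M *v v = 0" by simp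
    moreover have "inj ((*v) M)" using det by (simp add: invertible_det_nz[symmetric] inj_matrix_vector_mult)
    ultimately show False using v by (metis injD matrix_vector_mult_0_right)
  qed
  with nonneg[of v] show "0 < v \<bullet> (M *v v)" by simp
qed

section \<open>Extreme eigenvalues\<close>

lemma sym_pos_def_mat_1: "sym_pos_def (mat 1 :: real^'n^'n)"
  by (simp add: sym_pos_def_def)

text \<open>\<open>GREATEST\<close> says something only if a largest eigenvalue exists. The maximum
  of the Rayleigh quotient provides it, since the maximiser is an eigenvector.\<close>

lemma lambda_max_rayleigh:
  fixes A :: "real^'n^'n"
  assumes "transpose A = A"
  shows "matrix_eigenvalue A (lambda_max A)" and "v \<bullet> (A *v v) \<le> lambda_max A * (norm v)\<^sup>2"
proof -
  have "\<exists>v\<in>(UNIV :: (real^'n) set). v \<noteq> 0" by (rule bexI[of _ "axis undefined 1"]) (auto simp: axis_eq_0_iff)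
  then obtain x R where x: "x \<bullet> (mat 1 *v x) = 1" "\<And>w. w \<bullet> (A *v x) = R * (w \<bullet> (mat 1 *v x))"
    and R: "\<And>w. w \<bullet> (A *v w) \<le> R * (w \<bullet> (mat 1 *v w))"
    using relative_rayleigh[OF sym_pos_def_mat_1 assms subspace_UNIV] by (metis UNIV_I)
  have "A *v x = R *\<^sub>R x"
    by (rule vector_eq_rdot[THEN iffD1]) (use x(2) in \<open>auto simp: inner_commute\<close>)
  moreover have "x \<noteq> 0" using x(1) by auto
  ultimately have eig: "matrix_eigenvalue A R" by (auto simp: matrix_eigenvalue_def)
  have "l \<le> R" if l: "matrix_eigenvalue A l" for l
  proof -
    obtain w where w: "w \<noteq> 0" "A *v w = l *\<^sub>R w" using l by (auto simp: matrix_eigenvalue_def)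
    then have "l * (w \<bullet> w) \<le> R * (w \<bullet> w)" using R[of w] by simp
    then show ?thesis using w(1) by simp
  qed
  then have "lambda_max A = R" unfolding lambda_max_def using eig by (intro Greatest_equality)
  then show "matrix_eigenvalue A (lambda_max A)" "v \<bullet> (A *v v) \<le> lambda_max A * (norm v)\<^sup>2"
    using eig R[of v] by (simp_all add: power2_norm_eq_inner)
qed

lemma lambda_min_rayleigh:
  fixes A :: "real^'n^'n"
  assumes "transpose A = A"
  shows "matrix_eigenvalue A (lambda_min A)" and "lambda_min A * (norm v)\<^sup>2 \<le> v \<bullet> (A *v v)"
proof -
  have neg: "(- A) *v w = - (A *v w)" for w
    by (simp add: matrix_vector_mult_def vec_eq_iff sum_negf)
  have "transpose (- A) = - A" using assms by (simp add: transpose_def vec_eq_iff)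
  note * = lambda_max_rayleigh[OF this]
  have iff: "matrix_eigenvalue A (- l) \<longleftrightarrow> matrix_eigenvalue (- A) l" for l
  proof -
    have "- (A *v w) = l *\<^sub>R w \<longleftrightarrow> A *v w = (- l) *\<^sub>R w" for w
      by (metis add.inverse_inverse scaleR_minus_left)
    then show ?thesis by (simp only: matrix_eigenvalue_def neg)
  qed
  have eig: "matrix_eigenvalue A (- lambda_max (- A))" using *(1) iff by simp
  have le: "- lambda_max (- A) * (norm w)\<^sup>2 \<le> w \<bullet> (A *v w)" for w
    using *(2)[of w] by (simp add: neg)
  have "- lambda_max (- A) \<le> l" if l: "matrix_eigenvalue A l" for l
  proof -
    obtain w where w: "w \<noteq> 0" "A *v w = l *\<^sub>R w" using l by (auto simp: matrix_eigenvalue_def)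
    then have "- lambda_max (- A) * (norm w)\<^sup>2 \<le> l * (norm w)\<^sup>2"
      using le[of w] by (simp add: power2_norm_eq_inner)
    then show ?thesis by (rule mult_right_le_imp_le) (use w(1) in simp)
  qed
  then have "lambda_min A = - lambda_max (- A)" unfolding lambda_min_def using eig by (intro Least_equality)
  then show "matrix_eigenvalue A (lambda_min A)" "lambda_min A * (norm v)\<^sup>2 \<le> v \<bullet> (A *v v)"
    using eig le[of v] by simp_all
qed

lemma lambda_min_pos:
  fixes A :: "real^'n^'n"
  assumes "sym_pos_def A"
  shows "lambda_min A > 0"
proof -
  have "transpose A = A" using assms by (simp add: sym_pos_def_def)
  then obtain v where v: "v \<noteq> 0" "A *v v = lambda_min A *\<^sub>R v"
    using lambda_min_rayleigh(1) unfolding matrix_eigenvalue_def by blast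
  have "0 < v \<bullet> (A *v v)" using assms v(1) by (simp add: sym_pos_def_def)
  also have "\<dots> = lambda_min A * (norm v)\<^sup>2" by (simp add: v(2) power2_norm_eq_inner)
  finally show ?thesis by (simp add: zero_less_mult_iff)
qed

lemma lambda_min_le_max:
  fixes A :: "real^'n^'n"
  assumes "transpose A = A"
  shows "lambda_min A \<le> lambda_max A"
proof -
  have "lambda_min A * (norm (axis undefined 1 :: real^'n))\<^sup>2 \<le> lambda_max A * (norm (axis undefined 1 :: real^'n))\<^sup>2"
    using lambda_min_rayleigh(2)[OF assms] lambda_max_rayleigh(2)[OF assms] by (rule order_trans)
  then show ?thesis by (simp add: norm_axis_1)
qed

section \<open>Inner product distortion of random vectors\<close>

lemma integrable_product_pair:
  fixes f :: "'a \<Rightarrow> real" and g :: "'b \<Rightarrow> real"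
  assumes M: "sigma_finite_measure M" and N: "sigma_finite_measure N"
    and f: "integrable M f" and g: "integrable N g"
  shows "integrable (M \<Otimes>\<^sub>M N) (\<lambda>p. f (fst p) * g (snd p))"
    and "(\<integral>p. f (fst p) * g (snd p) \<partial>(M \<Otimes>\<^sub>M N)) = (\<integral>x. f x \<partial>M) * (\<integral>y. g y \<partial>N)"
proof -
  interpret P: pair_sigma_finite M N using M N by (simp add: pair_sigma_finite_def)
  have [measurable]: "f \<in> borel_measurable M" "g \<in> borel_measurable N" using f g by auto
  show int: "integrable (M \<Otimes>\<^sub>M N) (\<lambda>p. f (fst p) * g (snd p))"
    by (rule P.Fubini_integrable) (use f g in \<open>auto simp: abs_mult\<close>)
  show "(\<integral>p. f (fst p) * g (snd p) \<partial>(M \<Otimes>\<^sub>M N)) = (\<integral>x. f x \<partial>M) * (\<integral>y. g y \<partial>N)"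
    using P.integral_fst'[OF int] by simp
qed

text \<open>The couplings to be estimated are all induced by maps on the space of
  \<open>\<mu>0\<close>, so they are studied through L2 random vectors on one probability space, and
  moments of couplings become integrals over that space.\<close>

definition sq_integrable :: "'a measure \<Rightarrow> ('a \<Rightarrow> 'b::euclidean_space) \<Rightarrow> bool" where
  "sq_integrable M X \<longleftrightarrow> X \<in> borel_measurable M \<and> integrable M (\<lambda>w. (norm (X w))\<^sup>2)"

lemma sq_integrable_bound:
  assumes "sq_integrable M X" "Y \<in> borel_measurable M" "\<And>w. norm (Y w) \<le> K * norm (X w)"
  shows "sq_integrable M Y"
  unfolding sq_integrable_def
proof (intro conjI assms(2))
  have i: "integrable M (\<lambda>w. K\<^sup>2 * (norm (X w))\<^sup>2)" using assms(1) by (simp add: sq_integrable_def)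
  have "(norm (Y w))\<^sup>2 \<le> K\<^sup>2 * (norm (X w))\<^sup>2" for w
    using power_mono[OF assms(3)[of w] norm_ge_zero, of 2] by (simp add: power_mult_distrib)
  then show "integrable M (\<lambda>w. (norm (Y w))\<^sup>2)"
    by (intro Bochner_Integration.integrable_bound[OF i])
      (use assms(2) in \<open>auto intro!: AE_I2 intro: order_trans[OF _ abs_ge_self]\<close>)
qed

lemma sq_integrable_add:
  assumes "sq_integrable M X" "sq_integrable M Y"
  shows "sq_integrable M (\<lambda>w. X w + Y w)"
  unfolding sq_integrable_def
proof (intro conjI)
  have [measurable]: "X \<in> borel_measurable M" "Y \<in> borel_measurable M"
    using assms by (auto simp: sq_integrable_def)
  show "(\<lambda>w. X w + Y w) \<in> borel_measurable M" by measurable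
  have i: "integrable M (\<lambda>w. 2 * (norm (X w))\<^sup>2 + 2 * (norm (Y w))\<^sup>2)"
    using assms by (simp add: sq_integrable_def)
  have "(norm (X w + Y w))\<^sup>2 \<le> 2 * (norm (X w))\<^sup>2 + 2 * (norm (Y w))\<^sup>2" for w
  proof -
    have "(norm (X w + Y w))\<^sup>2 \<le> (norm (X w) + norm (Y w))\<^sup>2"
      by (intro power_mono norm_triangle_ineq) simp
    also have "\<dots> \<le> 2 * (norm (X w))\<^sup>2 + 2 * (norm (Y w))\<^sup>2"
      using zero_le_power2[of "norm (X w) - norm (Y w)"] by (simp add: power2_sum power2_diff)
    finally show ?thesis .
  qed
  then show "integrable M (\<lambda>w. (norm (X w + Y w))\<^sup>2)"
    by (intro Bochner_Integration.integrable_bound[OF i]) (auto intro!: AE_I2 intro: order_trans[OF _ abs_ge_self])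
qed

lemma sq_integrable_linear:
  fixes f :: "'b::euclidean_space \<Rightarrow> 'c::euclidean_space"
  assumes "sq_integrable M X" "bounded_linear f"
  shows "sq_integrable M (\<lambda>w. f (X w))"
proof -
  interpret bounded_linear f by fact
  obtain K where K: "\<And>x. norm (f x) \<le> norm x * K" using bounded by blast
  have "f \<in> borel_measurable borel"
    using assms(2) by (intro borel_measurable_continuous_onI linear_continuous_on)
  then have "(\<lambda>w. f (X w)) \<in> borel_measurable M"
    using assms(1) by (auto simp: sq_integrable_def intro: measurable_compose)
  then show ?thesis
    by (rule sq_integrable_bound[OF assms(1)]) (use K in \<open>simp add: mult.commute\<close>)
qed

lemma sq_integrable_diff:
  assumes "sq_integrable M X" "sq_integrable M Y"
  shows "sq_integrable M (\<lambda>w. X w - Y w)"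
  using sq_integrable_add[OF assms(1) sq_integrable_linear[OF assms(2) bounded_linear_minus[OF bounded_linear_ident]]]
  by simp

lemma sq_integrable_inner:
  assumes "sq_integrable M X" "sq_integrable M Y"
  shows "integrable M (\<lambda>w. X w \<bullet> Y w)"
proof -
  have [measurable]: "X \<in> borel_measurable M" "Y \<in> borel_measurable M"
    using assms by (auto simp: sq_integrable_def)
  have i: "integrable M (\<lambda>w. (norm (X w))\<^sup>2 + (norm (Y w))\<^sup>2)" using assms by (simp add: sq_integrable_def)
  have "\<bar>X w \<bullet> Y w\<bar> \<le> (norm (X w))\<^sup>2 + (norm (Y w))\<^sup>2" for w
  proof -
    have "\<bar>X w \<bullet> Y w\<bar> \<le> norm (X w) * norm (Y w)" by (rule Cauchy_Schwarz_ineq2)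
    moreover have "0 \<le> (norm (X w) - norm (Y w))\<^sup>2" by simp
    moreover have "0 \<le> norm (X w) * norm (Y w)" by simp
    ultimately show ?thesis unfolding power2_diff by linarith
  qed
  then show ?thesis
    by (intro Bochner_Integration.integrable_bound[OF i]) (auto intro!: AE_I2 intro: order_trans[OF _ abs_ge_self])
qed

lemma sq_integrable_component:
  fixes X :: "'a \<Rightarrow> real^'n"
  assumes "sq_integrable M X"
  shows "sq_integrable M (\<lambda>w. X w $ i)"
  using sq_integrable_linear[OF assms bounded_linear_vec_nth] .

lemma Cauchy_Schwarz_integral:
  fixes f g :: "'a \<Rightarrow> real"
  assumes f: "sq_integrable M f" and g: "sq_integrable M g"
  shows "\<bar>\<integral>w. f w * g w \<partial>M\<bar> \<le> sqrt (\<integral>w. (f w)\<^sup>2 \<partial>M) * sqrt (\<integral>w. (g w)\<^sup>2 \<partial>M)"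
proof -
  define F where "F = (\<integral>w. (f w)\<^sup>2 \<partial>M)"
  define G where "G = (\<integral>w. (g w)\<^sup>2 \<partial>M)"
  define B where "B = (\<integral>w. f w * g w \<partial>M)"
  have i: "integrable M (\<lambda>w. (f w)\<^sup>2)" "integrable M (\<lambda>w. (g w)\<^sup>2)" "integrable M (\<lambda>w. f w * g w)"
    using f g sq_integrable_inner[OF f g] by (auto simp: sq_integrable_def)
  have F0: "0 \<le> F" and G0: "0 \<le> G" by (simp_all add: F_def G_def)
  have q: "0 \<le> F + (2 * s * B + s\<^sup>2 * G)" for s
  proof -
    have "0 \<le> (\<integral>w. (f w + s * g w)\<^sup>2 \<partial>M)" by simp
    also have "\<dots> = (\<integral>w. (f w)\<^sup>2 + ((2 * s) * (f w * g w) + s\<^sup>2 * (g w)\<^sup>2) \<partial>M)"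
      by (rule Bochner_Integration.integral_cong) (auto simp: power2_eq_square algebra_simps)
    also have "\<dots> = F + (2 * s * B + s\<^sup>2 * G)"
      unfolding F_def G_def B_def using i by simp
    finally show ?thesis .
  qed
  have "B\<^sup>2 \<le> F * G"
  proof (cases "G = 0")
    case True
    have "B = 0"
    proof (rule ccontr)
      assume B: "B \<noteq> 0"
      have "0 \<le> F + 2 * (- (F + 1) / (2 * B)) * B" using q[of "- (F + 1) / (2 * B)"] True by simp
      also have "\<dots> = -1" using B by (simp add: field_simps)
      finally show False by simp
    qed
    with True show ?thesis by simp
  next
    case False
    with G0 have G: "G > 0" by simp
    have "0 \<le> F + (2 * (- B / G) * B + (- B / G)\<^sup>2 * G)" by (rule q)
    also have "\<dots> = F - B\<^sup>2 / G" using G by (simp add: power2_eq_square field_simps)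
    finally show ?thesis using G by (simp add: pos_divide_le_eq)
  qed
  then have "sqrt (B\<^sup>2) \<le> sqrt (F * G)" by (rule real_sqrt_le_mono)
  then show ?thesis by (simp add: real_sqrt_mult B_def F_def G_def)
qed

lemma Cauchy_Schwarz_integral_norm:
  assumes X: "sq_integrable M X" and Y: "sq_integrable M Y"
  shows "(\<integral>w. norm (X w) * norm (Y w) \<partial>M) \<le> sqrt (\<integral>w. (norm (X w))\<^sup>2 \<partial>M) * sqrt (\<integral>w. (norm (Y w))\<^sup>2 \<partial>M)"
    and "integrable M (\<lambda>w. norm (X w) * norm (Y w))"
proof -
  have n: "sq_integrable M (\<lambda>w. norm (X w))" "sq_integrable M (\<lambda>w. norm (Y w))"
    using X Y by (auto simp: sq_integrable_def)
  show "(\<integral>w. norm (X w) * norm (Y w) \<partial>M) \<le> sqrt (\<integral>w. (norm (X w))\<^sup>2 \<partial>M) * sqrt (\<integral>w. (norm (Y w))\<^sup>2 \<partial>M)"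
    using Cauchy_Schwarz_integral[OF n] by linarith
  show "integrable M (\<lambda>w. norm (X w) * norm (Y w))"
    using sq_integrable_inner[OF n] by simp
qed

lemma integral_inner_mult:
  fixes X Y :: "'a \<Rightarrow> real^'n"
  assumes X: "sq_integrable M X" and Y: "sq_integrable M Y"
  shows "(\<integral>w. (u \<bullet> X w) * (v \<bullet> Y w) \<partial>M) = u \<bullet> ((\<chi> i j. \<integral>w. X w $ i * Y w $ j \<partial>M) *v v)"
proof -
  have mI: "integrable M (\<lambda>w. X w $ i * Y w $ j)" for i j
    using sq_integrable_inner[OF sq_integrable_component[OF X] sq_integrable_component[OF Y], of i j] by simp
  have "(\<integral>w. (u \<bullet> X w) * (v \<bullet> Y w) \<partial>M) = (\<integral>w. (\<Sum>i\<in>UNIV. \<Sum>j\<in>UNIV. (u $ i * v $ j) * (X w $ i * Y w $ j)) \<partial>M)"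
    by (rule Bochner_Integration.integral_cong[OF refl])
      (unfold inner_vec_def sum_product inner_real_def, intro sum.cong refl, simp only: ac_simps)
  also have "\<dots> = (\<Sum>i\<in>UNIV. \<Sum>j\<in>UNIV. (u $ i * v $ j) * (\<integral>w. X w $ i * Y w $ j \<partial>M))"
    using mI by (simp add: Bochner_Integration.integral_sum Bochner_Integration.integrable_sum)
  also have "\<dots> = u \<bullet> ((\<chi> i j. \<integral>w. X w $ i * Y w $ j \<partial>M) *v v)"
    by (simp add: inner_vec_def matrix_vector_mult_def sum_distrib_left ac_simps)
  finally show ?thesis .
qed

section \<open>Moments over two independent copies\<close>

context prob_space
begin

text \<open>Expanded in coordinates, every term is a function of the first copy times a function of
  the second and so factorises. The result is the Frobenius product of two cross moment
  matrices.\<close>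

lemma integrable_pair_inner_mult:
  fixes X Y Z W :: "'a \<Rightarrow> real^'n"
  assumes "sq_integrable M X" "sq_integrable M Y" "sq_integrable M Z" "sq_integrable M W"
  shows "integrable (M \<Otimes>\<^sub>M M) (\<lambda>p. (X (fst p) \<bullet> Y (snd p)) * (Z (fst p) \<bullet> W (snd p)))"
    and "(\<integral>p. (X (fst p) \<bullet> Y (snd p)) * (Z (fst p) \<bullet> W (snd p)) \<partial>(M \<Otimes>\<^sub>M M)) =
      (\<Sum>i\<in>UNIV. \<Sum>j\<in>UNIV. (\<integral>w. X w $ i * Z w $ j \<partial>M) * (\<integral>w. Y w $ i * W w $ j \<partial>M))"
proof -
  have sf: "sigma_finite_measure M" by (rule sigma_finite_measure_axioms)
  have ij: "integrable M (\<lambda>w. X w $ i * Z w $ j)" "integrable M (\<lambda>w. Y w $ i * W w $ j)" for i j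
    using sq_integrable_inner[OF sq_integrable_component sq_integrable_component] assms by auto
  note P = integrable_product_pair[OF sf sf ij]
  have eq: "(X (fst p) \<bullet> Y (snd p)) * (Z (fst p) \<bullet> W (snd p)) =
      (\<Sum>i\<in>UNIV. \<Sum>j\<in>UNIV. (X (fst p) $ i * Z (fst p) $ j) * (Y (snd p) $ i * W (snd p) $ j))" for p
    unfolding inner_vec_def sum_product inner_real_def by (intro sum.cong refl) (simp only: ac_simps)
  show "integrable (M \<Otimes>\<^sub>M M) (\<lambda>p. (X (fst p) \<bullet> Y (snd p)) * (Z (fst p) \<bullet> W (snd p)))"
    unfolding eq by (intro Bochner_Integration.integrable_sum P)
  show "(\<integral>p. (X (fst p) \<bullet> Y (snd p)) * (Z (fst p) \<bullet> W (snd p)) \<partial>(M \<Otimes>\<^sub>M M)) =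
      (\<Sum>i\<in>UNIV. \<Sum>j\<in>UNIV. (\<integral>w. X w $ i * Z w $ j \<partial>M) * (\<integral>w. Y w $ i * W w $ j \<partial>M))"
    unfolding eq by (simp add: P Bochner_Integration.integral_sum Bochner_Integration.integrable_sum)
qed

text \<open>The value of \<open>igw_cost\<close> at the joint law of \<open>X\<close> and
  \<open>Y\<close>: the squared L2 distance of their Gram kernels on the product space.\<close>

definition gram_cost :: "('a \<Rightarrow> real^'n) \<Rightarrow> ('a \<Rightarrow> real^'n) \<Rightarrow> real" where
  "gram_cost X Y = (\<integral>p. (X (fst p) \<bullet> X (snd p) - Y (fst p) \<bullet> Y (snd p))\<^sup>2 \<partial>(M \<Otimes>\<^sub>M M))"

lemma gram_cost_integrable:
  fixes X Y :: "'a \<Rightarrow> real^'n"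
  assumes X: "sq_integrable M X" and Y: "sq_integrable M Y"
  shows "integrable (M \<Otimes>\<^sub>M M) (\<lambda>p. (X (fst p) \<bullet> X (snd p) - Y (fst p) \<bullet> Y (snd p))\<^sup>2)"
proof -
  have eq: "(X (fst p) \<bullet> X (snd p) - Y (fst p) \<bullet> Y (snd p))\<^sup>2 =
    (X (fst p) \<bullet> X (snd p)) * (X (fst p) \<bullet> X (snd p)) - 2 * ((X (fst p) \<bullet> X (snd p)) * (Y (fst p) \<bullet> Y (snd p)))
    + (Y (fst p) \<bullet> Y (snd p)) * (Y (fst p) \<bullet> Y (snd p))" for p
    by (simp add: power2_eq_square algebra_simps)
  show ?thesis unfolding eq
    using integrable_pair_inner_mult(1)[OF X X X X] integrable_pair_inner_mult(1)[OF X X Y Y]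
      integrable_pair_inner_mult(1)[OF Y Y Y Y] by simp
qed

lemma gram_cost_nonneg: "0 \<le> gram_cost X Y"
  by (simp add: gram_cost_def)

lemma gram_cost_triangle:
  fixes X Y Z :: "'a \<Rightarrow> real^'n"
  assumes X: "sq_integrable M X" and Y: "sq_integrable M Y" and Z: "sq_integrable M Z"
  shows "gram_cost X Z \<le> 2 * gram_cost X Y + 2 * gram_cost Y Z"
proof -
  note i = gram_cost_integrable[OF X Y] gram_cost_integrable[OF Y Z] gram_cost_integrable[OF X Z]
  have "gram_cost X Z \<le> (\<integral>p. 2 * (X (fst p) \<bullet> X (snd p) - Y (fst p) \<bullet> Y (snd p))\<^sup>2
      + 2 * (Y (fst p) \<bullet> Y (snd p) - Z (fst p) \<bullet> Z (snd p))\<^sup>2 \<partial>(M \<Otimes>\<^sub>M M))"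
    unfolding gram_cost_def
  proof (rule integral_mono[OF i(3)])
    have "(a - c)\<^sup>2 \<le> 2 * (a - b)\<^sup>2 + 2 * (b - c)\<^sup>2" for a b c :: real
      using zero_le_power2[of "a - 2 * b + c"] by (simp add: power2_eq_square algebra_simps)
    then show "(X (fst p) \<bullet> X (snd p) - Z (fst p) \<bullet> Z (snd p))\<^sup>2 \<le>
      2 * (X (fst p) \<bullet> X (snd p) - Y (fst p) \<bullet> Y (snd p))\<^sup>2
      + 2 * (Y (fst p) \<bullet> Y (snd p) - Z (fst p) \<bullet> Z (snd p))\<^sup>2" for p .
  qed (use i in auto)
  also have "\<dots> = 2 * gram_cost X Y + 2 * gram_cost Y Z"
    unfolding gram_cost_def using i by simp
  finally show ?thesis .
qed

text \<open>With \<open>S = X - Y\<close> and \<open>P = X + Y\<close> one has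
  \<open>2(\<langle>X,X'\<rangle> - \<langle>Y,Y'\<rangle>) = \<langle>S,P'\<rangle> + \<langle>P,S'\<rangle>\<close>. The cross term of the square has nonnegative mean since
  the matrix \<open>E SP\<^sup>T\<close> is symmetric, and \<open>E PP\<^sup>T\<close> dominates \<open>E XX\<^sup>T\<close> since \<open>E XY\<^sup>T\<close> is semidefinite.\<close>

lemma gram_cost_lower_bound:
  fixes X Y :: "'a \<Rightarrow> real^'n"
  assumes X: "sq_integrable M X" and Y: "sq_integrable M Y"
    and sym: "\<And>i j. (\<integral>w. X w $ i * Y w $ j \<partial>M) = (\<integral>w. X w $ j * Y w $ i \<partial>M)"
    and psd: "\<And>v. 0 \<le> (\<integral>w. (v \<bullet> X w) * (v \<bullet> Y w) \<partial>M)"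
    and c: "\<And>v. c * (norm v)\<^sup>2 \<le> (\<integral>w. (v \<bullet> X w)\<^sup>2 \<partial>M)"
  shows "c / 2 * (\<integral>w. (norm (X w - Y w))\<^sup>2 \<partial>M) \<le> gram_cost X Y"
proof -
  define S where "S w = X w - Y w" for w
  define P where "P w = X w + Y w" for w
  have S: "sq_integrable M S" and P: "sq_integrable M P"
    unfolding S_def P_def using X Y by (auto intro: sq_integrable_add sq_integrable_diff)
  have mI: "integrable M (\<lambda>w. U w $ i * V w $ j)"
    if "sq_integrable M U" "sq_integrable M V" for U V :: "'a \<Rightarrow> real^'n" and i j
    using sq_integrable_inner[OF sq_integrable_component[OF that(1)] sq_integrable_component[OF that(2)], of i j] by simp
  have lin: "sq_integrable M (\<lambda>w. v \<bullet> U w)" if "sq_integrable M U" for U :: "'a \<Rightarrow> real^'n" and v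
    by (rule sq_integrable_linear[OF that bounded_linear_inner_right])
  define K where "K i j = (\<integral>w. S w $ i * P w $ j \<partial>M)" for i j
  have Ksym: "K i j = K j i" for i j
  proof -
    have "K i j = (\<integral>w. X w $ i * X w $ j \<partial>M) + (\<integral>w. X w $ i * Y w $ j \<partial>M)
        - (\<integral>w. X w $ j * Y w $ i \<partial>M) - (\<integral>w. Y w $ i * Y w $ j \<partial>M)" for i j
    proof -
      have "K i j = (\<integral>w. X w $ i * X w $ j + X w $ i * Y w $ j - X w $ j * Y w $ i - Y w $ i * Y w $ j \<partial>M)"
        unfolding K_def by (rule Bochner_Integration.integral_cong) (auto simp: S_def P_def algebra_simps)
      then show ?thesis using mI[OF X X] mI[OF X Y] mI[OF Y Y] by simp
    qed
    then show ?thesis using sym[of i j] by (simp add: mult.commute)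
  qed
  let ?SP = "\<lambda>p. S (fst p) \<bullet> P (snd p)" and ?PS = "\<lambda>p. P (fst p) \<bullet> S (snd p)"
  note iSP = integrable_pair_inner_mult[OF S P S P] and iPS = integrable_pair_inner_mult[OF P S P S]
    and iX = integrable_pair_inner_mult[OF S P P S]
  have cross: "0 \<le> (\<integral>p. ?SP p * ?PS p \<partial>(M \<Otimes>\<^sub>M M))"
  proof -
    have "(\<integral>w. P w $ i * S w $ j \<partial>M) = K j i" for i j by (simp add: K_def mult.commute)
    then have "(\<integral>p. ?SP p * ?PS p \<partial>(M \<Otimes>\<^sub>M M)) = (\<Sum>i\<in>UNIV. \<Sum>j\<in>UNIV. K i j * K j i)"
      unfolding iX(2) by (simp add: K_def[symmetric])
    also have "\<dots> = (\<Sum>i\<in>UNIV. \<Sum>j\<in>UNIV. (K i j)\<^sup>2)"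
      using Ksym by (simp add: power2_eq_square)
    finally show ?thesis by (simp add: sum_nonneg)
  qed
  have swap: "(\<integral>p. ?PS p * ?PS p \<partial>(M \<Otimes>\<^sub>M M)) = (\<integral>p. ?SP p * ?SP p \<partial>(M \<Otimes>\<^sub>M M))"
    unfolding iSP(2) iPS(2) by (simp add: mult.commute)
  interpret PP: pair_sigma_finite M M ..
  have low: "c * (\<integral>w. (norm (S w))\<^sup>2 \<partial>M) \<le> (\<integral>p. ?SP p * ?SP p \<partial>(M \<Otimes>\<^sub>M M))"
  proof -
    \<comment> \<open>For a fixed value \<open>v\<close> of \<open>S\<close> at the first copy, the
      integral over the second copy is a second moment of \<open>P\<close> in the direction
      \<open>v\<close>.\<close>
    have pt: "c * (norm v)\<^sup>2 \<le> (\<integral>w. (v \<bullet> P w) * (v \<bullet> P w) \<partial>M)" for v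
    proof -
      have "(\<integral>w. (v \<bullet> P w) * (v \<bullet> P w) \<partial>M) =
        (\<integral>w. (v \<bullet> X w)\<^sup>2 + 2 * ((v \<bullet> X w) * (v \<bullet> Y w)) + (v \<bullet> Y w)\<^sup>2 \<partial>M)"
        by (rule Bochner_Integration.integral_cong) (auto simp: P_def inner_add_right power2_eq_square algebra_simps)
      also have "\<dots> = (\<integral>w. (v \<bullet> X w)\<^sup>2 \<partial>M) + 2 * (\<integral>w. (v \<bullet> X w) * (v \<bullet> Y w) \<partial>M) + (\<integral>w. (v \<bullet> Y w)\<^sup>2 \<partial>M)"
        using lin[OF X, of v] lin[OF Y, of v] sq_integrable_inner[OF lin[OF X, of v] lin[OF Y, of v]]
        by (simp add: sq_integrable_def)
      also have "\<dots> \<ge> (\<integral>w. (v \<bullet> X w)\<^sup>2 \<partial>M)" using psd[of v] by simp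
      finally show ?thesis using c[of v] by linarith
    qed
    have "c * (\<integral>w. (norm (S w))\<^sup>2 \<partial>M) = (\<integral>w. c * (norm (S w))\<^sup>2 \<partial>M)" by simp
    also have "\<dots> \<le> (\<integral>w. (\<integral>w'. (S w \<bullet> P w') * (S w \<bullet> P w') \<partial>M) \<partial>M)"
    proof (rule integral_mono)
      show "integrable M (\<lambda>w. c * (norm (S w))\<^sup>2)" using S by (simp add: sq_integrable_def)
      show "integrable M (\<lambda>w. \<integral>w'. (S w \<bullet> P w') * (S w \<bullet> P w') \<partial>M)"
        using PP.integrable_fst'[OF iSP(1)] by simp
    qed (rule pt)
    also have "\<dots> = (\<integral>p. ?SP p * ?SP p \<partial>(M \<Otimes>\<^sub>M M))"
      using PP.integral_fst'[OF iSP(1)] by simp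
    finally show ?thesis .
  qed
  \<comment> \<open>Each of the two squares enters with weight 1/4 and is bounded below by
    \<open>c\<close> times the mean of \<open>(norm (S w))\<^sup>2\<close>; together they give
    \<open>c / 2\<close>.\<close>
  have "gram_cost X Y = (\<integral>p. 1/4 * (?SP p * ?SP p) + (1/4 * (?PS p * ?PS p) + 1/2 * (?SP p * ?PS p)) \<partial>(M \<Otimes>\<^sub>M M))"
    unfolding gram_cost_def
  proof (rule Bochner_Integration.integral_cong)
    fix p :: "'a \<times> 'a"
    have "X (fst p) \<bullet> X (snd p) - Y (fst p) \<bullet> Y (snd p) = 1/2 * (?SP p + ?PS p)"
      by (simp add: S_def P_def inner_simps)
    then show "(X (fst p) \<bullet> X (snd p) - Y (fst p) \<bullet> Y (snd p))\<^sup>2 =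
      1/4 * (?SP p * ?SP p) + (1/4 * (?PS p * ?PS p) + 1/2 * (?SP p * ?PS p))"
      by (simp only:) (simp add: power2_eq_square algebra_simps)
  qed simp
  also have "\<dots> = 1/4 * (\<integral>p. ?SP p * ?SP p \<partial>(M \<Otimes>\<^sub>M M)) + (1/4 * (\<integral>p. ?PS p * ?PS p \<partial>(M \<Otimes>\<^sub>M M))
      + 1/2 * (\<integral>p. ?SP p * ?PS p \<partial>(M \<Otimes>\<^sub>M M)))"
    using iSP(1) iPS(1) iX(1) by simp
  finally show ?thesis using cross swap low by (simp add: S_def)
qed

text \<open>\<open>X\<close> mediates between \<open>Y\<close> and \<open>Z\<close>. Splitting the
  squared distance costs a factor 2 and passing to distortions a factor \<open>2 / c\<close>;
  \<open>gram_cost X Z\<close> is then replaced by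
  \<open>2 * gram_cost X Y + 2 * gram_cost Y Z\<close>. Hence 4 + 4 * 2 = 12 and 4 * 2 = 8.\<close>

lemma distance_gram_bound:
  fixes X Y Z :: "'a \<Rightarrow> real^'n"
  assumes X: "sq_integrable M X" and Y: "sq_integrable M Y" and Z: "sq_integrable M Z" and c: "0 < c"
    and XY: "c / 2 * (\<integral>w. (norm (X w - Y w))\<^sup>2 \<partial>M) \<le> gram_cost X Y"
    and XZ: "c / 2 * (\<integral>w. (norm (X w - Z w))\<^sup>2 \<partial>M) \<le> gram_cost X Z"
  shows "(\<integral>w. (norm (Z w - Y w))\<^sup>2 \<partial>M) \<le> (12 * gram_cost X Y + 8 * gram_cost Y Z) / c"
proof -
  have i: "integrable M (\<lambda>w. (norm (X w - Y w))\<^sup>2)" "integrable M (\<lambda>w. (norm (X w - Z w))\<^sup>2)"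
    "integrable M (\<lambda>w. (norm (Z w - Y w))\<^sup>2)"
    using sq_integrable_diff[OF X Y] sq_integrable_diff[OF X Z] sq_integrable_diff[OF Z Y]
    by (simp_all add: sq_integrable_def)
  have "(\<integral>w. (norm (Z w - Y w))\<^sup>2 \<partial>M) \<le> (\<integral>w. 2 * (norm (X w - Y w))\<^sup>2 + 2 * (norm (X w - Z w))\<^sup>2 \<partial>M)"
  proof (rule integral_mono[OF i(3)])
    fix w
    have "(norm (Z w - Y w))\<^sup>2 \<le> (norm (X w - Y w) + norm (X w - Z w))\<^sup>2"
      using norm_triangle_ineq4[of "X w - Y w" "X w - Z w"] by (intro power_mono) (auto simp: algebra_simps)
    also have "\<dots> \<le> 2 * (norm (X w - Y w))\<^sup>2 + 2 * (norm (X w - Z w))\<^sup>2"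
      using zero_le_power2[of "norm (X w - Y w) - norm (X w - Z w)"] by (simp add: power2_sum power2_diff)
    finally show "(norm (Z w - Y w))\<^sup>2 \<le> 2 * (norm (X w - Y w))\<^sup>2 + 2 * (norm (X w - Z w))\<^sup>2" .
  qed (use i in simp)
  also have "\<dots> = 2 * (\<integral>w. (norm (X w - Y w))\<^sup>2 \<partial>M) + 2 * (\<integral>w. (norm (X w - Z w))\<^sup>2 \<partial>M)"
    using i by simp
  finally have "c * (\<integral>w. (norm (Z w - Y w))\<^sup>2 \<partial>M) \<le>
      c * (2 * (\<integral>w. (norm (X w - Y w))\<^sup>2 \<partial>M) + 2 * (\<integral>w. (norm (X w - Z w))\<^sup>2 \<partial>M))"
    using c by (intro mult_left_mono) auto
  also have "\<dots> = 4 * (c / 2 * (\<integral>w. (norm (X w - Y w))\<^sup>2 \<partial>M)) + 4 * (c / 2 * (\<integral>w. (norm (X w - Z w))\<^sup>2 \<partial>M))"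
    by (simp add: algebra_simps)
  also have "\<dots> \<le> 12 * gram_cost X Y + 8 * gram_cost Y Z"
    using XY XZ gram_cost_triangle[OF X Y Z] by linarith
  finally show ?thesis using c by (simp add: pos_le_divide_eq mult.commute)
qed

end

text \<open>Here \<open>q\<close> is the mixed term of the expansion
  \<open>T\<^sub>t = (1-t)\<^sup>2 y + t(1-t) q + t\<^sup>2 z\<close>, so the left-hand side is the derivative of
  \<open>M\<^sub>2(\<nu>\<^sub>t)/2\<close> at \<open>t = 0\<close>. With \<open>D = A2 - A1 = E x(z-y)\<^sup>T/2\<close> one has
  \<open>q - 2y = (z - y) + A1\<inverse>D(z - y) + A1\<inverse>D A2\<inverse>D y\<close>.\<close>

lemma mixed_term_bound:
  fixes X Y Z :: "'a \<Rightarrow> real^'n" and A1 A2 V1 V2 :: "real^'n^'n"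
  assumes X: "sq_integrable M X" and Y: "sq_integrable M Y" and Z: "sq_integrable M Z"
    and A1: "\<And>i j. A1 $ i $ j = 1 / 2 * (\<integral>w. X w $ i * Y w $ j \<partial>M)"
    and A2: "\<And>i j. A2 $ i $ j = 1 / 2 * (\<integral>w. X w $ i * Z w $ j \<partial>M)"
    and inv1: "V1 ** A1 = mat 1" and inv2: "V2 ** A2 = mat 1"
    and V1: "\<And>v. norm (V1 *v v) \<le> k * norm v" and V2: "\<And>v. norm (V2 *v v) \<le> k * norm v" and k: "1 \<le> k"
    and q: "\<And>w. q w = V1 *v (A2 *v Z w) + V2 *v (A1 *v Y w)"
    and \<beta>: "\<beta> = k / 2 * sqrt (\<integral>w. (norm (X w))\<^sup>2 \<partial>M) * sqrt (\<integral>w. (norm (Y w))\<^sup>2 \<partial>M)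
      + k ^ 4 / 4 * (\<integral>w. (norm (X w))\<^sup>2 \<partial>M) * (\<integral>w. (norm (Y w))\<^sup>2 \<partial>M)"
  shows "(\<integral>w. Y w \<bullet> (q w - 2 *\<^sub>R Y w) \<partial>M) \<le>
    1 / 2 * (\<integral>w. (norm (Z w))\<^sup>2 \<partial>M) - 1 / 2 * (\<integral>w. (norm (Y w))\<^sup>2 \<partial>M) + \<beta> * (\<integral>w. (norm (Z w - Y w))\<^sup>2 \<partial>M)"
proof -
  define m0 where "m0 = (\<integral>w. (norm (X w))\<^sup>2 \<partial>M)"
  define m1 where "m1 = (\<integral>w. (norm (Y w))\<^sup>2 \<partial>M)"
  define m2 where "m2 = (\<integral>w. (norm (Z w))\<^sup>2 \<partial>M)"
  define e where "e = (\<integral>w. (norm (Z w - Y w))\<^sup>2 \<partial>M)"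
  have nn: "0 \<le> m0" "0 \<le> m1" "0 \<le> e" by (simp_all add: m0_def m1_def e_def)
  define D where "D = A2 - A1"
  \<comment> \<open>By Cauchy-Schwarz this bounds the operator norm of \<open>D\<close>, half the
    cross moment of \<open>X\<close> and \<open>Z - Y\<close>.\<close>
  define K where "K = 1 / 2 * sqrt m0 * sqrt e"
  have K0: "0 \<le> K" using nn by (simp add: K_def)
  have S: "sq_integrable M (\<lambda>w. Z w - Y w)" using Z Y by (rule sq_integrable_diff)
  have Dw: "u \<bullet> (D *v v) = 1 / 2 * (\<integral>w. (u \<bullet> X w) * (v \<bullet> (Z w - Y w)) \<partial>M)" for u v
  proof -
    have mI: "integrable M (\<lambda>w. U w $ i * W w $ j)"
      if "sq_integrable M U" "sq_integrable M W" for U W :: "'a \<Rightarrow> real^'n" and i j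
      using sq_integrable_inner[OF sq_integrable_component[OF that(1)] sq_integrable_component[OF that(2)], of i j] by simp
    have De: "D $ i $ j = 1 / 2 * (\<integral>w. X w $ i * (Z w - Y w) $ j \<partial>M)" for i j
      using mI[OF X Y, of i j] mI[OF X Z, of i j] by (simp add: D_def A1 A2 right_diff_distrib)
    have "D = (1 / 2) *\<^sub>R (\<chi> i j. \<integral>w. X w $ i * (Z w - Y w) $ j \<partial>M)"
      using De by (simp add: vec_eq_iff)
    then have "u \<bullet> (D *v v) = 1 / 2 * (u \<bullet> ((\<chi> i j. \<integral>w. X w $ i * (Z w - Y w) $ j \<partial>M) *v v))"
      by (simp add: scaleR_matrix_vector_assoc[symmetric])
    also have "u \<bullet> ((\<chi> i j. \<integral>w. X w $ i * (Z w - Y w) $ j \<partial>M) *v v) = (\<integral>w. (u \<bullet> X w) * (v \<bullet> (Z w - Y w)) \<partial>M)"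
      by (rule integral_inner_mult[OF X S, symmetric])
    finally show ?thesis .
  qed
  have Dn: "norm (D *v v) \<le> K * norm v" for v
  proof -
    let ?u = "D *v v"
    have "?u \<bullet> (D *v v) \<le> 1 / 2 * (\<integral>w. (norm ?u * norm v) * (norm (X w) * norm (Z w - Y w)) \<partial>M)"
      unfolding Dw
    proof (intro mult_left_mono integral_mono)
      show "integrable M (\<lambda>w. (?u \<bullet> X w) * (v \<bullet> (Z w - Y w)))"
        using sq_integrable_inner[OF sq_integrable_linear[OF X bounded_linear_inner_right, of ?u]
            sq_integrable_linear[OF S bounded_linear_inner_right, of v]] by simp
      show "integrable M (\<lambda>w. (norm ?u * norm v) * (norm (X w) * norm (Z w - Y w)))"
        by (rule integrable_mult_right) (rule Cauchy_Schwarz_integral_norm(2)[OF X S])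
      fix w
      have "(?u \<bullet> X w) * (v \<bullet> (Z w - Y w)) \<le> \<bar>?u \<bullet> X w\<bar> * \<bar>v \<bullet> (Z w - Y w)\<bar>"
        by (metis abs_ge_self abs_mult)
      also have "\<dots> \<le> (norm ?u * norm (X w)) * (norm v * norm (Z w - Y w))"
        by (intro mult_mono Cauchy_Schwarz_ineq2) auto
      finally show "(?u \<bullet> X w) * (v \<bullet> (Z w - Y w)) \<le> (norm ?u * norm v) * (norm (X w) * norm (Z w - Y w))"
        by (simp add: mult.assoc mult.left_commute)
    qed simp
    also have "\<dots> \<le> 1 / 2 * ((norm ?u * norm v) * (sqrt m0 * sqrt e))"
    proof -
      have "(\<integral>w. (norm ?u * norm v) * (norm (X w) * norm (Z w - Y w)) \<partial>M)
          = (norm ?u * norm v) * (\<integral>w. norm (X w) * norm (Z w - Y w) \<partial>M)"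
        by (rule integral_mult_right_zero)
      also have "\<dots> \<le> (norm ?u * norm v) * (sqrt m0 * sqrt e)"
        unfolding m0_def e_def by (intro mult_left_mono Cauchy_Schwarz_integral_norm(1) X S) simp
      finally show ?thesis by simp
    qed
    finally have "norm ?u * norm ?u \<le> norm ?u * (K * norm v)"
      by (simp add: K_def norm_eq_sqrt_inner mult.assoc mult.left_commute mult.commute)
    then show ?thesis using K0 by (cases "?u = 0") auto
  qed
  have i1: "V1 *v (A1 *v v) = v" and i2: "V2 *v (A2 *v v) = v" for v
    using inv1 inv2 by (simp_all add: matrix_vector_mul_assoc)
  have A2D: "A2 *v v = A1 *v v + D *v v" for v
    by (simp add: D_def matrix_vector_mult_diff_rdistrib)
  have qe: "q w - 2 *\<^sub>R Y w = (Z w - Y w) + V1 *v (D *v (Z w - Y w)) + V1 *v (D *v (V2 *v (D *v Y w)))" for w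
  proof -
    have a: "V1 *v (A2 *v Z w) = Z w + V1 *v (D *v Z w)"
      by (simp add: A2D matrix_vector_right_distrib i1)
    have b: "V2 *v (A1 *v Y w) = Y w - V2 *v (D *v Y w)"
      using i2[of "Y w"] by (simp add: A2D matrix_vector_right_distrib algebra_simps)
    have "V2 *v (D *v Y w) = V1 *v (A1 *v (V2 *v (D *v Y w)))" by (simp add: i1)
    also have "\<dots> = V1 *v (D *v Y w - D *v (V2 *v (D *v Y w)))"
    proof -
      have "A2 *v (V2 *v v) = v" for v
        using inv2 by (simp add: matrix_vector_mul_assoc matrix_left_right_inverse)
      from this[of "D *v Y w"] have "A1 *v (V2 *v (D *v Y w)) = D *v Y w - D *v (V2 *v (D *v Y w))"
        by (simp add: A2D algebra_simps)
      then show ?thesis by simp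
    qed
    finally have c: "V2 *v (D *v Y w) = V1 *v (D *v Y w) - V1 *v (D *v (V2 *v (D *v Y w)))"
      by (simp add: matrix_vector_mult_diff_distrib)
    show ?thesis unfolding q a b
      by (subst c) (simp add: matrix_vector_mult_diff_distrib algebra_simps scaleR_2)
  qed
  \<comment> \<open>Each of the last two terms carries two factors of size \<open>sqrt e\<close>,
    either \<open>K\<close> and \<open>norm (Z w - Y w)\<close> or \<open>K\<close> twice. This is
    why both integrate to a multiple of \<open>e\<close>, and why the bound is quadratic in the
    distance.\<close>
  have pt: "Y w \<bullet> (q w - 2 *\<^sub>R Y w) \<le> 1 / 2 * (norm (Z w))\<^sup>2 - 1 / 2 * (norm (Y w))\<^sup>2
      + ((k * K) * (norm (Y w) * norm (Z w - Y w)) + (k * K)\<^sup>2 * (norm (Y w))\<^sup>2)" for w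
  proof -
    have 1: "Y w \<bullet> (Z w - Y w) \<le> 1 / 2 * (norm (Z w))\<^sup>2 - 1 / 2 * (norm (Y w))\<^sup>2"
    proof -
      have "(norm (Z w - Y w))\<^sup>2 = (norm (Z w))\<^sup>2 - 2 * (Y w \<bullet> Z w) + (norm (Y w))\<^sup>2"
        by (simp add: power2_norm_eq_inner inner_diff_left inner_diff_right inner_commute)
      moreover have "0 \<le> (norm (Z w - Y w))\<^sup>2" by simp
      moreover have "Y w \<bullet> (Z w - Y w) = Y w \<bullet> Z w - (norm (Y w))\<^sup>2"
        by (simp add: power2_norm_eq_inner inner_diff_right)
      ultimately show ?thesis by linarith
    qed
    have VD: "norm (V1 *v (D *v v)) \<le> (k * K) * norm v" "norm (V2 *v (D *v v)) \<le> (k * K) * norm v" for v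
    proof -
      have "k * norm (D *v v) \<le> k * (K * norm v)" using Dn k by (intro mult_left_mono) auto
      then show "norm (V1 *v (D *v v)) \<le> (k * K) * norm v" "norm (V2 *v (D *v v)) \<le> (k * K) * norm v"
        using V1[of "D *v v"] V2[of "D *v v"] by (simp_all add: mult.assoc)
    qed
    have 2: "Y w \<bullet> (V1 *v (D *v (Z w - Y w))) \<le> (k * K) * (norm (Y w) * norm (Z w - Y w))"
    proof -
      have "Y w \<bullet> (V1 *v (D *v (Z w - Y w))) \<le> norm (Y w) * norm (V1 *v (D *v (Z w - Y w)))"
        by (rule norm_cauchy_schwarz)
      also have "\<dots> \<le> norm (Y w) * ((k * K) * norm (Z w - Y w))" by (intro mult_left_mono VD) simp
      finally show ?thesis by (simp add: mult.left_commute)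
    qed
    have 3: "Y w \<bullet> (V1 *v (D *v (V2 *v (D *v Y w)))) \<le> (k * K)\<^sup>2 * (norm (Y w))\<^sup>2"
    proof -
      have "Y w \<bullet> (V1 *v (D *v (V2 *v (D *v Y w)))) \<le> norm (Y w) * norm (V1 *v (D *v (V2 *v (D *v Y w))))"
        by (rule norm_cauchy_schwarz)
      also have "\<dots> \<le> norm (Y w) * ((k * K) * ((k * K) * norm (Y w)))"
        using k K0 by (intro mult_left_mono order_trans[OF VD(1)] VD(2)) auto
      finally show ?thesis by (simp add: power2_eq_square mult.left_commute mult.assoc)
    qed
    show ?thesis unfolding qe inner_add_right using 1 2 3 by linarith
  qed
  have iY: "integrable M (\<lambda>w. (norm (Y w))\<^sup>2)" and iZ: "integrable M (\<lambda>w. (norm (Z w))\<^sup>2)"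
    using Y Z by (simp_all add: sq_integrable_def)
  have iN: "integrable M (\<lambda>w. norm (Y w) * norm (Z w - Y w))" by (rule Cauchy_Schwarz_integral_norm(2)[OF Y S])
  have sq: "sq_integrable M (\<lambda>w. q w - 2 *\<^sub>R Y w)"
    unfolding q
    by (intro sq_integrable_diff sq_integrable_add sq_integrable_linear[OF _ matrix_vector_mul_bounded_linear]
      sq_integrable_linear[OF _ bounded_linear_scaleR_right] Y Z)
  have "(\<integral>w. Y w \<bullet> (q w - 2 *\<^sub>R Y w) \<partial>M) \<le> (\<integral>w. 1 / 2 * (norm (Z w))\<^sup>2 - 1 / 2 * (norm (Y w))\<^sup>2
      + ((k * K) * (norm (Y w) * norm (Z w - Y w)) + (k * K)\<^sup>2 * (norm (Y w))\<^sup>2) \<partial>M)"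
    by (rule integral_mono[OF sq_integrable_inner[OF Y sq]]) (use iY iZ iN pt in auto)
  also have "\<dots> = 1 / 2 * m2 - 1 / 2 * m1 + ((k * K) * (\<integral>w. norm (Y w) * norm (Z w - Y w) \<partial>M) + (k * K)\<^sup>2 * m1)"
    unfolding m1_def m2_def using iY iZ iN by simp
  also have "\<dots> \<le> 1 / 2 * m2 - 1 / 2 * m1 + ((k * K) * (sqrt m1 * sqrt e) + (k * K)\<^sup>2 * m1)"
    using k K0 unfolding m1_def e_def
    by (intro add_left_mono add_right_mono mult_left_mono Cauchy_Schwarz_integral_norm(1) Y S) simp_all
  also have "(k * K) * (sqrt m1 * sqrt e) = k / 2 * sqrt m0 * sqrt m1 * e"
    using nn by (simp add: K_def)
  also have "(k * K)\<^sup>2 * m1 = k\<^sup>2 / 4 * m0 * m1 * e"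
    using nn by (simp add: K_def power_mult_distrib power_divide)
  \<comment> \<open>The estimate produces \<open>k\<^sup>2\<close>; the assumption
    \<open>1 \<le> k\<close> raises it to the fourth power that occurs in
    \<open>\<beta>\<close>.\<close>
  also have "k\<^sup>2 / 4 * m0 * m1 * e \<le> k ^ 4 / 4 * m0 * m1 * e"
  proof -
    have "k\<^sup>2 \<le> k ^ 4" using k by (intro power_increasing) auto
    then show ?thesis using nn by (intro mult_right_mono divide_right_mono) auto
  qed
  finally show ?thesis
    unfolding \<beta> m0_def[symmetric] m1_def[symmetric] m2_def[symmetric] e_def[symmetric]
    by (simp add: algebra_simps)
qed

section \<open>Relative entropy along the geodesic\<close>

definition gaussian_density :: "real^'n \<Rightarrow> real" where
  "gaussian_density y = (\<Prod>i\<in>UNIV. std_normal_density (y $ i))"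

lemma gaussian_density_pos: "0 < gaussian_density y"
  unfolding gaussian_density_def by (intro prod_pos) (simp add: normal_density_pos)

lemma gaussian_density_measurable [measurable]:
  "gaussian_density \<in> borel_measurable (borel :: (real^'n) measure)"
  unfolding gaussian_density_def by measurable

lemma ln_gaussian_density:
  fixes y :: "real^'n"
  shows "ln (gaussian_density y) = - (norm y)\<^sup>2 / 2 - real CARD('n) / 2 * ln (2 * pi)"
proof -
  have "ln (std_normal_density x) = - x\<^sup>2 / 2 - ln (2 * pi) / 2" for x
    by (simp add: std_normal_density_def ln_mult ln_div ln_sqrt)
  then have "ln (gaussian_density y) = (\<Sum>i\<in>UNIV. - (y $ i)\<^sup>2 / 2 - ln (2 * pi) / 2)"
    unfolding gaussian_density_def by (subst ln_prod) (auto simp: less_imp_neq[OF normal_density_pos, symmetric])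
  also have "\<dots> = - (\<Sum>i\<in>UNIV. (y $ i)\<^sup>2) / 2 - real CARD('n) / 2 * ln (2 * pi)"
    by (simp add: sum_subtractf sum_negf sum_divide_distrib[symmetric])
  also have "(\<Sum>i\<in>UNIV. (y $ i)\<^sup>2) = (norm y)\<^sup>2"
    unfolding power2_norm_eq_inner by (simp add: inner_vec_def power2_eq_square)
  finally show ?thesis .
qed

lemma std_gaussian_eq: "std_gaussian = density lborel (\<lambda>y. ennreal (gaussian_density y))"
  by (simp add: std_gaussian_def gaussian_density_def)

lemma sets_std_gaussian [simp]: "sets (std_gaussian :: (real^'n) measure) = sets borel"
  by (simp add: std_gaussian_eq)

lemma prob_space_std_gaussian: "prob_space (std_gaussian :: (real^'n) measure)"
proof
  let ?n = "\<lambda>x. ennreal (std_normal_density x)"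
  have cart: "(\<Prod>b\<in>Basis. ?n (y \<bullet> b)) = (\<Prod>i\<in>UNIV. ?n (y $ i))" for y :: "real^'n"
    by (simp add: Basis_vec_def UNION_singleton_eq_range prod.reindex inj_on_def axis_eq_axis inner_axis)
  have one: "(\<integral>\<^sup>+x. ?n x \<partial>lborel) = 1"
    using prob_space.emeasure_space_1[OF prob_space_normal_density[of 1 0]] by (simp add: emeasure_density)
  have "emeasure (std_gaussian :: (real^'n) measure) (space std_gaussian) = (\<integral>\<^sup>+y. ennreal (gaussian_density y) \<partial>(lborel :: (real^'n) measure))"
    unfolding std_gaussian_eq by (subst emeasure_density) auto
  also have "\<dots> = (\<integral>\<^sup>+y. (\<Prod>b\<in>Basis. ?n (y \<bullet> b)) \<partial>(lborel :: (real^'n) measure))"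
    unfolding cart gaussian_density_def by (simp add: prod_ennreal)
  also have "\<dots> = (\<Prod>b\<in>(Basis :: (real^'n) set). \<integral>\<^sup>+x. ?n x \<partial>lborel)"
    by (rule nn_integral_lborel_prod) auto
  finally show "emeasure (std_gaussian :: (real^'n) measure) (space std_gaussian) = 1"
    by (simp add: one)
qed

lemma sigma_finite_std_gaussian: "sigma_finite_measure (std_gaussian :: (real^'n) measure)"
  by (rule prob_space_imp_sigma_finite[OF prob_space_std_gaussian])

lemma density_std_gaussian:
  fixes f :: "real^'n \<Rightarrow> ennreal"
  assumes [measurable]: "f \<in> borel_measurable borel"
  shows "density std_gaussian (\<lambda>y. f y / ennreal (gaussian_density y)) = density lborel f"
  unfolding std_gaussian_eq
proof (subst density_density_eq)
  show "density lborel (\<lambda>y. ennreal (gaussian_density y) * (f y / ennreal (gaussian_density y))) = density lborel f"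
  proof (rule density_cong)
    show "AE y in lborel. ennreal (gaussian_density y) * (f y / ennreal (gaussian_density y)) = f y"
    proof (rule AE_I2)
      fix y :: "real^'n"
      have "ennreal (gaussian_density y) \<noteq> 0"
        using gaussian_density_pos[of y] by (simp add: ennreal_eq_0_iff)
      then have "f y * ennreal (gaussian_density y) / ennreal (gaussian_density y) = f y"
        by (rule mult_divide_eq_ennreal) simp
      then show "ennreal (gaussian_density y) * (f y / ennreal (gaussian_density y)) = f y"
        by (simp add: ennreal_times_divide mult.commute)
    qed
  qed measurable
qed measurable

text \<open>The Gaussian density is positive everywhere, so the two reference measures have the same
  null sets.\<close>

lemma absolutely_continuous_std_gaussian_iff:
  "absolutely_continuous std_gaussian \<nu> \<longleftrightarrow> absolutely_continuous lborel (\<nu> :: (real^'n) measure)"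
proof -
  have "null_sets (std_gaussian :: (real^'n) measure) = null_sets lborel"
  proof (intro set_eqI)
    fix N :: "(real^'n) set"
    have "N \<in> null_sets std_gaussian \<longleftrightarrow> N \<in> sets lborel \<and> (AE x in lborel. x \<in> N \<longrightarrow> ennreal (gaussian_density x) = 0)"
      unfolding std_gaussian_eq by (subst null_sets_density_iff) auto
    also have "\<dots> \<longleftrightarrow> N \<in> sets lborel \<and> (AE x in lborel. x \<notin> N)"
      by (simp add: ennreal_eq_0_iff not_le[THEN iffD2, OF gaussian_density_pos])
    also have "\<dots> \<longleftrightarrow> N \<in> null_sets lborel" by (metis AE_iff_null_sets null_setsD2)
    finally show "N \<in> null_sets std_gaussian \<longleftrightarrow> N \<in> null_sets lborel" .
  qed
  then show ?thesis by (simp add: absolutely_continuous_def)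
qed

lemma density_RN_deriv_lborel:
  fixes \<nu> :: "(real^'n) measure"
  assumes "absolutely_continuous lborel \<nu>" "sets \<nu> = sets borel"
  shows "density lborel (RN_deriv lborel \<nu>) = \<nu>"
  by (rule sigma_finite_measure.density_RN_deriv[OF sigma_finite_lborel assms(1)]) (simp add: assms(2))

lemma RN_deriv_AE_pos_finite:
  fixes \<nu> :: "(real^'n) measure"
  assumes prob: "prob_space \<nu>" and ac: "absolutely_continuous lborel \<nu>" and sets: "sets \<nu> = sets borel"
  shows "AE y in \<nu>. 0 < RN_deriv lborel \<nu> y \<and> RN_deriv lborel \<nu> y < \<infinity>"
proof -
  let ?f = "RN_deriv lborel \<nu>"
  have d: "density lborel ?f = \<nu>" by (rule density_RN_deriv_lborel[OF ac sets])
  have [measurable]: "?f \<in> borel_measurable borel" using borel_measurable_RN_deriv[of lborel \<nu>] by simp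
  have pos: "AE y in \<nu>. 0 < ?f y"
  proof -
    have "AE y in density lborel ?f. 0 < ?f y" by (subst AE_density) auto
    then show ?thesis by (simp only: d)
  qed
  have "(\<integral>\<^sup>+y. ?f y \<partial>lborel) = emeasure (density lborel ?f) UNIV" by (subst emeasure_density) auto
  also have "\<dots> = 1" using prob_space.emeasure_space_1[OF prob] sets_eq_imp_space_eq[OF sets] by (simp add: d)
  finally have "AE y in lborel. ?f y \<noteq> \<infinity>" by (intro nn_integral_PInf_AE) auto
  then have "AE y in \<nu>. ?f y \<noteq> \<infinity>" by (rule absolutely_continuous_AE[OF _ ac, rotated]) (simp add: sets)
  with pos show ?thesis by eventually_elim (simp add: less_top)
qed

text \<open>This is where the second moment enters the entropy: the reference density adds
  \<open>(norm y)\<^sup>2 / 2\<close> and a constant to the logarithm of the Lebesgue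
  density.\<close>

lemma entropy_density_std_gaussian:
  fixes \<nu> :: "(real^'n) measure"
  assumes prob: "prob_space \<nu>" and ac: "absolutely_continuous lborel \<nu>" and sets: "sets \<nu> = sets borel"
  shows "AE y in \<nu>. entropy_density (exp 1) std_gaussian \<nu> y =
    ln (enn2real (RN_deriv lborel \<nu> y)) + (norm y)\<^sup>2 / 2 + real CARD('n) / 2 * ln (2 * pi)"
proof -
  let ?f = "RN_deriv lborel \<nu>" and ?\<gamma> = "std_gaussian :: (real^'n) measure"
  have [measurable]: "?f \<in> borel_measurable borel" using borel_measurable_RN_deriv[of lborel \<nu>] by simp
  have "density ?\<gamma> (\<lambda>y. ?f y / ennreal (gaussian_density y)) = \<nu>"
    by (subst density_std_gaussian) (simp_all add: density_RN_deriv_lborel[OF ac sets])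
  then have "AE y in ?\<gamma>. ?f y / ennreal (gaussian_density y) = RN_deriv ?\<gamma> \<nu> y"
    by (intro sigma_finite_measure.RN_deriv_unique[OF sigma_finite_std_gaussian])
      (simp_all add: measurable_cong_sets[OF sets_std_gaussian refl])
  moreover have "absolutely_continuous ?\<gamma> \<nu>" using ac by (simp add: absolutely_continuous_std_gaussian_iff)
  ultimately have "AE y in \<nu>. ?f y / ennreal (gaussian_density y) = RN_deriv ?\<gamma> \<nu> y"
    using absolutely_continuous_AE[of \<nu> ?\<gamma>] by (simp add: sets)
  with RN_deriv_AE_pos_finite[OF prob ac sets] show ?thesis
  proof eventually_elim
    case (elim y)
    then have f: "?f y = ennreal (enn2real (?f y))" "enn2real (?f y) > 0"
      by (simp_all add: enn2real_positive_iff)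
    have g: "gaussian_density y > 0" by (rule gaussian_density_pos)
    have "enn2real (RN_deriv ?\<gamma> \<nu> y) = enn2real (?f y / ennreal (gaussian_density y))" using elim by simp
    also have "\<dots> = enn2real (?f y) / gaussian_density y"
      by (subst f(1)) (use f(2) g in \<open>simp add: divide_ennreal\<close>)
    finally have "entropy_density (exp 1) ?\<gamma> \<nu> y = ln (enn2real (?f y) / gaussian_density y)"
      by (simp add: entropy_density_def log_def)
    then show ?case using f(2) g by (simp add: ln_div ln_gaussian_density)
  qed
qed

text \<open>For a positive value \<open>a\<close> of the density relative to the Gaussian,
  \<open>a * (- ln a) \<le> 1 - a \<le> 1\<close> by \<open>ln (1 / a) \<le> 1 / a - 1\<close>, and
  the Gaussian has total mass 1. Integrability of the logarithm is thus a matter of upper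
  bounds.\<close>

lemma entropy_density_negative_part_integrable:
  fixes \<nu> :: "(real^'n) measure"
  assumes prob: "prob_space \<nu>" and ac: "absolutely_continuous lborel \<nu>" and sets: "sets \<nu> = sets borel"
  shows "integrable \<nu> (\<lambda>y. max 0 (- entropy_density (exp 1) std_gaussian \<nu> y))"
proof -
  let ?\<gamma> = "std_gaussian :: (real^'n) measure"
  let ?r = "RN_deriv ?\<gamma> \<nu>" and ?h = "entropy_density (exp 1) ?\<gamma> \<nu>"
  have rm [measurable]: "?r \<in> borel_measurable borel"
    using borel_measurable_RN_deriv[of ?\<gamma> \<nu>] by (simp add: measurable_cong_sets[OF sets_std_gaussian refl])
  have hm [measurable]: "?h \<in> borel_measurable borel"
    unfolding entropy_density_def[abs_def] comp_def by measurable
  have hm\<nu>: "(\<lambda>y. max 0 (- ?h y)) \<in> borel_measurable \<nu>"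
    by (subst measurable_cong_sets[OF sets refl]) measurable
  have d: "density ?\<gamma> ?r = \<nu>"
    by (rule sigma_finite_measure.density_RN_deriv[OF sigma_finite_std_gaussian])
      (simp_all add: absolutely_continuous_std_gaussian_iff ac sets)
  have fin: "AE y in ?\<gamma>. ?r y \<noteq> \<infinity>"
    using sigma_finite_measure.RN_deriv_finite[OF sigma_finite_std_gaussian, of \<nu>] prob ac sets
    by (simp add: absolutely_continuous_std_gaussian_iff prob_space_imp_sigma_finite)
  have "(\<integral>\<^sup>+y. ennreal (max 0 (- ?h y)) \<partial>\<nu>) = (\<integral>\<^sup>+y. ennreal (max 0 (- ?h y)) \<partial>density ?\<gamma> ?r)"
    by (simp only: d)
  also have "\<dots> = (\<integral>\<^sup>+y. ?r y * ennreal (max 0 (- ?h y)) \<partial>?\<gamma>)"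
    by (subst nn_integral_density) (simp_all add: measurable_cong_sets[OF sets_std_gaussian refl])
  also have "\<dots> \<le> (\<integral>\<^sup>+y. 1 \<partial>?\<gamma>)"
  proof (rule nn_integral_mono_AE)
    show "AE y in ?\<gamma>. ?r y * ennreal (max 0 (- ?h y)) \<le> 1"
      using fin
    proof eventually_elim
      case (elim y)
      define a where "a = enn2real (?r y)"
      have ra: "?r y = ennreal a" using elim by (simp add: a_def less_top)
      have a0: "a \<ge> 0" by (simp add: a_def)
      have "a * max 0 (- ln a) \<le> 1"
      proof (cases "a = 0")
        case False
        with a0 have a: "a > 0" by simp
        have "- ln a = ln (1 / a)" using a by (simp add: ln_div)
        also have "\<dots> \<le> 1 / a - 1" using a by (intro ln_le_minus_one) simp
        finally have "a * (- ln a) \<le> a * (1 / a - 1)" using a by (intro mult_left_mono) auto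
        also have "\<dots> \<le> 1" using a by (simp add: field_simps)
        finally show ?thesis using a by (simp add: max_def)
      qed simp
      moreover have "?h y = ln a" by (simp add: entropy_density_def log_def a_def)
      ultimately show ?case
      proof -
        have "ennreal a * ennreal (max 0 (- ln a)) = ennreal (a * max 0 (- ln a))"
          by (rule ennreal_mult[symmetric]) (use a0 in auto)
        also have "\<dots> \<le> ennreal 1" by (rule ennreal_leI) fact
        finally show ?thesis unfolding ra \<open>?h y = ln a\<close> by simp
      qed
    qed
  qed
  also have "\<dots> < \<infinity>"
  proof -
    have "emeasure ?\<gamma> (space ?\<gamma>) = 1" by (rule prob_space.emeasure_space_1[OF prob_space_std_gaussian])
    then show ?thesis by simp
  qed
  finally show ?thesis
    using hm\<nu> by (intro integrableI_nonneg) auto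
qed


text \<open>The integrable majorant \<open>k\<close> controls the positive part of the logarithm;
  its negative part is integrable anyway. So the first case of \<open>rel_entropy\<close> applies,
  and the almost everywhere inequality can be integrated over \<open>\<mu>\<close>.\<close>

lemma rel_entropy_pushforward_le:
  fixes \<mu> :: "(real^'n) measure" and T :: "real^'n \<Rightarrow> real^'n"
  assumes prob: "prob_space \<mu>" and sets: "sets \<mu> = sets borel" and T: "T \<in> borel_measurable borel"
    and ac: "absolutely_continuous lborel (distr \<mu> borel T)"
    and k: "integrable \<mu> k"
    and le: "AE x in \<mu>. entropy_density (exp 1) std_gaussian (distr \<mu> borel T) (T x) \<le> k x"
  shows "rel_entropy (distr \<mu> borel T) std_gaussian \<le> ereal (\<integral>x. k x \<partial>\<mu>)"
proof -
  let ?\<nu> = "distr \<mu> borel T"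
  let ?h = "entropy_density (exp 1) std_gaussian ?\<nu>"
  have Tm: "T \<in> borel_measurable \<mu>" using T by (simp add: measurable_cong_sets[OF sets refl])
  have prob\<nu>: "prob_space ?\<nu>" by (rule prob_space.prob_space_distr[OF prob Tm])
  have hm: "?h \<in> borel_measurable borel"
    using measurable_entropy_density[of "exp 1" std_gaussian ?\<nu>]
    by (simp add: measurable_cong_sets[OF sets_std_gaussian refl])
  have hTm: "(\<lambda>x. ?h (T x)) \<in> borel_measurable \<mu>" by (rule measurable_compose[OF Tm hm])
  have "integrable ?\<nu> (\<lambda>y. max 0 (- ?h y))"
    by (rule entropy_density_negative_part_integrable[OF prob\<nu> ac]) simp
  then have neg: "integrable \<mu> (\<lambda>x. max 0 (- ?h (T x)))"
    by (subst (asm) integrable_distr_eq[OF Tm]) (use hm in measurable)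
  have int\<mu>: "integrable \<mu> (\<lambda>x. ?h (T x))"
  proof (rule Bochner_Integration.integrable_bound[OF Bochner_Integration.integrable_add[OF integrable_abs[OF k] neg] hTm])
    show "AE x in \<mu>. norm (?h (T x)) \<le> norm (\<bar>k x\<bar> + max 0 (- ?h (T x)))"
      using le by eventually_elim (auto simp: abs_if max_def)
  qed
  then have int\<nu>: "integrable ?\<nu> ?h" by (subst integrable_distr_eq[OF Tm hm])
  have "KL_divergence (exp 1) std_gaussian ?\<nu> = (\<integral>x. ?h (T x) \<partial>\<mu>)"
    unfolding KL_divergence_def by (rule integral_distr[OF Tm hm])
  also have "\<dots> \<le> (\<integral>x. k x \<partial>\<mu>)" by (rule integral_mono_AE[OF int\<mu> k le])
  finally show ?thesis
    using ac int\<nu> by (simp add: rel_entropy_def absolutely_continuous_std_gaussian_iff)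
qed

lemma rel_entropy_finiteD:
  assumes "rel_entropy \<mu> \<nu> \<noteq> \<infinity>"
  shows "integrable \<mu> (entropy_density (exp 1) \<nu> \<mu>)"
    and "rel_entropy \<mu> \<nu> = ereal (\<integral>x. entropy_density (exp 1) \<nu> \<mu> x \<partial>\<mu>)"
  using assms by (auto simp: rel_entropy_def KL_divergence_def split: if_splits)

lemma matrix_of_mult_mult:
  fixes A B :: "real^'n^'n"
  shows "matrix (\<lambda>h. A *v (B *v h)) = A ** B"
  by (simp add: matrix_vector_mul_assoc)

text \<open>The density of the initial measure cancels in the inequality, which is why its entropy need
  not be finite: only the concavity of \<open>ln det\<close> along the two factors of the Jacobian is used.\<close>

lemma entropy_density_along_geodesic:
  fixes \<mu>0 :: "(real^'n) measure" and G1 G2 :: "real^'n \<Rightarrow> real^'n" and B1 B2 :: "real^'n^'n"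
  assumes prob: "prob_space \<mu>0" and sets: "sets \<mu>0 = sets borel" and ac: "absolutely_continuous lborel \<mu>0"
    and pot1: "convex_potential_gradient \<mu>0 \<Omega>1 \<phi>1 G1" and pot2: "convex_potential_gradient \<mu>0 \<Omega>2 \<phi>2 G2"
    and B1: "sym_pos_def B1" and B2: "sym_pos_def B2"
  defines "T \<equiv> \<lambda>t x. ((1 - t) *\<^sub>R B1 + t *\<^sub>R B2) *v ((1 - t) *\<^sub>R G1 x + t *\<^sub>R G2 x)"
  defines "\<nu> \<equiv> \<lambda>t. distr \<mu>0 borel (T t)"
  assumes ac0: "absolutely_continuous lborel (\<nu> 0)" and ac1: "absolutely_continuous lborel (\<nu> 1)"
    and t: "0 \<le> t" "t \<le> 1"
  shows "absolutely_continuous lborel (\<nu> t)"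
    and "AE x in \<mu>0. entropy_density (exp 1) std_gaussian (\<nu> t) (T t x) \<le>
      (1 - t) * entropy_density (exp 1) std_gaussian (\<nu> 0) (T 0 x)
      + t * entropy_density (exp 1) std_gaussian (\<nu> 1) (T 1 x)
      + ((norm (T t x))\<^sup>2 / 2 - (1 - t) * ((norm (T 0 x))\<^sup>2 / 2) - t * ((norm (T 1 x))\<^sup>2 / 2))"
proof -
  have G [measurable]: "G1 \<in> borel_measurable borel" "G2 \<in> borel_measurable borel"
    using pot1 pot2 by (auto simp: convex_potential_gradient_def)
  have Tb: "T s \<in> borel_measurable borel" for s
  proof -
    have "((*v) A) \<in> borel_measurable borel" for A :: "real^'n^'n"
      by (intro borel_measurable_continuous_onI linear_continuous_on matrix_vector_mul_bounded_linear)
    moreover have "(\<lambda>x. (1 - s) *\<^sub>R G1 x + s *\<^sub>R G2 x) \<in> borel_measurable borel" by measurable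
    ultimately show ?thesis unfolding T_def by (rule measurable_compose[rotated])
  qed
  have Tm: "T s \<in> borel_measurable \<mu>0" for s using Tb by (simp add: measurable_cong_sets[OF sets refl])
  obtain S1 M1 where S1: "S1 \<in> sets borel" "AE x in \<mu>0. x \<in> S1" and r1: "regular_gradient G1 S1 M1"
    by (rule convex_gradient_regular[OF prob sets ac pot1])
  obtain S2 M2 where S2: "S2 \<in> sets borel" "AE x in \<mu>0. x \<in> S2" and r2: "regular_gradient G2 S2 M2"
    by (rule convex_gradient_regular[OF prob sets ac pot2])
  note r1' = r1[unfolded regular_gradient_def] and r2' = r2[unfolded regular_gradient_def]
  define B where "B s = (1 - s) *\<^sub>R B1 + s *\<^sub>R B2" for s :: real
  define M where "M s x = (1 - s) *\<^sub>R M1 x + s *\<^sub>R M2 x" for s :: real and x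
  have derT: "(T s has_derivative (\<lambda>h. B s *v (M s x *v h))) (at x within S)"
    if x: "x \<in> S" and sub: "S \<subseteq> S1 \<inter> S2" for S s x
  proof -
    have "((\<lambda>y. (1 - s) *\<^sub>R G1 y + s *\<^sub>R G2 y) has_derivative (\<lambda>h. (1 - s) *\<^sub>R (M1 x *v h) + s *\<^sub>R (M2 x *v h))) (at x within S)"
      using x sub by (intro has_derivative_add has_derivative_scaleR_right has_derivative_subset[where s = S1 and t = S] has_derivative_subset[where s = S2 and t = S])
        (use r1' r2' in auto)
    moreover have "(\<lambda>h. (1 - s) *\<^sub>R (M1 x *v h) + s *\<^sub>R (M2 x *v h)) = (\<lambda>h. M s x *v h)"
      by (simp add: fun_eq_iff M_def matrix_vector_mult_add_rdistrib scaleR_matrix_vector_assoc)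
    ultimately have "((\<lambda>y. (1 - s) *\<^sub>R G1 y + s *\<^sub>R G2 y) has_derivative (\<lambda>h. M s x *v h)) (at x within S)" by simp
    from bounded_linear.has_derivative[OF matrix_vector_mul_bounded_linear this, of "B s"]
    show ?thesis by (simp add: T_def B_def)
  qed
  obtain N1 where N1: "N1 \<in> null_sets \<mu>0"
    "\<forall>x\<in>S1 \<inter> S2 - N1. det (matrix (\<lambda>h. B 0 *v (M 0 x *v h))) \<noteq> 0"
    by (rule nonsingular_of_absolutely_continuous_image[OF Tb sets derT[OF _ order_refl] ac0[unfolded \<nu>_def]])
  obtain N2 where N2: "N2 \<in> null_sets \<mu>0"
    "\<forall>x\<in>S1 \<inter> S2 - N2. det (matrix (\<lambda>h. B 1 *v (M 1 x *v h))) \<noteq> 0"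
    by (rule nonsingular_of_absolutely_continuous_image[OF Tb sets derT[OF _ order_refl] ac1[unfolded \<nu>_def]])
  \<comment> \<open>Absolute continuity at \<open>t = 0\<close> and \<open>t = 1\<close> removes the
    points where either Hessian is singular; on \<open>S\<close> both \<open>M1\<close> and
    \<open>M2\<close> are then definite, and so is every convex combination.\<close>
  define S where "S = S1 \<inter> S2 - (N1 \<union> N2)"
  have SS: "S \<subseteq> S1 \<inter> S2" by (auto simp: S_def)
  have "N1 \<in> sets borel" "N2 \<in> sets borel" using null_setsD2[OF N1(1)] null_setsD2[OF N2(1)] by (simp_all only: sets)
  then have S: "S \<in> sets borel" unfolding S_def using S1(1) S2(1) by (intro sets.Diff sets.Int sets.Un)
  have Sae: "AE x in \<mu>0. x \<in> S"
    using S1(2) S2(2) AE_not_in[OF N1(1)] AE_not_in[OF N2(1)] by eventually_elim (simp add: S_def)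
  have M1: "sym_pos_def (M1 x)" and M2: "sym_pos_def (M2 x)" if x: "x \<in> S" for x
  proof -
    have "x \<in> S1 \<inter> S2 - N1" "x \<in> S1 \<inter> S2 - N2" using x by (auto simp: S_def)
    from bspec[OF N1(2) this(1)] bspec[OF N2(2) this(2)] have "det (M1 x) \<noteq> 0" "det (M2 x) \<noteq> 0"
      by (auto simp: matrix_of_mult_mult det_mul M_def)
    then show "sym_pos_def (M1 x)" "sym_pos_def (M2 x)"
      using x SS r1' r2' sym_pos_def_of_semidefinite[of "M1 x"] sym_pos_def_of_semidefinite[of "M2 x"] by auto
  qed
  have Bpd: "sym_pos_def (B s)" and Mpd: "x \<in> S \<Longrightarrow> sym_pos_def (M s x)" if "0 \<le> s" "s \<le> 1" for s x
    unfolding B_def M_def using that B1 B2 M1 M2 by (auto intro: sym_pos_def_convex)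
  have det: "det (matrix (\<lambda>h. B s *v (M s x *v h))) = det (B s) * det (M s x)" for s x
    by (simp add: matrix_of_mult_mult det_mul)
  have detpos: "0 < det (B s) * det (M s x)" if "0 \<le> s" "s \<le> 1" "x \<in> S" for s x
    using sym_pos_def_det_pos[OF Bpd[OF that(1,2)]] sym_pos_def_det_pos[OF Mpd[OF that]] by simp
  \<comment> \<open>Invertibility of \<open>B s\<close> cancels the matrix. The remaining identity,
    tested with \<open>x - y\<close>, is a vanishing sum of two nonnegative terms. Equality in
    monotonicity makes one of the gradients agree at the two points, so \<open>y - x\<close> lies in
    the kernel of a definite Hessian. The case \<open>s = 1\<close> is separate because the first
    gradient then has weight 0.\<close>
  have inj: "inj_on (T s) S" if s: "0 \<le> s" "s \<le> 1" for s
  proof (rule inj_onI)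
    fix x y assume x: "x \<in> S" and y: "y \<in> S" and eq: "T s x = T s y"
    have xs: "x \<in> S1" "x \<in> S2" "y \<in> S1" "y \<in> S2" using x y SS by auto
    have "inj ((*v) (B s))"
      using sym_pos_def_det_pos[OF Bpd[OF s]] by (simp add: invertible_det_nz inj_matrix_vector_mult)
    from injD[OF this eq[unfolded T_def B_def[symmetric]]] have "(1 - s) *\<^sub>R (G1 x - G1 y) + s *\<^sub>R (G2 x - G2 y) = 0" by (simp add: algebra_simps)
    then have "((1 - s) *\<^sub>R (G1 x - G1 y) + s *\<^sub>R (G2 x - G2 y)) \<bullet> (x - y) = 0" by simp
    then have sum: "(1 - s) * ((G1 x - G1 y) \<bullet> (x - y)) + s * ((G2 x - G2 y) \<bullet> (x - y)) = 0"
      by (simp only: inner_add_left inner_scaleR_left)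
    have p1: "0 \<le> (1 - s) * ((G1 x - G1 y) \<bullet> (x - y))" and p2: "0 \<le> s * ((G2 x - G2 y) \<bullet> (x - y))"
      using s r1' r2' xs by simp_all
    have pd: "y - x = 0" if "sym_pos_def Q" "Q *v (y - x) = 0" for Q :: "real^'n^'n"
      using that by (metis inner_zero_right less_irrefl sym_pos_def_def)
    show "x = y"
    proof (cases "s = 1")
      case True
      then have "(G2 x - G2 y) \<bullet> (x - y) = 0" using sum by simp
      with r2' xs have "M2 x *v (y - x) = 0" by blast
      from pd[OF M2[OF x] this] show ?thesis by simp
    next
      case False
      then have "(G1 x - G1 y) \<bullet> (x - y) = 0" using sum p1 p2 s by (simp add: add_nonneg_eq_0_iff)
      with r1' xs have "M1 x *v (y - x) = 0" by blast
      from pd[OF M1[OF x] this] show ?thesis by simp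
    qed
  qed
  have ac\<nu>: "absolutely_continuous lborel (\<nu> s)" if s: "0 \<le> s" "s \<le> 1" for s
    unfolding \<nu>_def
  proof (rule absolutely_continuous_image[OF S Tb derT[OF _ SS] inj[OF s] _ sets ac Sae])
    show "det (matrix (\<lambda>h. B s *v (M s x *v h))) \<noteq> 0" if "x \<in> S" for x
      unfolding det by (rule less_imp_neq[OF detpos[OF s that], symmetric])
  qed
  show "absolutely_continuous lborel (\<nu> t)" by (rule ac\<nu>[OF t])
  let ?g = "RN_deriv lborel \<mu>0"
  have sets\<nu>: "sets (\<nu> s) = sets borel" and prob\<nu>: "prob_space (\<nu> s)" for s
    unfolding \<nu>_def by (simp_all add: prob_space.prob_space_distr[OF prob Tm])
  have d0: "density lborel ?g = \<mu>0" by (rule density_RN_deriv_lborel[OF ac sets])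
  have ae0: "AE x in \<mu>0. 0 < ?g x \<and> ?g x < \<infinity>" by (rule RN_deriv_AE_pos_finite[OF prob ac sets])
  \<comment> \<open>The logarithm of the Jacobian equation: the density of \<open>\<nu> s\<close> at
    \<open>T s x\<close>, times \<open>det (B s) * det (M s x)\<close>, is the density of
    \<open>\<mu>0\<close> at \<open>x\<close>.\<close>
  have formula: "AE x in \<mu>0. entropy_density (exp 1) std_gaussian (\<nu> s) (T s x) =
      ln (enn2real (?g x)) - ln (det (B s)) - ln (det (M s x)) + (norm (T s x))\<^sup>2 / 2 + real CARD('n) / 2 * ln (2 * pi)"
    if s: "0 \<le> s" "s \<le> 1" for s
  proof -
    let ?f = "RN_deriv lborel (\<nu> s)"
    have e: "AE x in \<mu>0. entropy_density (exp 1) std_gaussian (\<nu> s) (T s x) =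
        ln (enn2real (?f (T s x))) + (norm (T s x))\<^sup>2 / 2 + real CARD('n) / 2 * ln (2 * pi)"
      using entropy_density_std_gaussian[OF prob\<nu> ac\<nu>[OF s] sets\<nu>] unfolding \<nu>_def
      by (rule AE_distrD[OF Tm])
    have "AE x in lborel. x \<in> S \<longrightarrow> ?f (T s x) * ennreal \<bar>det (matrix (\<lambda>h. B s *v (M s x *v h)))\<bar> = ?g x"
    proof (rule jacobian_equation[OF S Tb derT[OF _ SS] inj[OF s]])
      show "AE x in density lborel ?g. x \<in> S" using Sae by (simp only: d0)
      show "distr (density lborel ?g) borel (T s) = density lborel ?f"
        using density_RN_deriv_lborel[OF ac\<nu>[OF s] sets\<nu>] by (simp only: d0 \<nu>_def)
    qed (use borel_measurable_RN_deriv[of lborel] in simp_all)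
    then have "AE x in \<mu>0. x \<in> S \<longrightarrow> ?f (T s x) * ennreal \<bar>det (matrix (\<lambda>h. B s *v (M s x *v h)))\<bar> = ?g x"
      by (rule absolutely_continuous_AE[OF _ ac, rotated]) (simp add: sets)
    with e ae0 Sae show ?thesis
    proof eventually_elim
      case (elim x)
      define \<delta> where "\<delta> = det (B s) * det (M s x)"
      have \<delta>: "\<delta> > 0" unfolding \<delta>_def by (rule detpos[OF s]) (use elim in simp)
      have j: "?f (T s x) * ennreal \<delta> = ?g x" using elim \<delta> by (simp add: det \<delta>_def[symmetric])
      have "enn2real (?g x) = enn2real (?f (T s x)) * \<delta>"
        using \<delta> by (simp add: j[symmetric] enn2real_mult)
      moreover have "enn2real (?g x) > 0" using elim by (simp add: enn2real_positive_iff)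
      ultimately have "enn2real (?f (T s x)) > 0" and eqf: "enn2real (?g x) = enn2real (?f (T s x)) * \<delta>"
        using \<delta> by (simp_all add: zero_less_mult_iff)
      then have "ln (enn2real (?g x)) = ln (enn2real (?f (T s x))) + ln \<delta>"
        using \<delta> by (simp add: ln_mult)
      also have "ln \<delta> = ln (det (B s)) + ln (det (M s x))"
      proof -
        have "x \<in> S" using elim by simp
        from sym_pos_def_det_pos[OF Bpd[OF s]] sym_pos_def_det_pos[OF Mpd[OF s this]]
        show ?thesis unfolding \<delta>_def by (rule ln_mult_pos)
      qed
      finally show ?case using elim by simp
    qed
  qed
  show "AE x in \<mu>0. entropy_density (exp 1) std_gaussian (\<nu> t) (T t x) \<le>
      (1 - t) * entropy_density (exp 1) std_gaussian (\<nu> 0) (T 0 x)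
      + t * entropy_density (exp 1) std_gaussian (\<nu> 1) (T 1 x)
      + ((norm (T t x))\<^sup>2 / 2 - (1 - t) * ((norm (T 0 x))\<^sup>2 / 2) - t * ((norm (T 1 x))\<^sup>2 / 2))"
  proof -
    have f0: "AE x in \<mu>0. entropy_density (exp 1) std_gaussian (\<nu> 0) (T 0 x) =
      ln (enn2real (?g x)) - ln (det B1) - ln (det (M1 x)) + (norm (T 0 x))\<^sup>2 / 2 + real CARD('n) / 2 * ln (2 * pi)"
      using formula[of 0] by (simp add: B_def M_def)
    have f1: "AE x in \<mu>0. entropy_density (exp 1) std_gaussian (\<nu> 1) (T 1 x) =
      ln (enn2real (?g x)) - ln (det B2) - ln (det (M2 x)) + (norm (T 1 x))\<^sup>2 / 2 + real CARD('n) / 2 * ln (2 * pi)"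
      using formula[of 1] by (simp add: B_def M_def)
    from f0 f1 formula[OF t] Sae show ?thesis
    proof eventually_elim
      case (elim x)
      have "(1 - t) * ln (det B1) + t * ln (det B2) \<le> ln (det (B t))"
        unfolding B_def by (rule ln_det_concave[OF B1 B2 t])
      moreover have "(1 - t) * ln (det (M1 x)) + t * ln (det (M2 x)) \<le> ln (det (M t x))"
        unfolding M_def by (rule ln_det_concave[OF M1 M2 t]) (use elim in simp_all)
      \<comment> \<open>\<open>a\<close> is the log-density of \<open>\<mu>0\<close> at the point
        and \<open>c\<close> the Gaussian constant; both cancel since the weights add up to
        1.\<close>
      moreover have "a - bt - mt + k + c \<le> (1 - t) * (a - b - m + n + c) + t * (a - b' - m' + n' + c)
          + (k - (1 - t) * n - t * n')"
        if "(1 - t) * b + t * b' \<le> bt" "(1 - t) * m + t * m' \<le> mt" for a b b' bt m m' mt n n' k c :: real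
        using that by (simp add: algebra_simps)
      ultimately show ?case unfolding elim(1,2,3) by blast
    qed
  qed
qed

section \<open>The entropy inequality\<close>

lemma matrix_inv_unique:
  fixes A X :: "real^'n^'n"
  assumes "X ** A = mat 1"
  shows "matrix_inv A = X"
proof -
  have AX: "A ** X = mat 1" using assms by (simp add: matrix_left_right_inverse)
  then have "invertible A" using assms by (auto simp: invertible_def)
  then have "matrix_inv A ** A = mat 1" by (rule matrix_inv_cancel)
  then have "(matrix_inv A ** A) ** X = X" by simp
  then show ?thesis using AX by (simp add: matrix_mul_assoc[symmetric])
qed

lemma sym_pos_def_invertible:
  fixes A :: "real^'n^'n"
  assumes "sym_pos_def A"
  shows "invertible A"
  using sym_pos_def_det_pos[OF assms] by (simp add: invertible_det_nz)

lemma matrix_inv_scaleR: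
  fixes A :: "real^'n^'n"
  assumes "invertible A" "c \<noteq> 0"
  shows "matrix_inv (c *\<^sub>R A) = (1 / c) *\<^sub>R matrix_inv A"
proof (rule matrix_inv_unique)
  show "(1 / c) *\<^sub>R matrix_inv A ** (c *\<^sub>R A) = mat 1"
    using matrix_inv_cancel(2)[OF assms(1)] assms(2)
    by (simp add: scalar_matrix_assoc[symmetric] matrix_scalar_ac)
qed

lemma sym_pos_def_matrix_inv:
  fixes A :: "real^'n^'n"
  assumes "sym_pos_def A"
  shows "sym_pos_def (matrix_inv A)"
  unfolding sym_pos_def_def
proof (intro conjI allI impI)
  have inv: "invertible A" by (rule sym_pos_def_invertible[OF assms])
  have sym: "transpose A = A" using assms by (simp add: sym_pos_def_def)
  have "transpose (matrix_inv A) ** A = transpose (A ** matrix_inv A)"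
    by (simp add: matrix_transpose_mul sym)
  also have "\<dots> = mat 1" by (simp add: matrix_inv_cancel[OF inv])
  finally show "transpose (matrix_inv A) = matrix_inv A" by (rule matrix_inv_unique[symmetric])
  fix v :: "real^'n" assume v: "v \<noteq> 0"
  define w where "w = matrix_inv A *v v"
  have Aw: "A *v w = v" by (simp add: w_def matrix_vector_mul_assoc matrix_inv_cancel[OF inv])
  then have "w \<noteq> 0" using v by auto
  then have "0 < w \<bullet> (A *v w)" using assms by (simp add: sym_pos_def_def)
  then have "0 < v \<bullet> w" by (simp only: Aw inner_commute)
  then show "0 < v \<bullet> (matrix_inv A *v v)" by (simp only: w_def)
qed

lemma sym_pos_def_scaleR:
  fixes A :: "real^'n^'n"
  assumes "sym_pos_def A" "c > 0"
  shows "sym_pos_def (c *\<^sub>R A)"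
  using assms by (auto simp: sym_pos_def_def transpose_def vec_eq_iff scaleR_matrix_vector_assoc[symmetric])

text \<open>The Rayleigh bound at \<open>w = matrix_inv A *v v\<close> gives
  \<open>1 / k * (norm w)\<^sup>2 \<le> w \<bullet> v\<close>, and Cauchy-Schwarz removes one factor
  \<open>norm w\<close>.\<close>

lemma norm_matrix_inv_le:
  fixes A :: "real^'n^'n"
  assumes A: "sym_pos_def A" and k: "k > 0" "1 / k \<le> lambda_min A"
  shows "norm (matrix_inv A *v v) \<le> k * norm v"
proof -
  have sym: "transpose A = A" using A by (simp add: sym_pos_def_def)
  define w where "w = matrix_inv A *v v"
  have Aw: "A *v w = v"
    by (simp add: w_def matrix_vector_mul_assoc matrix_inv_cancel[OF sym_pos_def_invertible[OF A]])
  have "1 / k * (norm w)\<^sup>2 \<le> lambda_min A * (norm w)\<^sup>2" using k(2) by (rule mult_right_mono) simp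
  also have "\<dots> \<le> w \<bullet> (A *v w)" by (rule lambda_min_rayleigh(2)[OF sym])
  also have "\<dots> \<le> norm w * norm v" unfolding Aw by (rule norm_cauchy_schwarz)
  finally have "norm w * norm w \<le> norm w * (k * norm v)" using k(1) by (simp add: field_simps power2_eq_square)
  then have "norm w \<le> k * norm v" using k(1) by (cases "w = 0") auto
  then show ?thesis by (simp add: w_def)
qed

section \<open>Couplings as joint laws\<close>

lemma (in prob_space) igw_cost_distr:
  fixes f g :: "'a \<Rightarrow> real^'n"
  assumes [measurable]: "f \<in> borel_measurable M" "g \<in> borel_measurable M"
  shows "igw_cost (distr M borel (\<lambda>w. (f w, g w))) = gram_cost f g"
proof -
  let ?F = "\<lambda>w. (f w, g w)"
  have F [measurable]: "?F \<in> M \<rightarrow>\<^sub>M (borel :: ((real^'n) \<times> (real^'n)) measure)"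
    by (rule borel_measurable_Pair) measurable
  have sf: "sigma_finite_measure (distr M borel ?F)"
    by (rule prob_space_imp_sigma_finite[OF prob_space_distr[OF F]])
  have c [measurable]: "fst \<in> borel_measurable (borel :: ((real^'n) \<times> (real^'n)) measure)"
    "snd \<in> borel_measurable (borel :: ((real^'n) \<times> (real^'n)) measure)"
    by (auto intro!: borel_measurable_continuous_onI continuous_intros)
  have "igw_cost (distr M borel ?F) = (\<integral>p. \<bar>fst (fst p) \<bullet> fst (snd p) - snd (fst p) \<bullet> snd (snd p)\<bar>\<^sup>2
      \<partial>(distr M borel ?F \<Otimes>\<^sub>M distr M borel ?F))"
    unfolding igw_cost_def by (simp add: case_prod_unfold)
  also have "distr M borel ?F \<Otimes>\<^sub>M distr M borel ?F =
      distr (M \<Otimes>\<^sub>M M) (borel \<Otimes>\<^sub>M borel) (\<lambda>(x, y). (?F x, ?F y))"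
    by (rule pair_measure_distr[OF F F sf])
  also have "(\<integral>p. \<bar>fst (fst p) \<bullet> fst (snd p) - snd (fst p) \<bullet> snd (snd p)\<bar>\<^sup>2
      \<partial>distr (M \<Otimes>\<^sub>M M) (borel \<Otimes>\<^sub>M borel) (\<lambda>(x, y). (?F x, ?F y))) = gram_cost f g"
    unfolding gram_cost_def
    by (subst integral_distr) (measurable, simp add: case_prod_beta)
  finally show ?thesis .
qed

text \<open>The entropy inequality involves \<open>IGW \<mu>1 \<mu>0\<close>, while the optimal
  coupling runs from \<open>\<mu>0\<close> to \<open>\<mu>1\<close>; exchanging the coordinates
  reconciles the two infima.\<close>

lemma coupling_swap:
  fixes \<mu> \<nu> :: "(real^'n) measure"
  assumes \<pi>: "\<pi> \<in> couplings \<mu> \<nu>" and \<mu>: "prob_space \<mu>"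
  shows "distr \<pi> borel prod.swap \<in> couplings \<nu> \<mu>" and "igw_cost (distr \<pi> borel prod.swap) = igw_cost \<pi>"
proof -
  have s: "sets \<pi> = sets borel" and f: "distr \<pi> borel fst = \<mu>" and g: "distr \<pi> borel snd = \<nu>"
    using \<pi> by (auto simp: couplings_def)
  have cb: "fst \<in> borel_measurable (borel :: ((real^'n) \<times> (real^'n)) measure)"
    "snd \<in> borel_measurable (borel :: ((real^'n) \<times> (real^'n)) measure)"
    "prod.swap \<in> (borel :: ((real^'n) \<times> (real^'n)) measure) \<rightarrow>\<^sub>M borel"
    by (auto intro!: borel_measurable_continuous_onI continuous_intros simp: prod.swap_def[abs_def])
  then have c: "fst \<in> borel_measurable \<pi>" "snd \<in> borel_measurable \<pi>" "prod.swap \<in> \<pi> \<rightarrow>\<^sub>M borel"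
    by (simp_all add: measurable_cong_sets[OF s refl])
  interpret prob_space \<pi>
    by (rule prob_space_distrD[OF c(1)]) (simp add: f \<mu>)
  have 1: "distr \<pi> borel (\<lambda>w. (fst w, snd w)) = \<pi>" using distr_id2[OF s[symmetric]] by simp
  have 2: "distr \<pi> borel (\<lambda>w. (snd w, fst w)) = distr \<pi> borel prod.swap" by (simp add: prod.swap_def[abs_def])
  show "distr \<pi> borel prod.swap \<in> couplings \<nu> \<mu>"
    unfolding couplings_def using f g by (auto simp: distr_distr[OF cb(1) c(3)] distr_distr[OF cb(2) c(3)] comp_def)
  show "igw_cost (distr \<pi> borel prod.swap) = igw_cost \<pi>"
    using igw_cost_distr[OF c(1,2)] igw_cost_distr[OF c(2,1)] unfolding 1 2
    by (simp add: gram_cost_def power2_commute)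
qed

lemma optimal_cost_le_IGW:
  fixes \<mu> \<nu> :: "(real^'n) measure"
  assumes opt: "optimal_igw_coupling \<pi> \<mu> \<nu>" and \<mu>: "prob_space \<mu>" and \<nu>: "prob_space \<nu>"
    and nonneg: "0 \<le> igw_cost \<pi>"
  shows "igw_cost \<pi> \<le> (IGW \<nu> \<mu>)\<^sup>2"
proof -
  have \<pi>: "\<pi> \<in> couplings \<mu> \<nu>" and min: "\<And>\<pi>'. \<pi>' \<in> couplings \<mu> \<nu> \<Longrightarrow> igw_cost \<pi> \<le> igw_cost \<pi>'"
    using opt by (auto simp: optimal_igw_coupling_def)
  have "igw_cost \<pi> \<le> (INF \<pi>'\<in>couplings \<nu> \<mu>. igw_cost \<pi>')"
  proof (rule cINF_greatest)
    show "couplings \<nu> \<mu> \<noteq> {}" using coupling_swap(1)[OF \<pi> \<mu>] by blast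
    fix \<pi>' assume "\<pi>' \<in> couplings \<nu> \<mu>"
    from min[OF coupling_swap(1)[OF this \<nu>]] coupling_swap(2)[OF this \<nu>]
    show "igw_cost \<pi> \<le> igw_cost \<pi>'" by simp
  qed
  then show ?thesis using nonneg by (simp add: IGW_def)
qed

text \<open>A vanishing value of the quadratic form at \<open>v\<close> would concentrate
  \<open>\<mu>\<close> on the hyperplane orthogonal to \<open>v\<close>, which absolute continuity
  forbids.\<close>

lemma second_moment_matrix_pos_def:
  fixes \<mu> :: "(real^'n) measure"
  assumes prob: "prob_space \<mu>" and sets: "sets \<mu> = sets borel" and ac: "absolutely_continuous lborel \<mu>"
    and sq: "sq_integrable \<mu> (\<lambda>x. x)"
  shows "sym_pos_def (second_moment_matrix \<mu>)"
  unfolding sym_pos_def_def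
proof (intro conjI allI impI)
  show "transpose (second_moment_matrix \<mu>) = second_moment_matrix \<mu>"
    by (simp add: second_moment_matrix_def transpose_def vec_eq_iff mult.commute)
  fix v :: "real^'n" assume v: "v \<noteq> 0"
  have eq: "v \<bullet> (second_moment_matrix \<mu> *v v) = (\<integral>x. (v \<bullet> x)\<^sup>2 \<partial>\<mu>)"
    using integral_inner_mult[OF sq sq, of v v] by (simp add: second_moment_matrix_def power2_eq_square)
  have int: "integrable \<mu> (\<lambda>x. (v \<bullet> x)\<^sup>2)"
    using sq_integrable_linear[OF sq bounded_linear_inner_right, of v] by (simp add: sq_integrable_def)
  have "(\<integral>x. (v \<bullet> x)\<^sup>2 \<partial>\<mu>) \<noteq> 0"
  proof
    assume "(\<integral>x. (v \<bullet> x)\<^sup>2 \<partial>\<mu>) = 0"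
    then have 1: "AE x in \<mu>. (v \<bullet> x)\<^sup>2 = 0" using integral_nonneg_eq_0_iff_AE[OF int] by simp
    have "negligible {x. v \<bullet> x = 0}" using v by (intro negligible_hyperplane) simp
    then have "AE x in lebesgue. x \<notin> {x. v \<bullet> x = 0}"
      by (intro AE_not_in) (simp add: negligible_iff_null_sets)
    then have "AE x in lborel. v \<bullet> x \<noteq> 0" by (simp add: AE_completion_iff)
    then have "AE x in \<mu>. v \<bullet> x \<noteq> 0" by (rule absolutely_continuous_AE[OF _ ac, rotated]) (simp add: sets)
    with 1 have "AE x in \<mu>. False" by eventually_elim simp
    then show False using prob_space.AE_False[OF prob] by simp
  qed
  then show "0 < v \<bullet> (second_moment_matrix \<mu> *v v)"
    unfolding eq by (simp add: less_le)
qed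

text \<open>In powers of \<open>t\<close> the vector is \<open>y + t a + t\<^sup>2 w\<close>, so
  half its squared norm has derivative \<open>y \<bullet> a\<close> at 0. All terms of higher order
  are absorbed into one multiple of \<open>t\<^sup>2\<close> by \<open>t \<le> 1\<close> and by
  bounding twice an inner product by the sum of the squared norms; this accounts for the
  coefficients 1, 2 and 3.\<close>

lemma quadratic_expansion_bound:
  fixes y z q :: "'a::real_inner" and t :: real
  assumes t: "0 \<le> t" "t \<le> 1"
  defines "a \<equiv> q - 2 *\<^sub>R y" and "w \<equiv> y - q + z"
  shows "(norm ((1 - t)\<^sup>2 *\<^sub>R y + (t * (1 - t)) *\<^sub>R q + t\<^sup>2 *\<^sub>R z))\<^sup>2 / 2 - (1 - t) * ((norm y)\<^sup>2 / 2) - t * ((norm z)\<^sup>2 / 2)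
    \<le> t * (y \<bullet> a - (norm z)\<^sup>2 / 2 + (norm y)\<^sup>2 / 2) + t\<^sup>2 * (((norm y)\<^sup>2 + 2 * (norm a)\<^sup>2 + 3 * (norm w)\<^sup>2) / 2)"
proof -
  have e: "(1 - t)\<^sup>2 *\<^sub>R y + (t * (1 - t)) *\<^sub>R q + t\<^sup>2 *\<^sub>R z = y + t *\<^sub>R a + t\<^sup>2 *\<^sub>R w"
    by (simp add: a_def w_def algebra_simps power2_eq_square)
  have n: "(norm (y + t *\<^sub>R a + t\<^sup>2 *\<^sub>R w))\<^sup>2 =
      (norm y)\<^sup>2 + 2 * t * (y \<bullet> a) + t\<^sup>2 * ((norm a)\<^sup>2 + 2 * (y \<bullet> w) + 2 * (t * (a \<bullet> w)) + t\<^sup>2 * (norm w)\<^sup>2)"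
    unfolding power2_norm_eq_inner
    by (simp add: inner_simps inner_commute[of a y] inner_commute[of w y] inner_commute[of w a] power2_eq_square algebra_simps)
  have yw: "2 * (u \<bullet> v) \<le> (norm u)\<^sup>2 + (norm v)\<^sup>2" for u v :: 'a
    using zero_le_power2[of "norm (u - v)"] by (simp add: power2_norm_eq_inner inner_simps inner_commute)
  have "t * (2 * (a \<bullet> w)) \<le> t * ((norm a)\<^sup>2 + (norm w)\<^sup>2)" using t yw by (intro mult_left_mono) auto
  also have "\<dots> \<le> 1 * ((norm a)\<^sup>2 + (norm w)\<^sup>2)" using t by (intro mult_right_mono) auto
  finally have 1: "2 * (t * (a \<bullet> w)) \<le> (norm a)\<^sup>2 + (norm w)\<^sup>2" by simp
  have "t\<^sup>2 \<le> 1" using t by (simp add: power_le_one)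
  then have 2: "t\<^sup>2 * (norm w)\<^sup>2 \<le> (norm w)\<^sup>2" by (simp add: mult_left_le_one_le)
  have "(norm a)\<^sup>2 + 2 * (y \<bullet> w) + 2 * (t * (a \<bullet> w)) + t\<^sup>2 * (norm w)\<^sup>2 \<le> (norm y)\<^sup>2 + 2 * (norm a)\<^sup>2 + 3 * (norm w)\<^sup>2"
    using 1 2 yw[of y w] by linarith
  then have "t\<^sup>2 * ((norm a)\<^sup>2 + 2 * (y \<bullet> w) + 2 * (t * (a \<bullet> w)) + t\<^sup>2 * (norm w)\<^sup>2)
      \<le> t\<^sup>2 * ((norm y)\<^sup>2 + 2 * (norm a)\<^sup>2 + 3 * (norm w)\<^sup>2)"
    by (rule mult_left_mono) simp
  then show ?thesis unfolding e n by (simp add: field_simps)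
qed

theorem lemma3p1:
  fixes \<mu>0 \<mu>1 \<mu>2 :: "(real^'n) measure"
    and \<pi>01 \<pi>02 \<pi>12 :: "((real^'n) \<times> (real^'n)) measure"
    and \<pi> :: "((real^'n) \<times> (real^'n) \<times> (real^'n)) measure"
    and A1 A2 :: "real^'n^'n"
    and \<Omega>1 \<Omega>2 :: "(real^'n) set"
    and \<phi>1 \<phi>2 :: "real^'n \<Rightarrow> real"
    and G1 G2 :: "real^'n \<Rightarrow> real^'n"
    and \<nu> :: "real \<Rightarrow> (real^'n) measure"
    and c1 c2 \<beta> :: real
  assumes "\<mu>0 \<in> P2ac" and "\<mu>1 \<in> P2ac" and "\<mu>2 \<in> P2ac"
    and "optimal_igw_coupling \<pi>01 \<mu>0 \<mu>1"
    and "optimal_igw_coupling \<pi>02 \<mu>0 \<mu>2"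
    and "A1 = (1/2) *\<^sub>R cross_moment_matrix \<pi>01"
    and "A2 = (1/2) *\<^sub>R cross_moment_matrix \<pi>02"
    and "sym_pos_def A1" and "sym_pos_def A2"
    and "convex_potential_gradient \<mu>0 \<Omega>1 \<phi>1 G1"
    and "convex_potential_gradient \<mu>0 \<Omega>2 \<phi>2 G2"
    and "distr \<mu>0 borel (\<lambda>x. (x, gm_map A1 G1 x)) = \<pi>01"
    and "distr \<mu>0 borel (\<lambda>x. (x, gm_map A2 G2 x)) = \<pi>02"
    and "\<nu> = mod_igw_geodesic \<mu>0 A1 G1 A2 G2"
    and "\<pi> = distr \<mu>0 borel (\<lambda>x. (x, gm_map A1 G1 x, gm_map A2 G2 x))"
    and "\<pi>12 = distr \<pi> borel (\<lambda>(x, y, z). (y, z))"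
    and "c1 = lambda_min (second_moment_matrix \<mu>0)"
    and "c2 > 0"
    and "1 / c2 \<le> lambda_min A1" and "lambda_max A1 \<le> c2"
    and "1 / c2 \<le> lambda_min A2" and "lambda_max A2 \<le> c2"
    and "\<beta> = c2 / 2 * sqrt (second_moment \<mu>0) * sqrt (second_moment \<mu>1)
              + c2 ^ 4 / 4 * second_moment \<mu>0 * second_moment \<mu>1"
  shows "c1 > 0 \<and>
    (\<exists>g :: real \<Rightarrow> real. g \<in> O[at_right 0](\<lambda>t. t\<^sup>2) \<and>
      (\<forall>t\<in>{0..1}.
         rel_entropy (\<nu> t) std_gaussian
           \<le> ereal (1 - t) * rel_entropy \<mu>1 std_gaussian + ereal t * rel_entropy \<mu>2 std_gaussian
             + ereal (t * (8 * sqrt 2 / c1) * \<beta> *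
                 (\<integral>((y, z), (y', z')). \<bar>y \<bullet> y' - z \<bullet> z'\<bar>\<^sup>2 \<partial>(\<pi>12 \<Otimes>\<^sub>M \<pi>12)))
             + ereal (t * (12 * sqrt 2 / c1) * \<beta> * (IGW \<mu>1 \<mu>0)\<^sup>2)
             + ereal (g t)))"
proof -
  note P = assms(1-3)[unfolded P2ac_def mem_Collect_eq]
  have prob: "prob_space \<mu>0" "prob_space \<mu>1" and sets0: "sets \<mu>0 = sets borel"
    and ac: "absolutely_continuous lborel \<mu>0" "absolutely_continuous lborel \<mu>1" "absolutely_continuous lborel \<mu>2"
    and m: "integrable \<mu>0 (\<lambda>x. (norm x)\<^sup>2)" "integrable \<mu>1 (\<lambda>x. (norm x)\<^sup>2)" "integrable \<mu>2 (\<lambda>x. (norm x)\<^sup>2)"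
    using P by simp_all
  note A1 = assms(8) and A2 = assms(9) and pot1 = assms(10) and pot2 = assms(11)
  interpret prob_space \<mu>0 by (rule prob(1))
  define V1 where "V1 = matrix_inv A1"
  define V2 where "V2 = matrix_inv A2"
  define B1 where "B1 = matrix_inv (8 *\<^sub>R A1)"
  define B2 where "B2 = matrix_inv (8 *\<^sub>R A2)"
  have inv: "invertible A1" "invertible A2" using A1 A2 by (auto intro: sym_pos_def_invertible)
  have BV: "B1 = (1 / 8) *\<^sub>R V1" "B2 = (1 / 8) *\<^sub>R V2"
    unfolding B1_def B2_def V1_def V2_def using inv by (simp_all add: matrix_inv_scaleR)
  have B: "sym_pos_def B1" "sym_pos_def B2"
    using sym_pos_def_matrix_inv[OF sym_pos_def_scaleR[OF A1, of 8]]
      sym_pos_def_matrix_inv[OF sym_pos_def_scaleR[OF A2, of 8]]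
    by (simp_all add: B1_def B2_def)
  \<comment> \<open>\<open>Y\<close> and \<open>Z\<close> are the two Gromov-Monge maps, read as
    random vectors on \<open>\<mu>0\<close>; the measures and couplings of the statement become laws
    of the identity, \<open>Y\<close> and \<open>Z\<close>.\<close>
  define Y where "Y = gm_map A1 G1"
  define Z where "Z = gm_map A2 G2"
  have Ye: "Y x = B1 *v G1 x" and Ze: "Z x = B2 *v G2 x" for x
    by (simp_all add: Y_def Z_def gm_map_def B1_def B2_def)
  have Gb: "G1 \<in> borel_measurable borel" "G2 \<in> borel_measurable borel"
    using pot1 pot2 by (auto simp: convex_potential_gradient_def)
  have matb: "((*v) Q) \<in> borel_measurable borel" for Q :: "real^'n^'n"
    by (intro borel_measurable_continuous_onI linear_continuous_on matrix_vector_mul_bounded_linear)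
  have YZb: "Y \<in> borel_measurable borel" "Z \<in> borel_measurable borel"
    using measurable_compose[OF Gb(1) matb[of B1]] measurable_compose[OF Gb(2) matb[of B2]]
    by (simp_all add: Ye[abs_def] Ze[abs_def])
  have YZm: "Y \<in> borel_measurable \<mu>0" "Z \<in> borel_measurable \<mu>0" and idm: "(\<lambda>x. x) \<in> borel_measurable \<mu>0"
    using YZb by (simp_all add: measurable_cong_sets[OF sets0 refl])
  have pairm: "(\<lambda>x. (x, Y x)) \<in> \<mu>0 \<rightarrow>\<^sub>M borel" "(\<lambda>x. (x, Z x)) \<in> \<mu>0 \<rightarrow>\<^sub>M borel"
    using YZm idm by (auto intro: borel_measurable_Pair)
  have fsb: "fst \<in> borel_measurable (borel :: ((real^'n) \<times> (real^'n)) measure)"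
    "snd \<in> borel_measurable (borel :: ((real^'n) \<times> (real^'n)) measure)"
    by (auto intro!: borel_measurable_continuous_onI continuous_intros)
  have \<pi>01: "\<pi>01 = distr \<mu>0 borel (\<lambda>x. (x, Y x))" and \<pi>02: "\<pi>02 = distr \<mu>0 borel (\<lambda>x. (x, Z x))"
    using assms(12,13) by (simp_all add: Y_def Z_def)
  have c01: "\<pi>01 \<in> couplings \<mu>0 \<mu>1" and c02: "\<pi>02 \<in> couplings \<mu>0 \<mu>2"
    using assms(4,5) by (auto simp: optimal_igw_coupling_def)
  have \<mu>1: "\<mu>1 = distr \<mu>0 borel Y" and \<mu>2: "\<mu>2 = distr \<mu>0 borel Z"
    using c01 c02 unfolding couplings_def \<pi>01 \<pi>02
    by (simp_all add: distr_distr[OF fsb(2)] pairm comp_def)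
  have X: "sq_integrable \<mu>0 (\<lambda>x. x)" using m(1) idm by (simp add: sq_integrable_def)
  have n2b: "(\<lambda>y :: real^'n. (norm y)\<^sup>2) \<in> borel_measurable borel" by measurable
  have Y: "sq_integrable \<mu>0 Y" and Z: "sq_integrable \<mu>0 Z"
    using m(2,3) YZm unfolding \<mu>1 \<mu>2 sq_integrable_def
    by (simp_all add: integrable_distr_eq[OF _ n2b])
  have M0: "second_moment \<mu>0 = (\<integral>x. (norm x)\<^sup>2 \<partial>\<mu>0)" by (simp add: second_moment_def)
  have M1: "second_moment \<mu>1 = (\<integral>x. (norm (Y x))\<^sup>2 \<partial>\<mu>0)"
    unfolding second_moment_def \<mu>1 by (rule integral_distr[OF YZm(1) n2b])
  have cm: "(\<lambda>p :: (real^'n) \<times> (real^'n). fst p $ i * snd p $ j) \<in> borel_measurable borel" for i j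
    by (intro borel_measurable_continuous_onI continuous_intros)
  have A1e: "A1 $ i $ j = 1 / 2 * (\<integral>x. x $ i * Y x $ j \<partial>\<mu>0)" for i j
    unfolding assms(6) cross_moment_matrix_def \<pi>01 case_prod_unfold
    by (simp add: integral_distr[OF pairm(1) cm])
  have A2e: "A2 $ i $ j = 1 / 2 * (\<integral>x. x $ i * Z x $ j \<partial>\<mu>0)" for i j
    unfolding assms(7) cross_moment_matrix_def \<pi>02 case_prod_unfold
    by (simp add: integral_distr[OF pairm(2) cm])
  have cost01: "igw_cost \<pi>01 = gram_cost (\<lambda>x. x) Y"
    unfolding \<pi>01 by (rule igw_cost_distr[OF idm YZm(1)])
  have cost12: "igw_cost \<pi>12 = gram_cost Y Z"
  proof -
    have tm: "(\<lambda>x. (x, Y x, Z x)) \<in> \<mu>0 \<rightarrow>\<^sub>M borel"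
      by (intro borel_measurable_Pair idm YZm)
    have sb: "(snd :: (real^'n) \<times> (real^'n) \<times> (real^'n) \<Rightarrow> _) \<in> borel \<rightarrow>\<^sub>M borel"
      by (auto intro!: borel_measurable_continuous_onI continuous_intros)
    have "(\<lambda>(x, y, z). (y, z)) = (snd :: (real^'n) \<times> (real^'n) \<times> (real^'n) \<Rightarrow> _)" by auto
    then have "\<pi>12 = distr \<mu>0 borel (\<lambda>x. (Y x, Z x))"
      unfolding assms(16) assms(15) Y_def[symmetric] Z_def[symmetric]
      by (simp add: distr_distr[OF sb tm] comp_def)
    then show ?thesis using igw_cost_distr[OF YZm] by simp
  qed
  have \<Sigma>: "sym_pos_def (second_moment_matrix \<mu>0)"
    by (rule second_moment_matrix_pos_def[OF prob(1) sets0 ac(1) X])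
  then have c1: "c1 > 0" unfolding assms(17) by (rule lambda_min_pos)
  have c1b: "c1 * (norm v)\<^sup>2 \<le> (\<integral>x. (v \<bullet> x)\<^sup>2 \<partial>\<mu>0)" for v
  proof -
    have "(\<integral>x. (v \<bullet> x)\<^sup>2 \<partial>\<mu>0) = v \<bullet> (second_moment_matrix \<mu>0 *v v)"
      using integral_inner_mult[OF X X, of v v] by (simp add: second_moment_matrix_def power2_eq_square)
    then show ?thesis
      using lambda_min_rayleigh(2)[of "second_moment_matrix \<mu>0" v] \<Sigma>
      by (simp add: assms(17) sym_pos_def_def)
  qed
  \<comment> \<open>Symmetry and definiteness of \<open>A\<close>, half the cross moment matrix, are
    the conditions under which the distortion controls the squared distance.\<close>
  have low: "c1 / 2 * (\<integral>x. (norm (x - U x))\<^sup>2 \<partial>\<mu>0) \<le> gram_cost (\<lambda>x. x) U"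
    if U: "sq_integrable \<mu>0 U" and A: "sym_pos_def A"
      and Ae: "\<And>i j. A $ i $ j = 1 / 2 * (\<integral>x. x $ i * U x $ j \<partial>\<mu>0)" for U A
  proof (rule gram_cost_lower_bound[OF X U _ _ c1b])
    show "(\<integral>x. x $ i * U x $ j \<partial>\<mu>0) = (\<integral>x. x $ j * U x $ i \<partial>\<mu>0)" for i j
    proof -
      have "transpose A $ i $ j = A $ i $ j" using A by (simp add: sym_pos_def_def)
      then show ?thesis using Ae[of i j] Ae[of j i] by (simp add: transpose_def)
    qed
    show "0 \<le> (\<integral>x. (v \<bullet> x) * (v \<bullet> U x) \<partial>\<mu>0)" for v
    proof -
      have "(\<chi> i j. \<integral>x. x $ i * U x $ j \<partial>\<mu>0) = 2 *\<^sub>R A" by (simp add: vec_eq_iff Ae)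
      then have "(\<integral>x. (v \<bullet> x) * (v \<bullet> U x) \<partial>\<mu>0) = 2 * (v \<bullet> (A *v v))"
        unfolding integral_inner_mult[OF X U] by (simp add: scaleR_matrix_vector_assoc[symmetric])
      also have "\<dots> \<ge> 0" using A by (cases "v = 0") (auto simp: sym_pos_def_def less_imp_le)
      finally show ?thesis .
    qed
  qed
  define E where "E = (\<integral>x. (norm (Z x - Y x))\<^sup>2 \<partial>\<mu>0)"
  have E: "E \<le> (12 * igw_cost \<pi>01 + 8 * igw_cost \<pi>12) / c1"
    unfolding E_def cost01 cost12
    by (rule distance_gram_bound[OF X Y Z c1 low[OF Y A1 A1e] low[OF Z A2 A2e]])
  have IGW: "igw_cost \<pi>01 \<le> (IGW \<mu>1 \<mu>0)\<^sup>2"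
    by (rule optimal_cost_le_IGW[OF assms(4) prob]) (simp add: cost01 gram_cost_nonneg)
  \<comment> \<open>\<open>c2\<close> bounds the spectrum of \<open>A1\<close> above and
    \<open>1 / c2\<close> bounds it below, so \<open>1 / c2 \<le> c2\<close>.\<close>
  have c2: "1 \<le> c2"
  proof -
    have "lambda_min A1 \<le> lambda_max A1" using A1 by (intro lambda_min_le_max) (simp add: sym_pos_def_def)
    with assms(19,20) have "1 / c2 \<le> c2" by linarith
    then have "1\<^sup>2 \<le> c2\<^sup>2" using assms(18) by (simp add: power2_eq_square field_simps)
    then show ?thesis using assms(18) by (simp only: power2_le_imp_le less_imp_le)
  qed
  define q where "q x = V1 *v (A2 *v Z x) + V2 *v (A1 *v Y x)" for x
  define a where "a x = q x - 2 *\<^sub>R Y x" for x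
  define w where "w x = Y x - q x + Z x" for x
  have \<beta>0: "0 \<le> \<beta>"
    unfolding assms(23) using assms(18) by (auto intro!: add_nonneg_nonneg mult_nonneg_nonneg simp: second_moment_def)
  have mixed: "(\<integral>x. Y x \<bullet> a x \<partial>\<mu>0) \<le>
      1 / 2 * (\<integral>x. (norm (Z x))\<^sup>2 \<partial>\<mu>0) - 1 / 2 * (\<integral>x. (norm (Y x))\<^sup>2 \<partial>\<mu>0) + \<beta> * E"
    unfolding a_def E_def
  proof (rule mixed_term_bound[OF X Y Z A1e A2e _ _ _ _ c2 q_def])
    show "V1 ** A1 = mat 1" "V2 ** A2 = mat 1"
      unfolding V1_def V2_def using inv by (simp_all add: matrix_inv_cancel)
    show "norm (V1 *v v) \<le> c2 * norm v" "norm (V2 *v v) \<le> c2 * norm v" for v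
      unfolding V1_def V2_def using A1 A2 assms(18,19,21) by (auto intro: norm_matrix_inv_le)
    show "\<beta> = c2 / 2 * sqrt (\<integral>x. (norm x)\<^sup>2 \<partial>\<mu>0) * sqrt (\<integral>x. (norm (Y x))\<^sup>2 \<partial>\<mu>0)
        + c2 ^ 4 / 4 * (\<integral>x. (norm x)\<^sup>2 \<partial>\<mu>0) * (\<integral>x. (norm (Y x))\<^sup>2 \<partial>\<mu>0)"
      by (simp only: assms(23) M0 M1)
  qed
  have sq: "sq_integrable \<mu>0 a" "sq_integrable \<mu>0 w"
  proof -
    have "sq_integrable \<mu>0 q"
      unfolding q_def by (intro sq_integrable_add sq_integrable_linear[OF _ matrix_vector_mul_bounded_linear] Y Z)
    then show "sq_integrable \<mu>0 a" "sq_integrable \<mu>0 w"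
      unfolding a_def w_def
      by (auto intro!: sq_integrable_add sq_integrable_diff Y Z sq_integrable_linear[OF _ bounded_linear_scaleR_right])
  qed
  define T where "T = (\<lambda>t x. ((1 - t) *\<^sub>R B1 + t *\<^sub>R B2) *v ((1 - t) *\<^sub>R G1 x + t *\<^sub>R G2 x))"
  have Tmod: "mod_geodesic_map A1 G1 A2 G2 t = T t" for t
    by (simp add: fun_eq_iff mod_geodesic_map_def T_def B1_def B2_def)
  have \<nu>T: "\<nu> t = distr \<mu>0 borel (T t)" for t
    unfolding assms(14) mod_igw_geodesic_def Tmod ..
  have T0: "T 0 = Y" and T1: "T 1 = Z" by (simp_all add: fun_eq_iff T_def Ye Ze)
  \<comment> \<open>The gradients are 8 times \<open>A1 *v Y x\<close> and \<open>A2 *v Z x\<close>,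
    so the factor 8 cancels against \<open>B1\<close> and \<open>B2\<close>. Equal indices reproduce
    \<open>Y x\<close> and \<open>Z x\<close>, and the mixed products add up to
    \<open>q x\<close>.\<close>
  have Texp: "T t x = (1 - t)\<^sup>2 *\<^sub>R Y x + (t * (1 - t)) *\<^sub>R q x + t\<^sup>2 *\<^sub>R Z x" for t x
  proof -
    have VA: "V1 *v (A1 *v v) = v" "V2 *v (A2 *v v) = v" "A1 *v (V1 *v v) = v" "A2 *v (V2 *v v) = v" for v
      unfolding V1_def V2_def by (simp_all add: matrix_vector_mul_assoc matrix_inv_cancel inv)
    have G: "G1 x = 8 *\<^sub>R (A1 *v Y x)" "G2 x = 8 *\<^sub>R (A2 *v Z x)"
      unfolding Ye Ze BV by (simp_all add: scaleR_matrix_vector_assoc[symmetric] matrix_vector_mult_scaleR VA)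
    have Bv: "B1 *v v = (1 / 8) *\<^sub>R (V1 *v v)" "B2 *v v = (1 / 8) *\<^sub>R (V2 *v v)" for v
      unfolding BV by (simp_all add: scaleR_matrix_vector_assoc)
    have "T t x = ((1 - t) * (1 - t)) *\<^sub>R Y x + ((1 - t) * t) *\<^sub>R (V1 *v (A2 *v Z x))
        + (t * (1 - t)) *\<^sub>R (V2 *v (A1 *v Y x)) + (t * t) *\<^sub>R Z x"
      unfolding T_def G matrix_vector_mult_add_rdistrib scaleR_matrix_vector_assoc[symmetric] Bv
        matrix_vector_right_distrib matrix_vector_mult_scaleR VA
      by (simp add: scaleR_add_right mult.commute add_ac)
    then show ?thesis by (simp add: q_def power2_eq_square scaleR_add_right mult.commute[of "1 - t" t])
  qed
  \<comment> \<open>\<open>R x\<close> is the coefficient of \<open>t\<^sup>2\<close> in the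
    expansion bound. All vectors in it are square integrable, so its mean \<open>C\<close> gives the
    error term.\<close>
  define R where "R x = ((norm (Y x))\<^sup>2 + 2 * (norm (a x))\<^sup>2 + 3 * (norm (w x))\<^sup>2) / 2" for x
  define C where "C = (\<integral>x. R x \<partial>\<mu>0)"
  have C: "0 \<le> C" by (simp add: C_def R_def)
  have acT: "absolutely_continuous lborel (distr \<mu>0 borel (T 0))" "absolutely_continuous lborel (distr \<mu>0 borel (T 1))"
    using ac \<mu>1 \<mu>2 by (simp_all add: T0 T1)
  let ?H1 = "rel_entropy \<mu>1 std_gaussian" and ?H2 = "rel_entropy \<mu>2 std_gaussian"
  let ?h = "\<lambda>\<mu>. entropy_density (exp 1) std_gaussian \<mu>"
  have geo: "absolutely_continuous lborel (distr \<mu>0 borel (T t))"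
      "AE x in \<mu>0. ?h (distr \<mu>0 borel (T t)) (T t x) \<le>
        (1 - t) * ?h (distr \<mu>0 borel (T 0)) (T 0 x) + t * ?h (distr \<mu>0 borel (T 1)) (T 1 x)
        + ((norm (T t x))\<^sup>2 / 2 - (1 - t) * ((norm (T 0 x))\<^sup>2 / 2) - t * ((norm (T 1 x))\<^sup>2 / 2))"
    if "0 \<le> t" "t \<le> 1" for t
    unfolding T_def
    by (rule entropy_density_along_geodesic[OF prob(1) sets0 ac(1) pot1 pot2 B acT[unfolded T_def] that])+
  let ?e1 = "\<lambda>t. t * (8 * sqrt 2 / c1) * \<beta> * igw_cost \<pi>12"
  let ?e2 = "\<lambda>t. t * (12 * sqrt 2 / c1) * \<beta> * (IGW \<mu>1 \<mu>0)\<^sup>2"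
  have nn: "0 \<le> ?e1 t" "0 \<le> ?e2 t" if "0 \<le> t" for t :: real
    using that \<beta>0 c1 by (simp_all add: cost12 gram_cost_nonneg)
  \<comment> \<open>The distance bound has the constants 12 and 8. The factor \<open>sqrt 2\<close>
    of the claim is at least 1 and multiplies nonnegative terms, so inserting it preserves the
    inequality.\<close>
  have errors: "t * (\<beta> * E) \<le> ?e1 t + ?e2 t" if t: "0 \<le> t" for t :: real
  proof -
    have s2: "1 \<le> sqrt (2 :: real)" by simp
    have n12: "0 \<le> igw_cost \<pi>12" and n01: "0 \<le> (IGW \<mu>1 \<mu>0)\<^sup>2" by (simp_all add: cost12 gram_cost_nonneg)
    have "12 * igw_cost \<pi>01 + 8 * igw_cost \<pi>12 \<le> sqrt 2 * (12 * (IGW \<mu>1 \<mu>0)\<^sup>2 + 8 * igw_cost \<pi>12)"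
      using mult_right_mono[OF s2, of "12 * (IGW \<mu>1 \<mu>0)\<^sup>2 + 8 * igw_cost \<pi>12"] IGW n12 n01 by simp
    then have "E \<le> sqrt 2 * (12 * (IGW \<mu>1 \<mu>0)\<^sup>2 + 8 * igw_cost \<pi>12) / c1"
      using E c1 by (meson divide_right_mono less_imp_le order_trans)
    then have "t * (\<beta> * E) \<le> t * (\<beta> * (sqrt 2 * (12 * (IGW \<mu>1 \<mu>0)\<^sup>2 + 8 * igw_cost \<pi>12) / c1))"
      using t \<beta>0 by (intro mult_left_mono) auto
    also have "\<dots> = ?e1 t + ?e2 t" using c1 by (simp add: field_simps)
    finally show ?thesis .
  qed
  have finite_case: "rel_entropy (\<nu> t) std_gaussian \<le> ereal (1 - t) * ?H1 + ereal t * ?H2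
      + ereal (?e1 t) + ereal (?e2 t) + ereal (C * t\<^sup>2)"
    if t: "0 \<le> t" "t \<le> 1" and fin: "?H1 \<noteq> \<infinity>" "?H2 \<noteq> \<infinity>" for t
  proof -
    have hm: "?h \<mu> \<in> borel_measurable borel" for \<mu> :: "(real^'n) measure"
      using measurable_entropy_density[of "exp 1" std_gaussian \<mu>]
      by (simp add: measurable_cong_sets[OF sets_std_gaussian refl])
    have i1: "integrable \<mu>0 (\<lambda>x. ?h \<mu>1 (Y x))" and i2: "integrable \<mu>0 (\<lambda>x. ?h \<mu>2 (Z x))"
      using rel_entropy_finiteD(1)[OF fin(1)] rel_entropy_finiteD(1)[OF fin(2)]
        integrable_distr_eq[OF YZm(1) hm[of \<mu>1]] integrable_distr_eq[OF YZm(2) hm[of \<mu>2]]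
      by (simp_all add: \<mu>1[symmetric] \<mu>2[symmetric])
    have H1: "?H1 = ereal (\<integral>x. ?h \<mu>1 (Y x) \<partial>\<mu>0)" and H2: "?H2 = ereal (\<integral>x. ?h \<mu>2 (Z x) \<partial>\<mu>0)"
      using rel_entropy_finiteD(2)[OF fin(1)] rel_entropy_finiteD(2)[OF fin(2)]
        integral_distr[OF YZm(1) hm[of \<mu>1]] integral_distr[OF YZm(2) hm[of \<mu>2]]
      by (simp_all add: \<mu>1[symmetric] \<mu>2[symmetric])
    \<comment> \<open>A pointwise majorant of the log-density at \<open>T t x\<close>: linear
      interpolation of the end points, the first-order term of the second moment, and the remainder.
      All parts are integrable once both entropies are finite.\<close>
    define K where "K x = (1 - t) * ?h \<mu>1 (Y x) + t * ?h \<mu>2 (Z x)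
        + (t * (Y x \<bullet> a x - (norm (Z x))\<^sup>2 / 2 + (norm (Y x))\<^sup>2 / 2) + t\<^sup>2 * R x)" for x
    have ints: "integrable \<mu>0 (\<lambda>x. Y x \<bullet> a x)" "integrable \<mu>0 (\<lambda>x. (norm (Z x))\<^sup>2)"
      "integrable \<mu>0 (\<lambda>x. (norm (Y x))\<^sup>2)" "integrable \<mu>0 R"
      using Y Z sq sq_integrable_inner[OF Y sq(1)] unfolding R_def by (simp_all add: sq_integrable_def)
    have "rel_entropy (\<nu> t) std_gaussian \<le> ereal (\<integral>x. K x \<partial>\<mu>0)"
      unfolding \<nu>T
    proof (rule rel_entropy_pushforward_le[OF prob(1) sets0 _ geo(1)[OF t]])
      show "T t \<in> borel_measurable borel"
        unfolding T_def using Gb by (intro measurable_compose[OF _ matb] borel_measurable_add borel_measurable_scaleR) auto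
      show "integrable \<mu>0 K" unfolding K_def using i1 i2 ints by simp
      show "AE x in \<mu>0. ?h (distr \<mu>0 borel (T t)) (T t x) \<le> K x"
        using geo(2)[OF t]
      proof eventually_elim
        case (elim x)
        have "(norm (T t x))\<^sup>2 / 2 - (1 - t) * ((norm (Y x))\<^sup>2 / 2) - t * ((norm (Z x))\<^sup>2 / 2)
            \<le> t * (Y x \<bullet> a x - (norm (Z x))\<^sup>2 / 2 + (norm (Y x))\<^sup>2 / 2) + t\<^sup>2 * R x"
          unfolding Texp a_def R_def w_def by (rule quadratic_expansion_bound[OF t])
        with elim show ?case unfolding T0 T1 \<mu>1[symmetric] \<mu>2[symmetric] K_def by linarith
      qed
    qed
    also have "(\<integral>x. K x \<partial>\<mu>0) = (1 - t) * (\<integral>x. ?h \<mu>1 (Y x) \<partial>\<mu>0) + t * (\<integral>x. ?h \<mu>2 (Z x) \<partial>\<mu>0)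
        + (t * ((\<integral>x. Y x \<bullet> a x \<partial>\<mu>0) - 1 / 2 * (\<integral>x. (norm (Z x))\<^sup>2 \<partial>\<mu>0) + 1 / 2 * (\<integral>x. (norm (Y x))\<^sup>2 \<partial>\<mu>0))
        + t\<^sup>2 * C)"
      unfolding K_def C_def using i1 i2 ints by simp
    also have "ereal \<dots> \<le> ereal ((1 - t) * (\<integral>x. ?h \<mu>1 (Y x) \<partial>\<mu>0) + t * (\<integral>x. ?h \<mu>2 (Z x) \<partial>\<mu>0)
        + ?e1 t + ?e2 t + C * t\<^sup>2)"
    proof -
      have "t * ((\<integral>x. Y x \<bullet> a x \<partial>\<mu>0) - 1 / 2 * (\<integral>x. (norm (Z x))\<^sup>2 \<partial>\<mu>0) + 1 / 2 * (\<integral>x. (norm (Y x))\<^sup>2 \<partial>\<mu>0)) \<le> t * (\<beta> * E)"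
        using mixed t(1) by (intro mult_left_mono) auto
      with errors[OF t(1)] show ?thesis by (simp add: mult.commute[of C])
    qed
    finally show ?thesis by (simp add: H1 H2)
  qed
  have main: "rel_entropy (\<nu> t) std_gaussian \<le> ereal (1 - t) * ?H1 + ereal t * ?H2
      + ereal (?e1 t) + ereal (?e2 t) + ereal (C * t\<^sup>2)"
    if "t \<in> {0..1}" for t
  proof -
    have t: "0 \<le> t" "t \<le> 1" using that by auto
    have nm: "?H1 \<noteq> - \<infinity>" "?H2 \<noteq> - \<infinity>" by (simp_all add: rel_entropy_def)
    \<comment> \<open>The end points are separate because \<open>0 * \<infinity> = 0\<close> in
      \<open>ereal\<close>: an infinite entropy with weight 0 drops out, and the bound rests on
      \<open>\<nu> 0 = \<mu>1\<close> and \<open>\<nu> 1 = \<mu>2\<close>. Strictly between, one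
      infinite entropy makes the right-hand side infinite, as neither entropy is
      \<open>- \<infinity>\<close>.\<close>
    consider "t = 0" | "t = 1" | "?H1 \<noteq> \<infinity>" "?H2 \<noteq> \<infinity>" | "0 < t" "t < 1" "?H1 = \<infinity> \<or> ?H2 = \<infinity>"
      using t by fastforce
    then show ?thesis
    proof cases
      case 1
      have "\<nu> 0 = \<mu>1" by (simp add: \<nu>T T0 \<mu>1[symmetric])
      with 1 show ?thesis by (simp add: zero_ereal_def[symmetric] one_ereal_def[symmetric])
    next
      case 2
      have "\<nu> 1 = \<mu>2" by (simp add: \<nu>T T1 \<mu>2[symmetric])
      moreover have "?H2 \<le> ?H2 + (ereal (?e1 1) + ereal (?e2 1) + ereal (C * 1\<^sup>2))"
        using nn[of 1] C by (intro ereal_le_add_self) simp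
      ultimately show ?thesis
        using 2 by (simp add: zero_ereal_def[symmetric] one_ereal_def[symmetric] add.assoc)
    next
      case 3
      then show ?thesis by (rule finite_case[OF t])
    next
      case 4
      then have "ereal (1 - t) * ?H1 + ereal t * ?H2 = \<infinity>"
        using nm by (cases ?H1; cases ?H2) auto
      then show ?thesis by (simp only: plus_ereal.simps ereal_less_eq(1))
    qed
  qed
  have "(\<lambda>t. C * t\<^sup>2) \<in> O[at_right 0](\<lambda>t. t\<^sup>2)" by simp
  with c1 main show ?thesis
    unfolding igw_cost_def by (intro conjI exI[of _ "\<lambda>t. C * t\<^sup>2"]) auto
qed


end
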